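(* Let $k \geq 3$ be an integer and let $G$ be a graph that does not contain two vertex-disjoint triangles. If \[ |H_{k}(G)| - |L_{k}(G)| \geq 2k, \] then $G$ contains $k$ pairwise vertex-disjoint cycles.
   Context: All graphs are finite and simple. For a graph $G$ and a positive integer $k$, $H_k(G)$ denotes the set of vertices of $G$ of degree at least $2k$, and $L_k(G)$ denotes the set of vertices of $G$ of degree at most $2k-2$. *)

theory Defs
  imports "Graph_Theory.Pair_Digraph" "HOL-Library.Disjoint_Sets"
begin

text \<open>
  A finite simple graph is a \<^locale>\<open>pair_graph\<close>: an edge is represented by its two opposite arcs.
  Hence the out-arcs of a vertex are in bijection with its incident edges, and
  \<^const>\<open>out_degree\<close> is the degree of the undirected graph.
\<close>

definition high_verts :: "nat \<Rightarrow> 'a pair_pre_digraph \<Rightarrow> 'a set" where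
  "high_verts k G = {v \<in> pverts G. out_degree (with_proj G) v \<ge> 2 * k}"

text \<open>The subtraction on the naturals is exact, since \<open>k\<close> is always positive.\<close>

definition low_verts :: "nat \<Rightarrow> 'a pair_pre_digraph \<Rightarrow> 'a set" where
  "low_verts k G = {v \<in> pverts G. out_degree (with_proj G) v \<le> 2 * k - 2}"

text \<open>
  The cycles of a symmetric digraph include the closed walks \<open>u, v, u\<close> that traverse one edge back
  and forth. Excluding these leaves exactly the cycles of the undirected graph, given with a
  starting point and an orientation.
\<close>

definition ugraph_cycle :: "'a pair_pre_digraph \<Rightarrow> ('a \<times> 'a) awalk \<Rightarrow> bool" where
  "ugraph_cycle G p \<longleftrightarrow> pre_digraph.cycle (with_proj G) p \<and> length p \<ge> 3"

definition triangle :: "'a pair_pre_digraph \<Rightarrow> ('a \<times> 'a) awalk \<Rightarrow> bool" where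
  "triangle G p \<longleftrightarrow> ugraph_cycle G p \<and> length p = 3"

text \<open>On a closed walk every vertex is the tail of some arc.\<close>

definition cycle_verts :: "('a \<times> 'a) awalk \<Rightarrow> 'a set" where
  "cycle_verts p = fst ` set p"

definition has_disjoint_cycles :: "nat \<Rightarrow> 'a pair_pre_digraph \<Rightarrow> bool" where
  "has_disjoint_cycles k G \<longleftrightarrow>
    (\<exists>C :: nat \<Rightarrow> ('a \<times> 'a) awalk.
      (\<forall>i<k. ugraph_cycle G (C i)) \<and> disjoint_family_on (\<lambda>i. cycle_verts (C i)) {..<k})"

end

theory Submission
  imports Defs
begin

text \<open>
  Give a vertex of degree \<open>d\<close> the sign of \<open>d + 1 - 2k\<close>; the hypothesis says that the signs sum up
  to at least \<open>2k\<close>. Deleting a cycle costs at most the signs on it as long as every other vertex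
  has at most two neighbours on it, since passing from \<open>k\<close> to \<open>k - 1\<close> lowers the thresholds by two.
  Contracting an edge \<open>xy\<close> without common neighbours at a low vertex \<open>x\<close> raises the sum by one, and
  disjoint cycles of the contracted graph lift back; it can only fail the triangle hypothesis if \<open>xy\<close>
  lies on a 4-cycle disjoint from some triangle.

  In a counterexample with the fewest vertices, deleting a triangle leaves a triangle-free graph, in
  which moreover one edge may be contracted, because all triangles created share the merged
  vertex. So every triangle carries three high vertices or lies in a \<open>K\<^sub>4\<close>. A \<open>K\<^sub>5\<close> is excluded
  directly. If no vertex is low, counting the neighbours of two adjacent vertices without common
  neighbour gives too many vertices. If \<open>x\<close> is low, the 4-cycle obtained from a failed contraction
  pins the structure down to a \<open>K\<^sub>4\<close> two of whose vertices are common neighbours of two neighbours of \<open>x\<close>,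
  and deletions of one or two cycles together with one low vertex finish the proof.

  The induction descends to \<open>k = 2\<close>, where the triangle hypothesis is replaced by the absence of a
  \<open>K\<^sub>5\<close> minus an edge.
\<close>

section \<open>Cores, packings and contractions\<close>

text \<open>Call \<open>slack\<close> the excess of the weight over \<open>2 * k\<close>. By
  minimality, deleting a cycle leaves weight at most \<open>2 * (k - 1) - 1\<close>; if no outer
  vertex loses sign, the cycle therefore weighs at least \<open>3 + slack\<close>. A triangle weighs
  at most 3, so every triangle balance is tight: one further gain, such as a contraction that
  becomes possible afterwards, is contradictory unless some outer vertex is adjacent to all three
  vertices. This is why K4 and the vertices attached to it govern the whole argument. A 4-cycle
  through a low vertex weighs at most 2, which is even less; but its deletion, unlike that of a
  triangle, need not leave a triangle-free graph. That obstacle arises only for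
  \<open>k = 3\<close>, where the induction lands at \<open>k = 2\<close>, and it accounts for the
  separate treatment of K5 and of K5 minus an edge.\<close>

definition dg :: "('a \<Rightarrow> 'a \<Rightarrow> bool) \<Rightarrow> 'a set \<Rightarrow> 'a \<Rightarrow> nat" where
  "dg A V v = card {u \<in> V. A v u}"

definition wgt :: "nat \<Rightarrow> nat \<Rightarrow> int" where
  "wgt k d = sgn (int d + 1 - 2 * int k)"

definition wt :: "('a \<Rightarrow> 'a \<Rightarrow> bool) \<Rightarrow> 'a set \<Rightarrow> nat \<Rightarrow> int" where
  "wt A V k = (\<Sum>v\<in>V. wgt k (dg A V v))"

text \<open>A finite graph contains a cycle iff it contains such a set, and sets are easier to delete and to
  lift along contractions than closed walks.\<close>

definition core :: "('a \<Rightarrow> 'a \<Rightarrow> bool) \<Rightarrow> 'a set \<Rightarrow> bool" where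
  "core A B \<longleftrightarrow> finite B \<and> B \<noteq> {} \<and> (\<forall>v\<in>B. 2 \<le> dg A B v)"

text \<open>Packing by successive deletion instead of an indexed family: the induction steps remove
  one core at a time. The family is recovered only at the very end.\<close>

fun packs :: "('a \<Rightarrow> 'a \<Rightarrow> bool) \<Rightarrow> 'a set \<Rightarrow> nat \<Rightarrow> bool" where
  "packs A V 0 = True"
| "packs A V (Suc k) = (\<exists>B\<subseteq>V. core A B \<and> packs A (V - B) k)"

text \<open>The contraction of the edge \<open>xy\<close>, to be used on a vertex set without \<open>x\<close>; the merged vertex is
  called \<open>y\<close>.\<close>

definition contr :: "('a \<Rightarrow> 'a \<Rightarrow> bool) \<Rightarrow> 'a \<Rightarrow> 'a \<Rightarrow> 'a \<Rightarrow> 'a \<Rightarrow> bool" where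
  "contr A x y u v \<longleftrightarrow> u \<noteq> v \<and> (A u v \<or> (u = y \<and> A x v) \<or> (v = y \<and> A x u))"

definition tri_meeting :: "('a \<Rightarrow> 'a \<Rightarrow> bool) \<Rightarrow> 'a set \<Rightarrow> bool" where
  "tri_meeting A V \<longleftrightarrow> (\<forall>P Q. P \<subseteq> V \<and> Q \<subseteq> V \<and> card P = 3 \<and> card Q = 3 \<and> pairwise A P \<and> pairwise A Q
     \<longrightarrow> P \<inter> Q \<noteq> {})"

text \<open>\<open>K\<^sub>5\<close> minus the edge \<open>st\<close>, where \<open>st\<close> may also be present.\<close>

definition K5m :: "('a \<Rightarrow> 'a \<Rightarrow> bool) \<Rightarrow> 'a set \<Rightarrow> bool" where
  "K5m A V \<longleftrightarrow> (\<exists>Q\<subseteq>V. card Q = 5 \<and>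
     (\<exists>s\<in>Q. \<exists>t\<in>Q. s \<noteq> t \<and> pairwise A (Q - {s}) \<and> pairwise A (Q - {t})))"

definition K5 :: "('a \<Rightarrow> 'a \<Rightarrow> bool) \<Rightarrow> 'a set \<Rightarrow> bool" where
  "K5 A V \<longleftrightarrow> (\<exists>Q\<subseteq>V. card Q = 5 \<and> pairwise A Q)"

text \<open>At \<open>k = 2\<close> the triangle hypothesis is too weak: a K5 with one edge
  subdivided has weight 4 and no two disjoint triangles, but no two disjoint cycles either.\<close>

definition admissible :: "nat \<Rightarrow> ('a \<Rightarrow> 'a \<Rightarrow> bool) \<Rightarrow> 'a set \<Rightarrow> bool" where
  "admissible k A V \<longleftrightarrow> (if k = 2 then \<not> K5m A V else tri_meeting A V)"

section \<open>Degrees into a vertex set\<close>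

lemma dg_empty [simp]: "dg A {} v = 0"
  by (simp add: dg_def)

lemma dg_insert [simp]:
  "finite B \<Longrightarrow> a \<notin> B \<Longrightarrow> dg A (insert a B) v = (if A v a then 1 else 0) + dg A B v"
proof -
  assume "finite B" "a \<notin> B"
  have "{u \<in> insert a B. A v u} = (if A v a then insert a {u \<in> B. A v u} else {u \<in> B. A v u})"
    by auto
  then show ?thesis using \<open>finite B\<close> \<open>a \<notin> B\<close> by (auto simp: dg_def)
qed

lemma dg_mono: "finite V \<Longrightarrow> B \<subseteq> V \<Longrightarrow> dg A B v \<le> dg A V v"
  unfolding dg_def by (rule card_mono) auto

lemma dg_le_card: "finite B \<Longrightarrow> dg A B v \<le> card B"
  unfolding dg_def by (rule card_mono) auto

lemma dg_Un: "finite B \<Longrightarrow> finite C \<Longrightarrow> B \<inter> C = {} \<Longrightarrow> dg A (B \<union> C) v = dg A B v + dg A C v"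
  unfolding dg_def by (subst card_Un_disjoint [symmetric]) (auto intro: arg_cong [where f = card])

lemma dg_split: "finite V \<Longrightarrow> B \<subseteq> V \<Longrightarrow> dg A V v = dg A (V - B) v + dg A B v"
proof -
  assume "finite V" "B \<subseteq> V"
  moreover from this have "V = (V - B) \<union> B" "finite B" by (auto intro: finite_subset)
  ultimately show ?thesis using dg_Un [of "V - B" B A v] by auto
qed

lemma dg_sum: "finite B \<Longrightarrow> dg A B v = (\<Sum>u\<in>B. if A v u then 1 else 0)"
  unfolding dg_def by (simp add: sum.If_cases Int_def)

lemma int_dg_sum: "finite B \<Longrightarrow> int (dg A B v) = (\<Sum>u\<in>B. if A v u then 1 else 0)"
  unfolding dg_def by (simp add: sum.If_cases Int_def)

lemma dg_double:
  assumes "finite B" "finite C" "symp A"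
  shows "(\<Sum>u\<in>B. dg A C u) = (\<Sum>v\<in>C. dg A B v)"
proof -
  have "(\<Sum>u\<in>B. dg A C u) = (\<Sum>u\<in>B. \<Sum>v\<in>C. if A u v then 1 else 0)"
    using assms by (simp add: dg_sum)
  also have "\<dots> = (\<Sum>v\<in>C. \<Sum>u\<in>B. if A u v then 1 else 0)" by (rule sum.swap)
  also have "\<dots> = (\<Sum>v\<in>C. \<Sum>u\<in>B. if A v u then 1 else 0)"
    using sympD [OF assms(3)] by (intro sum.cong) auto
  finally show ?thesis using assms by (simp add: dg_sum)
qed

lemma dg_cong: "(\<And>u. u \<in> B \<Longrightarrow> A v u = A' v u) \<Longrightarrow> dg A B v = dg A' B v"
  unfolding dg_def by (rule arg_cong [where f = card]) auto

lemma dg_pos: "finite B \<Longrightarrow> dg A B v > 0 \<longleftrightarrow> (\<exists>u\<in>B. A v u)"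
  unfolding dg_def by (auto simp: card_gt_0_iff)

lemma card_ge2E:
  assumes "2 \<le> card B"
  obtains u v where "u \<in> B" "v \<in> B" "u \<noteq> v"
proof -
  obtain S where "S \<subseteq> B" "card S = 2" using assms by (rule obtain_subset_with_card_n)
  then show ?thesis using that by (auto simp: card_2_iff)
qed

lemma dg_ge2E:
  assumes "2 \<le> dg A B v"
  obtains y p where "y \<in> B" "p \<in> B" "y \<noteq> p" "A v y" "A v p"
  using card_ge2E [of "{u \<in> B. A v u}"] assms that unfolding dg_def by blast

lemma dg_ge2I: "finite B \<Longrightarrow> y \<in> B \<Longrightarrow> p \<in> B \<Longrightarrow> y \<noteq> p \<Longrightarrow> A v y \<Longrightarrow> A v p \<Longrightarrow> 2 \<le> dg A B v"
  unfolding dg_def using card_mono [of "{u \<in> B. A v u}" "{y, p}"] by auto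

lemma dg_witness:
  assumes "finite C" "dg A C v < dg A B v"
  obtains u where "u \<in> B" "u \<notin> C" "A v u"
proof -
  have "\<not> {u \<in> B. A v u} \<subseteq> {u \<in> C. A v u}"
    using assms card_mono [of "{u \<in> C. A v u}" "{u \<in> B. A v u}"] unfolding dg_def by force
  then show ?thesis using that by blast
qed

section \<open>Cores and packings\<close>

lemma coreI: "finite B \<Longrightarrow> B \<noteq> {} \<Longrightarrow> (\<And>v. v \<in> B \<Longrightarrow> 2 \<le> dg A B v) \<Longrightarrow> core A B"
  by (simp add: core_def)

lemma core_tri:
  assumes "card T = 3" "pairwise A T"
  shows "core A T"
proof (rule coreI)
  show fin: "finite T" using assms(1) by (simp add: card_ge_0_finite)
  show "T \<noteq> {}" using assms(1) by auto
  fix v assume v: "v \<in> T"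
  have "{u \<in> T. A v u} \<supseteq> T - {v}" using assms(2) v by (auto simp: pairwise_def)
  then have "card (T - {v}) \<le> dg A T v" unfolding dg_def using fin by (intro card_mono) auto
  then show "2 \<le> dg A T v" using v fin assms(1) by simp
qed

lemma core_4:
  assumes "symp A" "irreflp A"
    "A x y" "A y q" "A q p" "A p x" "x \<noteq> q" "y \<noteq> p"
  shows "core A {x, y, q, p}"
proof (rule coreI)
  have r: "A y x" "A q y" "A p q" "A x p" using assms by (auto dest: sympD)
  have n: "x \<noteq> y" "y \<noteq> q" "q \<noteq> p" "p \<noteq> x" using assms irreflpD [of A] by auto
  fix v assume "v \<in> {x, y, q, p}"
  then consider "v = x" | "v = y" | "v = q" | "v = p" by auto
  then show "2 \<le> dg A {x, y, q, p} v"
  proof cases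
    case 1 then show ?thesis using assms(3-8) r n by (intro dg_ge2I [of _ y p]) auto
  next
    case 2 then show ?thesis using assms(3-8) r n by (intro dg_ge2I [of _ x q]) auto
  next
    case 3 then show ?thesis using assms(3-8) r n by (intro dg_ge2I [of _ y p]) auto
  next
    case 4 then show ?thesis using assms(3-8) r n by (intro dg_ge2I [of _ x q]) auto
  qed
qed auto

lemma core_cong: "(\<And>u v. u \<in> B \<Longrightarrow> v \<in> B \<Longrightarrow> A u v = A' u v) \<Longrightarrow> core A B = core A' B"
  unfolding core_def using dg_cong [of B A _ A'] by auto

lemma core_mono_rel: "core A' B \<Longrightarrow> (\<And>u v. A' u v \<Longrightarrow> A u v) \<Longrightarrow> core A B"
proof -
  assume c: "core A' B" and i: "\<And>u v. A' u v \<Longrightarrow> A u v"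
  have "dg A' B v \<le> dg A B v" for v
    using c i unfolding dg_def core_def by (intro card_mono) auto
  with c show ?thesis unfolding core_def using order_trans by blast
qed

lemma packs_mono: "packs A V k \<Longrightarrow> V \<subseteq> V' \<Longrightarrow> packs A V' k"
proof (induction k arbitrary: V V')
  case (Suc k)
  then obtain B where B: "B \<subseteq> V" "core A B" "packs A (V - B) k" by auto
  then have "packs A (V' - B) k" using Suc.IH [of "V - B" "V' - B"] Suc.prems(2) by blast
  then show ?case using B Suc.prems(2) by auto
qed simp

lemma packs_mono_rel: "packs A' V k \<Longrightarrow> (\<And>u v. A' u v \<Longrightarrow> A u v) \<Longrightarrow> packs A V k"
proof (induction k arbitrary: V)
  case (Suc k)
  then obtain B where "B \<subseteq> V" "core A' B" "packs A' (V - B) k" by auto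
  then show ?case using Suc core_mono_rel [of A' B A] by auto
qed simp

lemma packs_cong:
  "(\<And>u v. u \<in> V \<Longrightarrow> v \<in> V \<Longrightarrow> A u v = A' u v) \<Longrightarrow> packs A V k = packs A' V k"
proof (induction k arbitrary: V)
  case (Suc k)
  have "core A B = core A' B" if "B \<subseteq> V" for B
    using that Suc.prems by (intro core_cong) auto
  moreover have "packs A (V - B) k = packs A' (V - B) k" if "B \<subseteq> V" for B
    by (rule Suc.IH) (use Suc.prems in auto)
  ultimately show ?case by auto
qed simp

lemma packs_add:
  assumes "core A B" "B \<subseteq> V" "packs A U k" "U \<subseteq> V - B"
  shows "packs A V (Suc k)"
  using assms(1,2) packs_mono [OF assms(3,4)] by auto

section \<open>Sets without a core, that is, forests\<close>

lemma coreless_low: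
  assumes "finite F" "F \<noteq> {}" "\<And>B. B \<subseteq> F \<Longrightarrow> \<not> core A B"
  obtains v where "v \<in> F" "dg A F v \<le> 1"
  using assms(1,2) assms(3) [of F] unfolding core_def by (auto simp: not_le) (metis One_nat_def Suc_1 less_Suc_eq_le)

lemma dg_remove:
  assumes "finite F" "v \<in> F"
  shows "dg A F u = dg A (F - {v}) u + (if A u v then 1 else 0)"
  using dg_insert [of "F - {v}" v A u] assms by (simp add: insert_absorb)

text \<open>A nonempty forest has fewer edges than vertices, and the degree sum counts every edge
  twice.\<close>

lemma coreless_edges:
  assumes "finite F" "F \<noteq> {}" "\<And>B. B \<subseteq> F \<Longrightarrow> \<not> core A B"
    and S: "symp A" and I: "irreflp A"
  shows "(\<Sum>v\<in>F. dg A F v) + 2 \<le> 2 * card F"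
  using assms(1-3)
proof (induction "card F" arbitrary: F)
  case 0 then show ?case by simp
next
  case (Suc n)
  note sym = sympD [OF S]
  note irr = irreflpD [OF I]
  obtain v where v: "v \<in> F" "dg A F v \<le> 1" using coreless_low Suc.prems by metis
  define F' where "F' = F - {v}"
  have F: "F = insert v F'" "v \<notin> F'" "finite F'" using v Suc.prems by (auto simp: F'_def)
  have cF: "card F = Suc (card F')" using F by simp
  have dv: "dg A F v = dg A F' v" using F irr by simp
  have "(\<Sum>u\<in>F. dg A F u) = dg A F v + (\<Sum>u\<in>F'. dg A F u)" using F by simp
  also have "(\<Sum>u\<in>F'. dg A F u) = (\<Sum>u\<in>F'. (if A v u then 1 else 0) + dg A F' u)"
    using F sym by (intro sum.cong) auto
  also have "\<dots> = dg A F' v + (\<Sum>u\<in>F'. dg A F' u)" using F by (simp add: sum.distrib dg_sum)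
  finally have s: "(\<Sum>u\<in>F. dg A F u) = 2 * dg A F v + (\<Sum>u\<in>F'. dg A F' u)" using dv by simp
  show ?case
  proof (cases "F' = {}")
    case True then show ?thesis using s cF dv by simp
  next
    case False
    have "(\<Sum>v\<in>F'. dg A F' v) + 2 \<le> 2 * card F'"
      using False Suc.prems F cF Suc.hyps(2) by (intro Suc.hyps(1)) auto
    then show ?thesis using s cF v by simp
  qed
qed

text \<open>In a forest the vertices of degree at most 1 outnumber those of degree at least 3 by
  two: attaching a leaf contributes -1 and raises at most one other sign, by at most 1. A single
  vertex would give only -1, hence the bound on the cardinality.\<close>

lemma coreless_sgn:
  assumes "finite F" "2 \<le> card F" "\<And>B. B \<subseteq> F \<Longrightarrow> \<not> core A B"
    and S: "symp A" and I: "irreflp A"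
  shows "(\<Sum>v\<in>F. sgn (int (dg A F v) - 2)) \<le> -2"
  using assms(1-3)
proof (induction "card F" arbitrary: F)
  case 0 then show ?case by simp
next
  case (Suc n)
  note sym = sympD [OF S]
  note irr = irreflpD [OF I]
  have ne: "F \<noteq> {}" using Suc.prems by auto
  obtain v where v: "v \<in> F" "dg A F v \<le> 1" using coreless_low Suc.prems ne by metis
  define F' where "F' = F - {v}"
  have F: "F = insert v F'" "v \<notin> F'" "finite F'" using v Suc.prems by (auto simp: F'_def)
  have cF: "card F = Suc (card F')" using F by simp
  have dv: "dg A F v = dg A F' v" using F irr by simp
  have s: "(\<Sum>u\<in>F. sgn (int (dg A F u) - 2)) = -1 + (\<Sum>u\<in>F'. sgn (int (dg A F u) - 2))"
    using F v by (simp add: sgn_if)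
  have "(\<Sum>u\<in>F'. sgn (int (dg A F u) - 2))
      \<le> (\<Sum>u\<in>F'. sgn (int (dg A F' u) - 2) + (if A v u then 1 else 0))"
    using F sym by (intro sum_mono) (auto simp: sgn_if)
  also have "\<dots> = (\<Sum>u\<in>F'. sgn (int (dg A F' u) - 2)) + int (dg A F' v)"
    using F by (simp add: sum.distrib int_dg_sum)
  finally have t: "(\<Sum>u\<in>F. sgn (int (dg A F u) - 2)) \<le> (\<Sum>u\<in>F'. sgn (int (dg A F' u) - 2))"
    using s v dv by simp
  show ?case
  proof (cases "2 \<le> card F'")
    case True
    have "(\<Sum>v\<in>F'. sgn (int (dg A F' v) - 2)) \<le> -2"
      using True Suc.prems F cF Suc.hyps(2) by (intro Suc.hyps(1)) auto
    then show ?thesis using t by simp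
  next
    case False
    then have "card F' = 1" using Suc.prems cF by simp
    then obtain u where u: "F' = {u}" by (auto simp: card_1_singleton_iff)
    then show ?thesis using s F irr by (auto simp: sgn_if)
  qed
qed

section \<open>Triangles, K5 and K5 minus an edge\<close>

lemma tri_meeting_mono: "tri_meeting A V \<Longrightarrow> U \<subseteq> V \<Longrightarrow> tri_meeting A U"
  unfolding tri_meeting_def by (meson order_trans)

lemma K5m_mono: "K5m A U \<Longrightarrow> U \<subseteq> V \<Longrightarrow> K5m A V"
  unfolding K5m_def by (meson order_trans)

lemma K5_mono: "K5 A U \<Longrightarrow> U \<subseteq> V \<Longrightarrow> K5 A V"
  unfolding K5_def by (meson order_trans)

lemma pairwise_tri:
  "symp A \<Longrightarrow> A a b \<Longrightarrow> A a c \<Longrightarrow> A b c \<Longrightarrow> pairwise A {a, b, c}"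
  by (auto simp: pairwise_def dest: sympD)

lemma K5mE:
  assumes "K5m A V"
  obtains a b c s t where "{a, b, c, s, t} \<subseteq> V" "distinct [a, b, c, s, t]"
    "pairwise A {a, b, c, s}" "pairwise A {a, b, c, t}"
proof -
  obtain Q s t where Q: "Q \<subseteq> V" "card Q = 5" "s \<in> Q" "t \<in> Q" "s \<noteq> t"
    "pairwise A (Q - {s})" "pairwise A (Q - {t})" using assms unfolding K5m_def by auto
  have "finite Q" using Q(2) by (simp add: card_ge_0_finite)
  then have "card (Q - {s, t}) = 3" using Q by (simp add: card_Diff_subset)
  then obtain a b c where abc: "Q - {s, t} = {a, b, c}" "a \<noteq> b" "a \<noteq> c" "b \<noteq> c"
    by (auto simp: card_3_iff)
  have "Q - {s} = {a, b, c, t}" "Q - {t} = {a, b, c, s}" "Q = {a, b, c, s, t}"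
    using abc Q by auto
  moreover have "a \<notin> {s,t}" "b \<notin> {s,t}" "c \<notin> {s,t}" using abc by auto
  ultimately show ?thesis using that [of a b c s t] Q abc by simp
qed

text \<open>The four triangles of a K4 have no common vertex. This keeps contractions of
  triangle-free graphs admissible, since there every new triangle passes through the merged
  vertex.\<close>

lemma apex_no_K5m:
  assumes "\<And>P. P \<subseteq> V \<Longrightarrow> card P = 3 \<Longrightarrow> pairwise A P \<Longrightarrow> y \<in> P"
  shows "\<not> K5m A V"
proof
  assume "K5m A V"
  then obtain a b c s t where Q: "{a, b, c, s, t} \<subseteq> V" "distinct [a, b, c, s, t]"
    "pairwise A {a, b, c, s}" by (rule K5mE)
  have "y \<in> {a, b, c}" "y \<in> {a, b, s}" "y \<in> {a, c, s}" "y \<in> {b, c, s}"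
    by (rule assms; use Q in \<open>auto intro: pairwise_subset\<close>)+
  then show False using Q by auto
qed

lemma apex_admissible:
  assumes "\<And>P. P \<subseteq> V \<Longrightarrow> card P = 3 \<Longrightarrow> pairwise A P \<Longrightarrow> y \<in> P"
  shows "admissible k A V"
  unfolding admissible_def tri_meeting_def using apex_no_K5m [of V A y] assms by (auto split: if_splits) blast

section \<open>Contraction of an edge\<close>

lemma contr_symp: "symp A \<Longrightarrow> symp (contr A x y)"
  by (auto simp: contr_def symp_def)

lemma contr_irreflp: "irreflp (contr A x y)"
  by (simp add: contr_def irreflp_def)

lemma contr_eq: "irreflp A \<Longrightarrow> u \<noteq> y \<Longrightarrow> v \<noteq> y \<Longrightarrow> contr A x y u v = A u v"
  by (auto simp: contr_def dest: irreflpD)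

text \<open>The merged vertex is replaced by \<open>x\<close>, by \<open>y\<close> or by both,
  according to which of them has neighbours in the rest of the core. If both have, the edge
  \<open>xy\<close> supplies the second neighbour of each.\<close>

lemma contr_core:
  assumes B: "core (contr A x y) B" "x \<notin> B" "y \<in> B" and xy: "A x y"
    and S: "symp A" and I: "irreflp A"
  shows "\<exists>B'\<subseteq>insert x B. core A B'"
proof -
  note sym = sympD [OF S]
  note irr = irreflpD [OF I]
  have fin: "finite B" using B by (simp add: core_def)
  have d: "2 \<le> dg (contr A x y) B v" if "v \<in> B" for v using B that by (simp add: core_def)
  define P where "P = {v \<in> B - {y}. A x v}"
  define R where "R = {v \<in> B - {y}. A y v}"
  have yn: "{v \<in> B. contr A x y y v} = P \<union> R"
    using irr by (auto simp: contr_def P_def R_def)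
  \<comment> \<open>An edge from \<open>v\<close> to the merged vertex that stems from
    \<open>x\<close> is charged to \<open>x\<close> itself.\<close>
  have dgv: "dg (contr A x y) B v \<le> dg A (insert x B) v" if "v \<in> B" "v \<noteq> y" for v
  proof -
    have "{u \<in> B. contr A x y v u} \<subseteq> {u \<in> B. A v u} \<union> (if A v x then {y} else {})"
      using that sym by (auto simp: contr_def)
    then have "dg (contr A x y) B v \<le> card ({u \<in> B. A v u} \<union> (if A v x then {y} else {}))"
      unfolding dg_def using fin by (intro card_mono) auto
    also have "\<dots> \<le> card {u \<in> B. A v u} + card (if A v x then {y} else {})" by (rule card_Un_le)
    also have "\<dots> = dg A (insert x B) v" using fin B(2) by (simp add: dg_def [symmetric])
    finally show ?thesis .
  qed
  show ?thesis
  proof (cases "P = {}")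
    case True
    have "core A B"
    proof (rule coreI)
      fix v assume v: "v \<in> B"
      have "{u \<in> B. contr A x y v u} \<subseteq> {u \<in> B. A v u}"
        using True v sym by (auto simp: contr_def P_def)
      then have "dg (contr A x y) B v \<le> dg A B v" unfolding dg_def using fin by (intro card_mono) auto
      then show "2 \<le> dg A B v" using d [OF v] by simp
    qed (use fin B in auto)
    then show ?thesis by auto
  next
    case nP: False
    show ?thesis
    proof (cases "R = {}")
      case True
      have "core A (insert x (B - {y}))"
      proof (rule coreI)
        fix v assume v: "v \<in> insert x (B - {y})"
        show "2 \<le> dg A (insert x (B - {y})) v"
        proof (cases "v = x")
          case True
          have "card P \<ge> 2" using d [OF B(3)] yn \<open>R = {}\<close> by (simp add: dg_def)
          also have "card P \<le> dg A (insert x (B - {y})) v"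
            unfolding dg_def using fin True by (intro card_mono) (auto simp: P_def)
          finally show ?thesis .
        next
          case False
          then have vB: "v \<in> B" "v \<noteq> y" using v by auto
          then have "\<not> A v y" using \<open>R = {}\<close> sym by (auto simp: R_def)
          then have "dg A (insert x B) v = dg A (insert x (B - {y})) v"
            using fin B dg_remove [of B y A v] by simp
          then show ?thesis using dgv [OF vB] d [OF vB(1)] by simp
        qed
      qed (use fin in auto)
      moreover have "insert x (B - {y}) \<subseteq> insert x B" by auto
      ultimately show ?thesis by blast
    next
      case False
      obtain a b where ab: "a \<in> P" "b \<in> R" using nP False by auto
      have "core A (insert x B)"
      proof (rule coreI)
        fix v assume v: "v \<in> insert x B"
        consider "v = x" | "v = y" | "v \<in> B" "v \<noteq> y" using v by auto
        then show "2 \<le> dg A (insert x B) v"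
        proof cases
          case 1 then show ?thesis using ab xy B(3) fin by (intro dg_ge2I [of _ a y]) (auto simp: P_def)
        next
          case 2 then show ?thesis using ab xy sym B fin by (intro dg_ge2I [of _ b x]) (auto simp: R_def)
        next
          case 3 then show ?thesis using dgv [OF 3] d [OF 3(1)] by simp
        qed
      qed (use fin in auto)
      then show ?thesis by auto
    qed
  qed
qed

text \<open>At most one core of the packing contains the merged vertex. Only that one has to be
  lifted, and the vertex \<open>x\<close> that it may absorb is used by no other.\<close>

lemma contr_packs:
  assumes "packs (contr A x y) V k" "x \<notin> V" "A x y"
    and S: "symp A" and I: "irreflp A"
  shows "packs A (insert x V) k"
  using assms(1,2)
proof (induction k arbitrary: V)
  case (Suc k)
  obtain B where B: "B \<subseteq> V" "core (contr A x y) B" "packs (contr A x y) (V - B) k" using Suc.prems by auto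
  show ?case
  proof (cases "y \<in> B")
    case True
    obtain B' where B': "B' \<subseteq> insert x B" "core A B'"
      using contr_core [of A x y B] B Suc.prems(2) True assms by blast
    have "packs A (V - B) k"
    proof (subst packs_cong)
      fix u v assume "u \<in> V - B" "v \<in> V - B"
      then show "A u v = contr A x y u v" using contr_eq [of A u y v x] I True by auto
    qed (rule B(3))
    moreover have "V - B \<subseteq> insert x V - B'" "B' \<subseteq> insert x V" using B B' Suc.prems(2) by auto
    ultimately show ?thesis using packs_add [OF B'(2), of "insert x V" "V - B" k] by blast
  next
    case False
    have "core A B"
    proof (subst core_cong)
      fix u v assume "u \<in> B" "v \<in> B"
      then show "A u v = contr A x y u v" using contr_eq [of A u y v x] I False by auto
    qed (rule B(2))
    moreover have "packs A (insert x (V - B)) k" using Suc B by blast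
    moreover have "insert x (V - B) \<subseteq> insert x V - B" "B \<subseteq> insert x V" using B Suc.prems by auto
    ultimately show ?thesis using packs_add [of A B "insert x V" "insert x (V - B)" k] by simp
  qed
qed simp

text \<open>Without common neighbours the two neighbourhoods merge disjointly; the 2 stands for the
  two ends of the contracted edge.\<close>

lemma contr_dg_y:
  assumes "finite V" "x \<in> V" "y \<in> V" "A x y"
    and S: "symp A" and I: "irreflp A"
    and nc: "\<And>z. z \<in> V \<Longrightarrow> A x z \<Longrightarrow> \<not> A y z"
  shows "dg (contr A x y) (V - {x}) y + 2 = dg A V x + dg A V y"
proof -
  note sym = sympD [OF S]
  note irr = irreflpD [OF I]
  have "{u \<in> V - {x}. contr A x y y u} = ({u \<in> V. A x u} - {y}) \<union> ({u \<in> V. A y u} - {x})"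
    using irr nc assms(4) sym [OF assms(4)] by (auto simp: contr_def)
  moreover have "({u \<in> V. A x u} - {y}) \<inter> ({u \<in> V. A y u} - {x}) = {}" using nc by auto
  ultimately have "dg (contr A x y) (V - {x}) y = card ({u \<in> V. A x u} - {y}) + card ({u \<in> V. A y u} - {x})"
    unfolding dg_def using assms(1) by (simp add: card_Un_disjoint)
  moreover have "card ({u \<in> V. A x u} - {y}) + 1 = dg A V x"
    unfolding dg_def using assms(1,3,4) card_Suc_Diff1 [of "{u \<in> V. A x u}" y] by simp
  moreover have "card ({u \<in> V. A y u} - {x}) + 1 = dg A V y"
    unfolding dg_def using assms(1,2) sym [OF assms(4)] card_Suc_Diff1 [of "{u \<in> V. A y u}" x] by simp
  ultimately show ?thesis by simp
qed

lemma contr_dg_other: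
  assumes "finite V" "x \<in> V" "y \<in> V" "A x y" "v \<in> V" "v \<noteq> x" "v \<noteq> y"
    and S: "symp A" and I: "irreflp A"
    and nc: "\<And>z. z \<in> V \<Longrightarrow> A x z \<Longrightarrow> \<not> A y z"
  shows "dg (contr A x y) (V - {x}) v = dg A V v"
proof (cases "A x v")
  case True
  note sym = sympD [OF S]
  note irr = irreflpD [OF I]
  have nyv: "\<not> A v y" using True nc [of v] assms(5) sym [of v y] by blast
  have "{u \<in> V - {x}. contr A x y v u} = insert y ({u \<in> V. A v u} - {x})"
    using assms(3-7) True irr sym [OF True] by (auto simp: contr_def)
  then have "dg (contr A x y) (V - {x}) v = Suc (card ({u \<in> V. A v u} - {x}))"
    unfolding dg_def using assms(1) nyv by simp
  also have "\<dots> = dg A V v" unfolding dg_def using assms(1,2) sym [OF True] card_Suc_Diff1 [of "{u \<in> V. A v u}" x] by simp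
  finally show ?thesis .
next
  case False
  note sym = sympD [OF S]
  note irr = irreflpD [OF I]
  then have "{u \<in> V - {x}. contr A x y v u} = {u \<in> V. A v u}"
    using False assms(6,7) sym [of v x] irr by (auto simp: contr_def)
  then show ?thesis by (simp add: dg_def)
qed

text \<open>Since \<open>x\<close> has degree at least 2, the merged vertex has at least the degree
  of \<open>y\<close>, and without common neighbours all other degrees are kept. So only the weight
  of \<open>x\<close> disappears, which is a gain if \<open>x\<close> is low.\<close>

lemma contr_wt:
  assumes "finite V" "x \<in> V" "y \<in> V" "A x y"
    and S: "symp A" and I: "irreflp A"
    and nc: "\<And>z. z \<in> V \<Longrightarrow> A x z \<Longrightarrow> \<not> A y z" and d: "2 \<le> dg A V x"
  shows "wt (contr A x y) (V - {x}) k \<ge> wt A V k - wgt k (dg A V x)"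
proof -
  have "wt (contr A x y) (V - {x}) k \<ge> (\<Sum>v\<in>V - {x}. wgt k (dg A V v))"
    unfolding wt_def
  proof (rule sum_mono)
    fix v assume v: "v \<in> V - {x}"
    show "wgt k (dg A V v) \<le> wgt k (dg (contr A x y) (V - {x}) v)"
    proof (cases "v = y")
      case True
      have "dg A V y \<le> dg (contr A x y) (V - {x}) y"
        using contr_dg_y [OF assms(1-4) S I nc] d by simp
      then show ?thesis using True by (auto simp: wgt_def sgn_if)
    next
      case False
      then show ?thesis using contr_dg_other [OF assms(1-4) _ _ _ S I nc, of v] v by simp
    qed
  qed
  moreover have "wt A V k = wgt k (dg A V x) + (\<Sum>v\<in>V - {x}. wgt k (dg A V v))"
    unfolding wt_def using assms(1,2) by (simp add: sum.remove)
  ultimately show ?thesis by linarith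
qed

lemma delete_wt:
  assumes "finite V" "x \<in> V" "symp A" "irreflp A"
    and "\<And>v. v \<in> V - {x} \<Longrightarrow> wgt k (dg A V v) - c v \<le> wgt k (dg A (V - {x}) v)"
  shows "wt A (V - {x}) k \<ge> wt A V k - wgt k (dg A V x) - (\<Sum>v\<in>V - {x}. c v)"
proof -
  have "wt A (V - {x}) k \<ge> (\<Sum>v\<in>V - {x}. wgt k (dg A V v) - c v)"
    unfolding wt_def by (rule sum_mono) (use assms(5) in auto)
  moreover have "wt A V k = wgt k (dg A V x) + (\<Sum>v\<in>V - {x}. wgt k (dg A V v))"
    unfolding wt_def using assms(1,2) by (simp add: sum.remove)
  ultimately show ?thesis by (simp add: sum_subtractf)
qed

lemma wgt_Suc: "wgt k (Suc d) - 1 \<le> wgt k d"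
  by (auto simp: wgt_def sgn_if)

text \<open>The weight -1 of the deleted vertex pays for the loss at its only possible
  neighbour.\<close>

lemma delete_leaf_wt:
  assumes "finite V" "x \<in> V" "symp A" "irreflp A" "dg A V x \<le> 1" "k \<ge> 2"
  shows "wt A (V - {x}) k \<ge> wt A V k"
proof -
  have "wt A (V - {x}) k \<ge> wt A V k - wgt k (dg A V x) - (\<Sum>v\<in>V - {x}. if A x v then 1 else 0)"
  proof (rule delete_wt)
    fix v assume "v \<in> V - {x}"
    then show "wgt k (dg A V v) - (if A x v then 1 else 0) \<le> wgt k (dg A (V - {x}) v)"
      using dg_remove [OF assms(1,2), of A v] sympD [OF assms(3), of x v] wgt_Suc [of k "dg A (V - {x}) v"]
        sympD [OF assms(3), of v x] by auto
  qed (use assms(1-4) in auto)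
  moreover have "(\<Sum>v\<in>V - {x}. if A x v then 1 else 0) = int (dg A V x)"
    using dg_remove [OF assms(1,2), of A x] assms(1) irreflpD [OF assms(4)] by (simp add: int_dg_sum)
  moreover have "wgt k (dg A V x) = -1" using assms(5,6) by (simp add: wgt_def)
  ultimately show ?thesis using assms(5) by linarith
qed

section \<open>Two disjoint cores\<close>

lemma packs_2I:
  assumes "core A B" "core A C" "B \<subseteq> V" "C \<subseteq> V" "B \<inter> C = {}"
  shows "packs A V 2"
proof -
  have "C \<subseteq> V - B" using assms by auto
  then show ?thesis using assms(1-3) by (auto simp: numeral_2_eq_2)
qed

text \<open>The forest bound for \<open>insert r W\<close> with the edges at \<open>r\<close>
  counted apart, so that the bounds for several \<open>r\<close> over the same \<open>W\<close> can
  be added.\<close>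

lemma coreless_insert:
  assumes "finite W" "r \<notin> W" "\<And>B. B \<subseteq> insert r W \<Longrightarrow> \<not> core A B"
    and S: "symp A" and I: "irreflp A"
  shows "2 * dg A W r + (\<Sum>v\<in>W. dg A W v) \<le> 2 * card W"
proof -
  note sym = sympD [OF S]
  note irr = irreflpD [OF I]
  have "(\<Sum>v\<in>insert r W. dg A (insert r W) v) + 2 \<le> 2 * card (insert r W)"
    by (rule coreless_edges [OF _ _ assms(3) S I]) (use assms(1) in auto)
  moreover have "(\<Sum>v\<in>W. dg A (insert r W) v) = (\<Sum>v\<in>W. (if A r v then 1 else 0) + dg A W v)"
  proof (rule sum.cong)
    fix v assume "v \<in> W"
    show "dg A (insert r W) v = (if A r v then 1 else 0) + dg A W v"
      using assms(1,2) sym [of r v] sym [of v r] by auto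
  qed simp
  moreover have "\<dots> = dg A W r + (\<Sum>v\<in>W. dg A W v)"
    using assms(1) by (simp add: sum.distrib dg_sum)
  ultimately show ?thesis using assms(1,2) irr by simp
qed

lemma card3E:
  assumes "card P = 3"
  obtains a b c where "P = {a, b, c}" "a \<noteq> b" "a \<noteq> c" "b \<noteq> c"
  using assms by (auto simp: card_3_iff)

lemma dg_full:
  assumes "finite W" "dg A W i = card W" "w \<in> W"
  shows "A i w"
  using card_subset_eq [of W "{u \<in> W. A i u}"] assms unfolding dg_def by auto

lemma nbs_subset_full:
  assumes "finite S" "\<And>u. u \<in> V \<Longrightarrow> A v u \<Longrightarrow> u \<in> S" "card S \<le> dg A V v" "s \<in> S"
  shows "A v s"
proof -
  have "{u \<in> V. A v u} \<subseteq> S" using assms(2) by auto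
  then show ?thesis using card_seteq [of S "{u \<in> V. A v u}"] assms unfolding dg_def by auto
qed

lemma contr_triangle:
  assumes "P \<subseteq> V - {x}" "card P = 3" "pairwise (contr A x y) P" "y \<notin> P"
  shows "pairwise A P"
  using assms by (auto simp: pairwise_def contr_def)

lemma disjoint_nbs_card:
  assumes "finite V" "{u \<in> V. A x u} \<inter> {u \<in> V. A y u} = {}"
  shows "dg A V x + dg A V y \<le> card V"
proof -
  have "card ({u \<in> V. A x u} \<union> {u \<in> V. A y u}) \<le> card V" by (rule card_mono) (use assms in auto)
  then show ?thesis using assms by (simp add: card_Un_disjoint dg_def)
qed

lemma wt2_dense:
  assumes "finite V" "\<And>v. v \<in> V \<Longrightarrow> 3 \<le> dg A V v"
  shows "wt A V 2 = int (card {v \<in> V. 4 \<le> dg A V v})"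
proof -
  have "wt A V 2 = (\<Sum>v\<in>V. if 4 \<le> dg A V v then 1 else 0)"
    unfolding wt_def by (rule sum.cong) (use assms in \<open>force simp: wgt_def sgn_if\<close>)+
  then show ?thesis using assms(1) by (simp add: sum.If_cases Int_def)
qed

text \<open>The conclusion for \<open>k = 2\<close> is graded by the excess because contracting an edge at a low vertex
  raises the excess by one and may turn a \<open>K\<^sub>5\<close> minus an edge into a \<open>K\<^sub>5\<close>.\<close>

definition dense2 :: "('a \<Rightarrow> 'a \<Rightarrow> bool) \<Rightarrow> 'a set \<Rightarrow> bool" where
  "dense2 A V \<longleftrightarrow> wt A V 2 \<le> 5 \<and> K5m A V \<and> (5 \<le> wt A V 2 \<longrightarrow> K5 A V) \<and>
     ((\<forall>v\<in>V. 3 \<le> dg A V v) \<longrightarrow> card V = 5)"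

lemma K5_K5m: "K5 A V \<Longrightarrow> K5m A V"
proof -
  assume "K5 A V"
  then obtain Q where Q: "Q \<subseteq> V" "card Q = 5" "pairwise A Q" by (auto simp: K5_def)
  obtain s t where "s \<in> Q" "t \<in> Q" "s \<noteq> t" using card_ge2E [of Q] Q(2) by auto
  moreover have "pairwise A (Q - {s})" "pairwise A (Q - {t})" using Q(3) by (auto intro: pairwise_subset)
  ultimately show ?thesis using Q unfolding K5m_def by blast
qed

text \<open>Removing the triangle leaves a forest, whose vertex of degree at most 1 must be adjacent
  to the whole triangle. Removing any of the four triangles of the resulting K4 also leaves a
  forest; the four bounds together make the rest independent and completely joined to the K4, and
  two vertices there would give two disjoint triangles.\<close>

lemma two_cores_min4:
  assumes fin: "finite V" and S: "symp A" and I: "irreflp A"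
    and np: "\<not> packs A V 2" and d4: "\<And>v. v \<in> V \<Longrightarrow> 4 \<le> dg A V v"
    and P: "P \<subseteq> V" "card P = 3" "pairwise A P"
  shows "dense2 A V"
proof -
  note sym = sympD [OF S]
  note irr = irreflpD [OF I]
  obtain a b c where abc: "P = {a, b, c}" "a \<noteq> b" "a \<noteq> c" "b \<noteq> c" using P(2) by (rule card3E)
  have ad: "A a b" "A a c" "A b c" using P(3) abc by (auto simp: pairwise_def)
  have cl: "\<not> core A B" if "B \<subseteq> V - P'" "P' \<subseteq> V" "card P' = 3" "pairwise A P'" for B P'
    using np packs_2I [of A P' B V] core_tri [of P' A] that by blast
  have neF: "V - P \<noteq> {}"
  proof
    assume "V - P = {}"
    then have "V = P" using P by auto
    then have "dg A V a \<le> 3" using dg_le_card [OF fin, of A a] P by simp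
    then show False using d4 [of a] P abc by simp
  qed
  obtain u where u: "u \<in> V - P" "dg A (V - P) u \<le> 1"
  proof (rule coreless_low [of "V - P" A])
    show "\<not> core A B" if "B \<subseteq> V - P" for B using cl [OF that P] .
  qed (use fin neF in auto)
  have duP: "dg A P u = 3"
    using dg_split [OF fin P(1), of A u] u d4 [of u] dg_le_card [of P A u] abc by simp
  have "A u w" if "w \<in> P" for w
    by (rule dg_full [OF _ _ that]) (use duP P(2) abc(1) in simp_all)
  then have uabc: "A u a" "A u b" "A u c" using abc(1) by simp_all
  define K where "K = {a, b, c, u}"
  have uP: "u \<noteq> a" "u \<noteq> b" "u \<noteq> c" "u \<in> V" using u abc by auto
  have KV: "K \<subseteq> V" "card K = 4" using P abc u by (auto simp: K_def)
  have Kpw: "pairwise A K" unfolding K_def pairwise_def using ad uabc sym by blast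
  define W where "W = V - K"
  have W: "finite W" "K \<inter> W = {}" "V = K \<union> W" using fin KV by (auto simp: W_def)
  have ineq: "2 * dg A W i + (\<Sum>v\<in>W. dg A W v) \<le> 2 * card W" if "i \<in> K" for i
  proof (rule coreless_insert [OF W(1) _ _ S I])
    show "i \<notin> W" using that W by auto
    fix B assume "B \<subseteq> insert i W"
    moreover have "pairwise A (K - {i})" using Kpw by (rule pairwise_subset) auto
    moreover have "card (K - {i}) = 3" using KV that by simp
    moreover have "insert i W \<subseteq> V - (K - {i})" using that KV by (auto simp: W_def)
    ultimately show "\<not> core A B" using cl [of B "K - {i}"] KV by blast
  qed
  have sumK: "(\<Sum>i\<in>K. f i) = f a + f b + f c + f u" for f :: "'a \<Rightarrow> nat"
    unfolding K_def using abc uP by (simp add: ac_simps)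
  have "4 * card W \<le> (\<Sum>v\<in>W. dg A V v)"
    using sum_mono [of W "\<lambda>_. 4" "\<lambda>v. dg A V v"] d4 by (auto simp: W_def)
  also have "\<dots> = (\<Sum>v\<in>W. dg A W v) + (\<Sum>v\<in>W. dg A K v)"
  proof -
    have "dg A V v = dg A W v + dg A K v" for v
      using dg_split [OF fin KV(1), of A v] by (simp add: W_def)
    then show ?thesis by (simp add: sum.distrib)
  qed
  also have "(\<Sum>v\<in>W. dg A K v) = (\<Sum>i\<in>K. dg A W i)"
    by (rule dg_double [OF W(1) _ S]) (simp add: K_def)
  finally have big: "4 * card W \<le> (\<Sum>v\<in>W. dg A W v) + (dg A W a + dg A W b + dg A W c + dg A W u)"
    by (simp only: sumK)
  \<comment> \<open>Half the sum of the four bounds \<open>ineq\<close>, compared with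
    \<open>big\<close>, forces the degree sum inside \<open>W\<close> to be 0 and equality
    everywhere.\<close>
  have full: "dg A W a = card W" "dg A W b = card W" "dg A W c = card W" "dg A W u = card W"
    using big ineq [of a] ineq [of b] ineq [of c] ineq [of u]
      dg_le_card [OF W(1), of A a] dg_le_card [OF W(1), of A b] dg_le_card [OF W(1), of A c]
      dg_le_card [OF W(1), of A u]
    by (simp_all add: K_def)
  have W1: "card W \<le> 1"
  proof (rule ccontr)
    assume "\<not> card W \<le> 1"
    then have "2 \<le> card W" by simp
    then obtain w w' where w: "w \<in> W" "w' \<in> W" "w \<noteq> w'" by (rule card_ge2E)
    have "A a w" "A b w" "A c w'" "A u w'" using full w dg_full [OF W(1)] by metis+
    then have "pairwise A {a, b, w}" "pairwise A {c, u, w'}"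
      using ad uabc sym [of u c] by (auto intro!: pairwise_tri [OF S])
    moreover have "{a, b, w} \<inter> {c, u, w'} = {}" "card {a, b, w} = 3" "card {c, u, w'} = 3"
      "{a, b, w} \<subseteq> V" "{c, u, w'} \<subseteq> V"
    proof -
      have "w \<notin> {a, b, c, u}" "w' \<notin> {a, b, c, u}" "{w, w'} \<subseteq> V" "{a, b, c, u} \<subseteq> V"
        using w KV by (auto simp: W_def K_def)
      then show "{a, b, w} \<inter> {c, u, w'} = {}" "card {a, b, w} = 3" "card {c, u, w'} = 3"
        "{a, b, w} \<subseteq> V" "{c, u, w'} \<subseteq> V"
        using abc(2-4) uP(1-3) w(3) by auto
    qed
    ultimately show False
      using np packs_2I [of A "{a, b, w}" "{c, u, w'}" V] core_tri [of "{a, b, w}" A]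
        core_tri [of "{c, u, w'}" A] by simp
  qed
  have "card V = 4 + card W"
    using card_Un_disjoint [OF _ W(1,2)] KV(2) W(3) by (simp add: card_ge_0_finite)
  moreover have "dg A V a \<le> card (V - {a})"
    unfolding dg_def using fin irr by (intro card_mono) auto
  then have "5 \<le> card V" using d4 [of a] P abc fin by (simp add: card_Diff_singleton_if split: if_splits)
  ultimately have cV: "card V = 5" using W1 by simp
  have "pairwise A V"
  proof (unfold pairwise_def, intro ballI impI)
    fix v w assume vw: "v \<in> V" "w \<in> V" "v \<noteq> w"
    show "A v w"
    proof (rule nbs_subset_full [of "V - {v}" V])
      show "u \<in> V - {v}" if "u \<in> V" "A v u" for u using irr that by auto
    qed (use vw fin cV d4 [of v] in auto)
  qed
  then have k5: "K5 A V" using cV unfolding K5_def by blast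
  moreover have "wt A V 2 \<le> 5"
    using sum_mono [of V "\<lambda>v. wgt 2 (dg A V v)" "\<lambda>_. 1"] cV unfolding wt_def by (auto simp: wgt_def sgn_if)
  ultimately show ?thesis using cV K5_K5m unfolding dense2_def by blast
qed

text \<open>The neighbours of \<open>x\<close> contain a path \<open>p\<close>, \<open>q\<close>,
  \<open>r\<close>, so \<open>{x, p, q}\<close> and \<open>{x, q, r}\<close> are triangles. The
  forest bounds for their complements give the remaining vertices average degree at most 3, hence
  all of them degree 3, and only \<open>p\<close>, \<open>q\<close>, \<open>r\<close> can have
  more.\<close>

lemma two_cores_deg3_tri:
  assumes fin: "finite V" and S: "symp A" and I: "irreflp A"
    and np: "\<not> packs A V 2" and d3: "\<And>v. v \<in> V \<Longrightarrow> 3 \<le> dg A V v"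
    and x: "x \<in> V" "dg A V x = 3"
    and tri: "\<And>y. y \<in> V \<Longrightarrow> A x y \<Longrightarrow> \<exists>z\<in>V. A x z \<and> A y z"
  shows "card {v \<in> V. 4 \<le> dg A V v} \<le> 3"
proof -
  note sym = sympD [OF S]
  note irr = irreflpD [OF I]
  have cl: "\<not> core A B" if "B \<subseteq> V - P'" "P' \<subseteq> V" "card P' = 3" "pairwise A P'" for B P'
    using np packs_2I [of A P' B V] core_tri [of P' A] that by blast
  obtain a b c where abc: "{u \<in> V. A x u} = {a, b, c}" "a \<noteq> b" "a \<noteq> c" "b \<noteq> c"
    using x(2) unfolding dg_def by (rule card3E)
  have in3: "z \<in> V \<and> A x z \<longleftrightarrow> z = a \<or> z = b \<or> z = c" for z using abc(1) by blast
  \<comment> \<open>A graph on three vertices without an isolated vertex contains a path through all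
    three.\<close>
  have "\<exists>p q r. {u \<in> V. A x u} = {p, q, r} \<and> p \<noteq> q \<and> p \<noteq> r \<and> q \<noteq> r \<and> A p q \<and> A q r"
  proof -
    have "A a b \<or> A a c" "A b a \<or> A b c" "A c a \<or> A c b"
      using tri [of a] tri [of b] tri [of c] in3 irr by metis+
    then consider "A a b" "A b c" | "A b a" "A a c" | "A a c" "A c b"
      using sym by blast
    then show ?thesis
    proof cases
      case 1 then show ?thesis using abc by blast
    next
      case 2
      have "{u \<in> V. A x u} = {b, a, c}" using abc by auto
      then show ?thesis using abc 2 by blast
    next
      case 3
      have "{u \<in> V. A x u} = {a, c, b}" using abc by auto
      then show ?thesis using abc 3 by blast
    qed
  qed
  then obtain p q r where N: "{u \<in> V. A x u} = {p, q, r}" "p \<noteq> q" "p \<noteq> r" "q \<noteq> r" "A p q" "A q r"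
    by blast
  have xn: "A x p" "A x q" "A x r" "p \<in> V" "q \<in> V" "r \<in> V" "x \<noteq> p" "x \<noteq> q" "x \<noteq> r"
    using N(1) irr by auto
  define W where "W = V - {x, p, q, r}"
  have W: "finite W" "r \<notin> W" "p \<notin> W" using fin by (auto simp: W_def)
  have i1: "2 * dg A W r + (\<Sum>v\<in>W. dg A W v) \<le> 2 * card W"
  proof (rule coreless_insert [OF W(1,2) _ S I])
    fix B assume "B \<subseteq> insert r W"
    moreover have "insert r W \<subseteq> V - {x, p, q}" using xn N by (auto simp: W_def)
    moreover have "pairwise A {x, p, q}" using xn N by (intro pairwise_tri [OF S]) auto
    ultimately show "\<not> core A B" using cl [of B "{x, p, q}"] xn N x by auto
  qed
  have i2: "2 * dg A W p + (\<Sum>v\<in>W. dg A W v) \<le> 2 * card W"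
  proof (rule coreless_insert [OF W(1,3) _ S I])
    fix B assume "B \<subseteq> insert p W"
    moreover have "insert p W \<subseteq> V - {x, q, r}" using xn N by (auto simp: W_def)
    moreover have "pairwise A {x, q, r}" using xn N by (intro pairwise_tri [OF S]) auto
    ultimately show "\<not> core A B" using cl [of B "{x, q, r}"] xn N x by auto
  qed
  have xW: "\<not> A v x" if "v \<in> W" for v using that N(1) sym [of v x] unfolding W_def by blast
  have "(\<Sum>v\<in>W. dg A V v) = (\<Sum>v\<in>W. dg A W v) + (\<Sum>v\<in>W. dg A {x, p, q, r} v)"
  proof -
    have "dg A V v = dg A W v + dg A {x, p, q, r} v" for v
      using dg_split [OF fin, of "{x, p, q, r}" A v] xn x by (simp add: W_def)
    then show ?thesis by (simp add: sum.distrib)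
  qed
  also have "(\<Sum>v\<in>W. dg A {x, p, q, r} v) = (\<Sum>v\<in>W. dg A {p, q, r} v)"
    using xW xn by (intro sum.cong) auto
  also have "\<dots> = dg A W p + dg A W q + dg A W r"
    using dg_double [OF W(1) _ S, of "{p, q, r}"] N by simp
  finally have "(\<Sum>v\<in>W. dg A V v) \<le> 3 * card W"
    using i1 i2 dg_le_card [OF W(1), of A q] by simp
  then have "(\<Sum>v\<in>W. dg A V v) \<le> (\<Sum>v\<in>W. 3)" by simp
  moreover have "(\<Sum>v\<in>W. 3) < (\<Sum>v\<in>W. dg A V v)" if "w \<in> W" "4 \<le> dg A V w" for w
  proof (rule sum_strict_mono_ex1)
    show "\<exists>a\<in>W. 3 < dg A V a" using that by (intro bexI [of _ w]) auto
  qed (use W d3 in \<open>auto simp: W_def\<close>)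
  ultimately have "{v \<in> V. 4 \<le> dg A V v} \<subseteq> {p, q, r}"
    using x unfolding W_def by fastforce
  then have "card {v \<in> V. 4 \<le> dg A V v} \<le> card {p, q, r}" by (intro card_mono) auto
  then show ?thesis using N by simp
qed

text \<open>Both \<open>x\<close> and \<open>y\<close> have degree 3, and their disjoint
  neighbourhoods cover the six vertices. The other four vertices carry the high degrees, so each
  misses just one vertex, and \<open>{x, p, p'}\<close> and \<open>{y, r, r'}\<close> are
  triangles.\<close>

lemma six_vertices_two_cores:
  assumes fin: "finite V" and S: "symp A" and I: "irreflp A"
    and c6: "card V = 6" and d3: "\<And>v. v \<in> V \<Longrightarrow> 3 \<le> dg A V v"
    and x: "x \<in> V" "dg A V x = 3" and y: "y \<in> V" "A x y"
    and nc: "\<And>z. z \<in> V \<Longrightarrow> A x z \<Longrightarrow> \<not> A y z"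
    and h: "4 \<le> card {v \<in> V. 4 \<le> dg A V v}"
  shows "packs A V 2"
proof -
  note sym = sympD [OF S]
  note irr = irreflpD [OF I]
  have "card ({u \<in> V. A x u} - {y}) = 2" using x y unfolding dg_def by simp
  then obtain p p' where pp: "{u \<in> V. A x u} - {y} = {p, p'}" "p \<noteq> p'" by (auto simp: card_2_iff)
  have p: "p \<in> V" "p' \<in> V" "A x p" "A x p'" "p \<noteq> y" "p' \<noteq> y" "p \<noteq> x" "p' \<noteq> x" "x \<noteq> y"
    using pp(1) irr y by auto
  have "card (V - {x, y, p, p'}) = 2" using fin c6 x y p pp by (simp add: card_Diff_subset)
  then obtain r r' where rr: "V - {x, y, p, p'} = {r, r'}" "r \<noteq> r'" by (auto simp: card_2_iff)
  have r: "r \<in> V" "r' \<in> V" "r \<notin> {x, y, p, p'}" "r' \<notin> {x, y, p, p'}" using rr(1) by auto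
  have V: "V = {x, y, p, p', r, r'}" using rr(1) x y p by auto
  have ny: "{u \<in> V. A y u} \<subseteq> {x, r, r'}" using nc p irr V by auto
  have c3: "card {x, r, r'} = 3" using r(3,4) rr(2) by auto
  have yr': "A y s" if "s \<in> {x, r, r'}" for s
    by (rule nbs_subset_full [OF _ _ _ that, of V]) (use ny d3 [OF y(1)] c3 in auto)
  have yr: "A y r" "A y r'" using yr' by auto
  have "dg A V y \<le> 3"
    unfolding dg_def using card_mono [OF _ ny] c3 by simp
  then have "{v \<in> V. 4 \<le> dg A V v} \<subseteq> {p, p', r, r'}" using x V by auto
  moreover have "card {p, p', r, r'} = 4" using pp(2) rr(2) r(3,4) by auto
  ultimately have eq: "{v \<in> V. 4 \<le> dg A V v} = {p, p', r, r'}" using h by (intro card_seteq) auto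
  have hi: "4 \<le> dg A V p" "4 \<le> dg A V r" using eq by auto
  have c4: "card {x, p', r, r'} = 4" "card {y, p, p', r'} = 4"
    using r(3,4) rr(2) pp(2) p by auto
  have "A p p'"
  proof (rule nbs_subset_full [where V = V])
    show "u \<in> {x, p', r, r'}" if "u \<in> V" "A p u" for u
      using that irr V nc [of p] p sym [of p y] by auto
  qed (use hi c4 in auto)
  moreover have "A r r'"
  proof (rule nbs_subset_full [where V = V])
    have "\<not> A r x" using sym [of r x] pp(1) r(1,3) by blast
    then show "u \<in> {y, p, p', r'}" if "u \<in> V" "A r u" for u
      using that irr V by auto
  qed (use hi c4 in auto)
  ultimately have "pairwise A {x, p, p'}" "pairwise A {y, r, r'}"
    using p yr by (auto intro!: pairwise_tri [OF S])
  then have "core A {x, p, p'}" "core A {y, r, r'}" using p r(3,4) rr(2) pp(2) by (auto intro!: core_tri)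
  then show ?thesis by (rule packs_2I) (use V p r in auto)
qed

lemma card_tri: "irreflp A \<Longrightarrow> A a b \<Longrightarrow> A a c \<Longrightarrow> A b c \<Longrightarrow> card {a, b, c} = 3"
  by (cases "a = b"; cases "a = c"; cases "b = c") (auto dest: irreflpD)

text \<open>Vertices of degree at most 2 are deleted, contracted or excluded by a forest bound. From
  minimum degree 3 on, the weight is the number of vertices of degree at least 4, and contraction is
  used only at an edge without common neighbours.\<close>

lemma two_cores:
  assumes "finite V" "symp A" "irreflp A" "\<not> packs A V 2" "4 \<le> wt A V 2"
  shows "dense2 A V"
  using assms
proof (induction "card V" arbitrary: A V rule: less_induct)
  case less
  note fin = less.prems(1) and S = less.prems(2) and I = less.prems(3)
    and np = less.prems(4) and w4 = less.prems(5)
  note sym = sympD [OF S]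
  note irr = irreflpD [OF I]
  have del: "dense2 A V" if x: "x \<in> V" "dg A V x \<le> 2" "wt A V 2 \<le> wt A (V - {x}) 2" for x
  proof -
    have "card (V - {x}) < card V" using fin x(1) by (rule card_Diff1_less)
    moreover have "\<not> packs A (V - {x}) 2" using np packs_mono [of A "V - {x}" 2 V] by auto
    ultimately have "dense2 A (V - {x})"
      using less.hyps [of "V - {x}" A] fin S I w4 x by simp
    then show ?thesis
      using x K5m_mono [of A "V - {x}" V] K5_mono [of A "V - {x}" V] unfolding dense2_def
      by fastforce
  qed
  have con: "dense2 (contr A x y) (V - {x}) \<and> wt A V 2 - wgt 2 (dg A V x) \<le> wt (contr A x y) (V - {x}) 2"
    if x: "x \<in> V" "y \<in> V" "A x y" "2 \<le> dg A V x" "wgt 2 (dg A V x) + 4 \<le> wt A V 2"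
      and nc: "\<And>z. z \<in> V \<Longrightarrow> A x z \<Longrightarrow> \<not> A y z" for x y
  proof -
    have w: "wt A V 2 - wgt 2 (dg A V x) \<le> wt (contr A x y) (V - {x}) 2"
      by (rule contr_wt [OF fin x(1-3) S I nc x(4)])
    have "\<not> packs (contr A x y) (V - {x}) 2"
      using contr_packs [of A x y "V - {x}" 2] np x S I by (auto simp: insert_absorb)
    then have "dense2 (contr A x y) (V - {x})"
      using less.hyps [of "V - {x}" "contr A x y"] fin contr_symp [OF S, of x y]
        contr_irreflp [of A x y] w x card_Diff1_less [OF fin x(1)] by simp
    with w show ?thesis by simp
  qed
  have cl: "\<not> core A B" if "B \<subseteq> V - P" "P \<subseteq> V" "card P = 3" "pairwise A P" for B P
    using np packs_2I [of A P B V] core_tri [of P A] that by blast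
  show ?case
  proof (cases "\<exists>x\<in>V. dg A V x \<le> 1")
    case True
    then show ?thesis using del delete_leaf_wt [OF fin _ S I] by fastforce
  next
    case F1: False
    show ?thesis
    proof (cases "\<exists>x\<in>V. dg A V x = 2")
      case True
      then obtain x where x: "x \<in> V" "dg A V x = 2" by auto
      then obtain y z where yz: "{u \<in> V. A x u} = {y, z}" "y \<noteq> z"
        unfolding dg_def by (auto simp: card_2_iff)
      have xyz: "y \<in> V" "z \<in> V" "A x y" "A x z" "x \<noteq> y" "x \<noteq> z" using yz(1) irr by auto
      have wx: "wgt 2 (dg A V x) = -1" using x by (simp add: wgt_def)
      show ?thesis
      proof (cases "A y z")
        case False
        have nc: "\<not> A y u" if "u \<in> V" "A x u" for u
        proof -
          have "u = y \<or> u = z" using that yz(1) by blast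
          then show ?thesis using False irr by auto
        qed
        have c: "dense2 (contr A x y) (V - {x})" "wt A V 2 + 1 \<le> wt (contr A x y) (V - {x}) 2"
          using con [of x y] x xyz nc wx w4 by auto
        \<comment> \<open>The contraction has weight at least 5 and so contains a full K5. As
          \<open>y\<close> and \<open>z\<close> are the only neighbours of \<open>x\<close>, undoing
          it removes at most the edge \<open>yz\<close>.\<close>
        then obtain Q where Q: "Q \<subseteq> V - {x}" "card Q = 5" "pairwise (contr A x y) Q"
          using w4 by (auto simp: dense2_def K5_def)
        have cA: "A u v \<or> {u, v} = {y, z}" if "contr A x y u v" "u \<in> V" "v \<in> V" for u v
        proof -
          have "u = y \<or> u = z" if "A x u" using that \<open>u \<in> V\<close> yz(1) by blast
          moreover have "v = y \<or> v = z" if "A x v" using that \<open>v \<in> V\<close> yz(1) by blast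
          ultimately show ?thesis using that by (auto simp: contr_def)
        qed
        have "K5m A V"
        proof (cases "y \<in> Q \<and> z \<in> Q")
          case True
          have QA: "A u v \<or> {u, v} = {y, z}" if "u \<in> Q" "v \<in> Q" "u \<noteq> v" for u v
            using cA [of u v] Q(1) pairwiseD [OF Q(3), of u v] that by auto
          have "pairwise A (Q - {y})" "pairwise A (Q - {z})"
            using QA unfolding pairwise_def by (metis Diff_iff doubleton_eq_iff insertI1)+
          then show ?thesis unfolding K5m_def using True Q yz(2) by (intro exI [of _ Q]) auto
        next
          case False
          have "A u v" if "u \<in> Q" "v \<in> Q" "u \<noteq> v" for u v
            using cA [of u v] Q(1) pairwiseD [OF Q(3), of u v] that False by (auto simp: doubleton_eq_iff)
          then have "pairwise A Q" by (simp add: pairwise_def)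
          then have "K5 A V" using Q unfolding K5_def by auto
          then show ?thesis by (rule K5_K5m)
        qed
        moreover have "wt A V 2 \<le> 4" using c by (auto simp: dense2_def)
        ultimately show ?thesis using x unfolding dense2_def by force
      next
        case True
        have tri: "pairwise A {x, y, z}" "card {x, y, z} = 3" "{x, y, z} \<subseteq> V"
          using xyz True yz x by (auto intro!: pairwise_tri [OF S])
        show ?thesis
        proof (cases "5 \<le> dg A V y \<or> 5 \<le> dg A V z")
          case True
          then obtain p q where pq: "{u \<in> V. A x u} = {p, q}" "p \<noteq> q" "5 \<le> dg A V p"
            using yz by (metis insert_commute)
          \<comment> \<open>The vertex \<open>p\<close> keeps weight 1 with one neighbour less, so
            the gain from \<open>x\<close> covers the possible loss at \<open>q\<close>.\<close>
          have "wt A (V - {x}) 2 \<ge> wt A V 2 - wgt 2 (dg A V x) - (\<Sum>v\<in>V - {x}. if v = q then 1 else 0)"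
          proof (rule delete_wt [OF fin x(1) S I])
            fix v assume v: "v \<in> V - {x}"
            have r: "dg A V v = dg A (V - {x}) v + (if A v x then 1 else 0)"
              by (rule dg_remove [OF fin x(1)])
            have "A v x \<Longrightarrow> v = p \<or> v = q" using v pq(1) sym [of v x] by blast
            then show "wgt 2 (dg A V v) - (if v = q then 1 else 0) \<le> wgt 2 (dg A (V - {x}) v)"
              using r pq(3) by (auto simp: wgt_def sgn_if split: if_splits)
          qed
          moreover have "(\<Sum>v\<in>V - {x}. if v = q then 1 else 0) = (1::int)"
            using pq(1) fin irr by auto
          ultimately show ?thesis using del [of x] x wx by simp
        next
          case False
          define F where "F = V - {x, y, z}"
          have F: "finite F" using fin by (simp add: F_def)
          have spl: "dg A V v = dg A F v + dg A {x, y, z} v" for v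
            using dg_split [OF fin tri(3)] by (simp add: F_def)
          have dF: "dg A F x = 0" "dg A F y \<le> 2" "dg A F z \<le> 2"
            using spl [of x] spl [of y] spl [of z] x False xyz yz(2) True sym [of x y] sym [of x z]
              sym [of y z] irr by auto
          have wV: "wt A V 2 = (\<Sum>v\<in>{x, y, z}. wgt 2 (dg A V v)) + (\<Sum>v\<in>F. wgt 2 (dg A V v))"
            unfolding wt_def F_def using sum.subset_diff [OF tri(3) fin] by (simp add: add.commute)
          have "(\<Sum>v\<in>{x, y, z}. wgt 2 (dg A V v)) \<le> 1"
            using wx xyz yz(2) by (simp add: wgt_def sgn_if)
          moreover have "(\<Sum>v\<in>F. wgt 2 (dg A V v)) \<le> 2"
          proof (cases "F = {}")
            case False
            \<comment> \<open>For degrees \<open>m\<close> of at least 2 the weight is at most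
              \<open>m - 3\<close>. Thus the forest bound applies, together with the at most four
              edges from \<open>y\<close> and \<open>z\<close> into \<open>F\<close>.\<close>
            have "(\<Sum>v\<in>F. wgt 2 (dg A V v)) \<le> (\<Sum>v\<in>F. int (dg A F v) + int (dg A {x, y, z} v) - 3)"
            proof (rule sum_mono)
              fix v assume "v \<in> F"
              then have "2 \<le> dg A V v" using F1 by (force simp: F_def)
              then show "wgt 2 (dg A V v) \<le> int (dg A F v) + int (dg A {x, y, z} v) - 3"
                using spl [of v] by (auto simp: wgt_def sgn_if)
            qed
            also have "\<dots> = int (\<Sum>v\<in>F. dg A F v) + int (\<Sum>v\<in>F. dg A {x, y, z} v) - 3 * int (card F)"
              by (simp add: sum.distrib sum_subtractf)
            also have "(\<Sum>v\<in>F. dg A {x, y, z} v) = dg A F x + dg A F y + dg A F z"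
              using dg_double [OF F _ S, of "{x, y, z}"] xyz yz(2) by simp
            finally have "(\<Sum>v\<in>F. wgt 2 (dg A V v))
              \<le> int (\<Sum>v\<in>F. dg A F v) + int (dg A F x + dg A F y + dg A F z) - 3 * int (card F)" .
            moreover have "(\<Sum>v\<in>F. dg A F v) + 2 \<le> 2 * card F"
            proof (rule coreless_edges [OF F False _ S I])
              show "\<not> core A B" if "B \<subseteq> F" for B using cl [of B "{x, y, z}"] tri that by (simp add: F_def)
            qed
            ultimately show ?thesis using dF by linarith
          qed simp
          ultimately show ?thesis using wV w4 by simp
        qed
      qed
    next
      case F2: False
      have d3: "3 \<le> dg A V v" if "v \<in> V" for v using F1 F2 that by (metis One_nat_def Suc_1 le_less_Suc_eq not_less numeral_3_eq_3 not_less_eq_eq)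
      have wh: "wt A V 2 = int (card {v \<in> V. 4 \<le> dg A V v})" by (rule wt2_dense [OF fin d3])
      show ?thesis
      proof (cases "\<exists>P\<subseteq>V. card P = 3 \<and> pairwise A P")
        case False
        have nc: "\<not> A y z" if "x \<in> V" "y \<in> V" "A x y" "z \<in> V" "A x z" for x y z
        proof
          assume "A y z"
          then have "pairwise A {x, y, z}" "card {x, y, z} = 3"
            using pairwise_tri [OF S, of x y z] card_tri [OF I, of x y z] that(3,5) by simp_all
          moreover have "{x, y, z} \<subseteq> V" using that by simp
          ultimately show False using False by blast
        qed
        \<comment> \<open>The graph has no triangle, so all triangles of the contraction share the
          merged vertex.\<close>
        have nK: "\<not> K5m (contr A x y) (V - {x})" for x y
        proof (rule apex_no_K5m)
          fix P assume "P \<subseteq> V - {x}" "card P = 3" "pairwise (contr A x y) P"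
          then show "y \<in> P" using contr_triangle [of P V x A y] False by blast
        qed
        have "V \<noteq> {}" using w4 by (auto simp: wt_def)
        show ?thesis
        proof (cases "\<exists>x\<in>V. dg A V x = 3")
          case True
          then obtain x where x: "x \<in> V" "dg A V x = 3" by auto
          then obtain y where y: "y \<in> V" "A x y" using dg_pos [OF fin, of A x] by auto
          have "dense2 (contr A x y) (V - {x})"
            using con [of x y] x y nc [OF x(1) y] w4 by (auto simp: wgt_def)
          then show ?thesis using nK by (simp add: dense2_def)
        next
          case F3: False
          have d4: "4 \<le> dg A V v" if "v \<in> V" for v using F3 d3 that by (metis Suc_leI eval_nat_numeral(2) le_neq_implies_less semiring_norm(26,27))
          obtain x where x: "x \<in> V" using \<open>V \<noteq> {}\<close> by auto
          then obtain y where y: "y \<in> V" "A x y" using dg_pos [OF fin, of A x] d4 [OF x] by auto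
          have "dg A V x + dg A V y \<le> card V"
            by (rule disjoint_nbs_card [OF fin]) (use nc [OF x y] in auto)
          moreover have "{v \<in> V. 4 \<le> dg A V v} = V" using d4 by auto
          \<comment> \<open>Disjoint neighbourhoods of adjacent vertices make the graph large enough
            to contract even at a vertex of weight 1.\<close>
          ultimately have "8 \<le> wt A V 2" using wh d4 [OF x] d4 [OF y(1)] by simp
          moreover have "wgt 2 (dg A V x) \<le> 1" by (simp add: wgt_def sgn_if)
          ultimately have "dense2 (contr A x y) (V - {x})"
            using con [of x y] x y nc [OF x(1) y] d4 [OF x] by auto
          then show ?thesis using nK by (simp add: dense2_def)
        qed
      next
        case True
        then obtain P where P: "P \<subseteq> V" "card P = 3" "pairwise A P" by auto
        show ?thesis
        proof (cases "\<exists>x\<in>V. dg A V x = 3")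
          case True
          then obtain x where x: "x \<in> V" "dg A V x = 3" by auto
          have h: "4 \<le> card {v \<in> V. 4 \<le> dg A V v}" using wh w4 by simp
          show ?thesis
          proof (cases "\<forall>y\<in>V. A x y \<longrightarrow> (\<exists>z\<in>V. A x z \<and> A y z)")
            case True
            then show ?thesis using two_cores_deg3_tri [OF fin S I np d3 x] h by auto
          next
            case False
            then obtain y where y: "y \<in> V" "A x y" and nc: "\<And>z. z \<in> V \<Longrightarrow> A x z \<Longrightarrow> \<not> A y z" by auto
            have D: "dense2 (contr A x y) (V - {x})"
              using con [of x y] x y nc w4 by (auto simp: wgt_def)
            have "3 \<le> dg (contr A x y) (V - {x}) v" if v: "v \<in> V - {x}" for v
            proof (cases "v = y")
              case True
              then show ?thesis using contr_dg_y [OF fin x(1) y S I nc] d3 [of y] y x by simp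
            next
              case False
              then show ?thesis using contr_dg_other [OF fin x(1) y _ _ _ S I nc, of v] d3 [of v] v by simp
            qed
            \<comment> \<open>All degrees of the contraction are at least 3, so the last clause of
              \<open>dense2\<close> fixes its order.\<close>
            then have "card (V - {x}) = 5" using D by (simp add: dense2_def)
            then have "card V = 6" using x fin by simp
            then show ?thesis using six_vertices_two_cores [OF fin S I _ d3 x y nc h] np by simp
          qed
        next
          case F3: False
          have d4: "4 \<le> dg A V v" if "v \<in> V" for v using F3 d3 that by (metis Suc_leI eval_nat_numeral(2) le_neq_implies_less semiring_norm(26,27))
          show ?thesis by (rule two_cores_min4 [OF fin S I np d4 P])
        qed
      qed
    qed
  qed
qed

section \<open>A smallest counterexample\<close>

text \<open>Lowering \<open>k\<close> by \<open>i\<close> lowers the threshold by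
  \<open>2 * i\<close>, so a vertex affords that many deleted neighbours. The case
  \<open>i = 2\<close> serves the simultaneous deletion of two cycles.\<close>

lemma wgt_shift: "i \<le> k \<Longrightarrow> m \<le> n + 2 * i \<Longrightarrow> wgt k m \<le> wgt (k - i) n"
  by (auto simp: wgt_def sgn_if of_nat_diff)

lemma wgt_shift1: "i \<le> k \<Longrightarrow> m \<le> n + 2 * i + 1 \<Longrightarrow> wgt k m - 1 \<le> wgt (k - i) n"
  by (auto simp: wgt_def sgn_if of_nat_diff)

lemma wgt_gain: "i \<le> k \<Longrightarrow> wgt k m = 0 \<Longrightarrow> m + 1 \<le> n + 2 * i \<Longrightarrow> wgt (k - i) n = 1"
  by (auto simp: wgt_def sgn_if of_nat_diff split: if_splits)

text \<open>Three deleted neighbours are one too many only at the least high degree and at the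
  single degree of weight 0.\<close>

lemma wgt_no_drop:
  "1 \<le> k \<Longrightarrow> m = n + 3 \<Longrightarrow> m \<noteq> 2 * k \<Longrightarrow> m \<noteq> 2 * k - 1 \<Longrightarrow> wgt k m \<le> wgt (k - 1) n"
  by (auto simp: wgt_def sgn_if of_nat_diff)

lemma wgt_le1: "wgt k m \<le> 1" by (simp add: wgt_def sgn_if)

lemma wgt_cases: "wgt k m = -1 \<or> wgt k m = 0 \<or> wgt k m = 1" by (simp add: wgt_def sgn_if)

lemma wgt_eq_1: "wgt k m = 1 \<longleftrightarrow> 2 * k \<le> m" by (auto simp: wgt_def sgn_if)

lemma wgt_eq_0: "1 \<le> k \<Longrightarrow> wgt k m = 0 \<longleftrightarrow> m = 2 * k - 1" by (auto simp: wgt_def sgn_if)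

lemma wgt_eq_m1: "1 \<le> k \<Longrightarrow> wgt k m = -1 \<longleftrightarrow> m \<le> 2 * k - 2"
proof -
  assume "1 \<le> k"
  then have "m \<le> 2 * k - 2 \<longleftrightarrow> int m + 1 < 2 * int k" by arith
  then show ?thesis by (auto simp: wgt_def sgn_if)
qed

text \<open>The induction hypothesis ranges over all relations and all \<open>j\<close>, because
  contraction changes the relation and deleting cycles lowers \<open>k\<close>.\<close>

locale cex =
  fixes A :: "'a \<Rightarrow> 'a \<Rightarrow> bool" and V :: "'a set" and k :: nat
  assumes fin: "finite V" and S: "symp A" and I: "irreflp A" and k3: "3 \<le> k"
    and t1: "tri_meeting A V" and wV: "2 * int k \<le> wt A V k" and np: "\<not> packs A V k"
    and IH: "\<And>A' U j. card U < card V \<Longrightarrow> finite (U :: 'a set) \<Longrightarrow> symp A' \<Longrightarrow> irreflp A' \<Longrightarrow> 2 \<le> j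
      \<Longrightarrow> admissible j A' U \<Longrightarrow> 2 * int j \<le> wt A' U j \<Longrightarrow> packs A' U j"
begin

lemma sym: "A u v \<Longrightarrow> A v u" using S by (rule sympD)
lemma irr: "\<not> A u u" using I by (rule irreflpD)
lemma neqD: "A u v \<Longrightarrow> u \<noteq> v" using irr by auto

abbreviation d :: "'a \<Rightarrow> nat" where "d v \<equiv> dg A V v"
abbreviation w :: "'a \<Rightarrow> int" where "w v \<equiv> wgt k (d v)"
abbreviation slack :: int where "slack \<equiv> wt A V k - 2 * int k"

definition tri :: "'a set \<Rightarrow> bool" where
  "tri T \<longleftrightarrow> T \<subseteq> V \<and> card T = 3 \<and> pairwise A T"

lemma triI: "A a b \<Longrightarrow> A a c \<Longrightarrow> A b c \<Longrightarrow> {a, b, c} \<subseteq> V \<Longrightarrow> tri {a, b, c}"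
  unfolding tri_def using pairwise_tri [OF S, of a b c] card_tri [OF I, of a b c] by simp

lemma tri_meet: "tri P \<Longrightarrow> tri Q \<Longrightarrow> P \<inter> Q \<noteq> {}"
  using t1 unfolding tri_meeting_def tri_def by blast

lemma tri_finite: "tri T \<Longrightarrow> finite T"
  unfolding tri_def by (simp add: card_ge_0_finite)

lemma tri_core: "tri T \<Longrightarrow> core A T"
  unfolding tri_def by (simp add: core_tri)

lemma tri_adj: "tri T \<Longrightarrow> u \<in> T \<Longrightarrow> v \<in> T \<Longrightarrow> u \<noteq> v \<Longrightarrow> A u v"
  unfolding tri_def by (auto simp: pairwise_def)

lemma wt_sub:
  assumes "U \<subseteq> V" "\<And>v. v \<in> U \<Longrightarrow> w v + c v \<le> wgt j (dg A U v)"
  shows "wt A V k - sum w (V - U) + (\<Sum>v\<in>U. c v) \<le> wt A U j"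
proof -
  have "wt A V k = sum w (V - U) + sum w U"
    unfolding wt_def by (rule sum.subset_diff [OF assms(1) fin])
  moreover have "(\<Sum>v\<in>U. w v + c v) \<le> wt A U j" unfolding wt_def by (rule sum_mono) (rule assms(2))
  ultimately show ?thesis by (simp add: sum.distrib)
qed

lemma no_packs_rest:
  assumes "core A B" "B \<subseteq> V" "U \<subseteq> V - B"
  shows "\<not> packs A U (k - 1)"
  using packs_add [OF assms(1,2) _ assms(3), of "k - 1"] np k3 by auto

lemma card_less: "U \<subseteq> V \<Longrightarrow> x \<in> V \<Longrightarrow> x \<notin> U \<Longrightarrow> card U < card V"
  using fin by (intro psubset_card_mono) auto

text \<open>Otherwise the rest would have a packing by minimality, and the deleted core would
  complete it.\<close>

lemma rest_wt:
  assumes "core A B" "B \<subseteq> V" "U \<subseteq> V - B" "admissible (k - 1) A U"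
  shows "wt A U (k - 1) < 2 * int k - 2"
proof (rule ccontr)
  assume "\<not> ?thesis"
  then have "2 * int (k - 1) \<le> wt A U (k - 1)" using k3 by (simp add: of_nat_diff)
  moreover obtain b where "b \<in> B" using assms(1) by (auto simp: core_def)
  then have "card U < card V" using card_less [of U b] assms by blast
  moreover have "finite U" using assms fin by (meson finite_Diff finite_subset)
  ultimately have "packs A U (k - 1)" using IH [of U A "k - 1"] S I k3 assms(4) by simp
  then show False using no_packs_rest [OF assms(1-3)] by simp
qed

lemma tri_rest: "tri T \<Longrightarrow> P \<subseteq> V - T \<Longrightarrow> card P = 3 \<Longrightarrow> \<not> pairwise A P"
  using tri_meet [of T P] unfolding tri_def by blast

lemma tri_rest_admissible: "tri T \<Longrightarrow> U \<subseteq> V - T \<Longrightarrow> admissible j A U"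
  by (rule apex_admissible) (use tri_rest in blast)

text \<open>The rest \<open>U\<close> is triangle-free, so contracting an edge at \<open>x\<close>
  keeps it admissible; the gain at the low vertex sharpens \<open>rest_wt\<close> by one.\<close>

lemma contr_rest:
  assumes T: "core A B" "B \<subseteq> V" and U: "U \<subseteq> V - B" and tf: "\<And>P. P \<subseteq> U \<Longrightarrow> card P = 3 \<Longrightarrow> \<not> pairwise A P"
    and x: "x \<in> U" "wgt (k - 1) (dg A U x) = -1" "2 \<le> dg A U x"
  shows "wt A U (k - 1) < 2 * int k - 3"
proof (rule ccontr)
  assume "\<not> ?thesis"
  then have W: "2 * int k - 3 \<le> wt A U (k - 1)" by simp
  have fU: "finite U" using U fin by (meson finite_Diff finite_subset)
  obtain y where y: "y \<in> U" "A x y" using x(3) dg_pos [OF fU, of A x] by auto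
  have nc: "\<not> A y z" if "z \<in> U" "A x z" for z
  proof
    assume "A y z"
    then have "pairwise A {x, y, z}" "card {x, y, z} = 3"
      using that y pairwise_tri [OF S, of x y z] card_tri [OF I, of x y z] by simp_all
    then show False using tf [of "{x, y, z}"] that x y by auto
  qed
  have "wt A U (k - 1) - wgt (k - 1) (dg A U x) \<le> wt (contr A x y) (U - {x}) (k - 1)"
    by (rule contr_wt [OF fU x(1) y S I nc x(3)])
  then have w2: "2 * int (k - 1) \<le> wt (contr A x y) (U - {x}) (k - 1)"
    using W x(2) k3 by (simp add: of_nat_diff)
  have "admissible (k - 1) (contr A x y) (U - {x})"
  proof (rule apex_admissible)
    fix P assume "P \<subseteq> U - {x}" "card P = 3" "pairwise (contr A x y) P"
    then show "y \<in> P" using contr_triangle [of P U x A y] tf [of P] by blast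
  qed
  moreover have "card (U - {x}) < card V" using card_less [of "U - {x}" x] U x by blast
  ultimately have "packs (contr A x y) (U - {x}) (k - 1)"
    using IH [of "U - {x}" "contr A x y" "k - 1"] fU contr_symp [OF S, of x y] contr_irreflp [of A x y] k3 w2
    by simp
  then have "packs A (insert x (U - {x})) (k - 1)" by (rule contr_packs) (use y S I in auto)
  then show False using no_packs_rest [OF T U] x by (simp add: insert_absorb)
qed

text \<open>The vertices whose sign falls, and those whose sign surely rises, when the triangle \<open>T\<close> is deleted
  and \<open>k\<close> is lowered by one. A vertex witnessing \<open>hp\<close> allows one further contraction.\<close>

definition drp :: "'a set \<Rightarrow> 'a set" where
  "drp T = {v \<in> V - T. dg A T v = 3 \<and> (d v = 2 * k \<or> d v = 2 * k - 1)}"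

definition gn :: "'a set \<Rightarrow> 'a set" where
  "gn T = {v \<in> V - T. w v = 0 \<and> dg A T v \<le> 1}"

definition hp :: "'a set \<Rightarrow> bool" where
  "hp T \<longleftrightarrow> (\<exists>x\<in>V - T. w x = -1 \<and> 2 \<le> dg A (V - T) x)"

text \<open>The bound \<open>2 * k - 3\<close> on the weight of the rest, rewritten as a balance:
  the 3 is the drop of the bound by 2 plus 1 for strictness. Under \<open>hp\<close> the additional
  1 comes from a contraction in the rest, or from the low vertex itself if its sign rises.\<close>

lemma tri_loss:
  assumes T: "tri T"
  shows "3 + slack + int (card (gn T)) + (if hp T then 1 else 0) \<le> sum w T + int (card (drp T))"
proof -
  define U where "U = V - T"
  have TV: "T \<subseteq> V" using T by (simp add: tri_def)
  have U: "U \<subseteq> V" "V - U = T" "finite U" using TV fin by (auto simp: U_def)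
  have dU: "d v = dg A U v + dg A T v" for v using dg_split [OF fin TV] by (simp add: U_def)
  have T3: "dg A T v \<le> 3" for v using dg_le_card [OF tri_finite [OF T]] T by (simp add: tri_def)
  define c :: "'a \<Rightarrow> int" where "c v = (if v \<in> gn T then 1 else 0) - (if v \<in> drp T then 1 else 0)" for v
  have dis: "gn T \<inter> drp T = {}" by (auto simp: gn_def drp_def)
  have c: "w v + c v \<le> wgt (k - 1) (dg A U v)" if v: "v \<in> U" for v
  proof (cases "v \<in> gn T")
    case True
    then have "wgt (k - 1) (dg A U v) = 1"
      using wgt_gain [of 1 k "d v" "dg A U v"] k3 dU [of v] by (simp add: gn_def)
    then show ?thesis using True dis by (auto simp: c_def gn_def)
  next
    case F: False
    show ?thesis
    proof (cases "v \<in> drp T")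
      case True
      moreover from this have "dg A T v = 3" by (simp add: drp_def)
      ultimately show ?thesis using F wgt_shift1 [of 1 k "d v" "dg A U v"] k3 dU [of v] by (simp add: c_def)
    next
      case False
      have "wgt k (d v) \<le> wgt (k - 1) (dg A U v)"
      proof (cases "dg A T v = 3")
        case True
        then show ?thesis using wgt_no_drop [of k "d v" "dg A U v"] False v k3 dU [of v]
          by (auto simp: drp_def U_def)
      next
        case False
        then show ?thesis using wgt_shift [of 1 k "d v" "dg A U v"] T3 [of v] k3 dU [of v] by simp
      qed
      then show ?thesis using F False by (simp add: c_def)
    qed
  qed
  have sc: "(\<Sum>v\<in>U. c v) = int (card (gn T)) - int (card (drp T))"
  proof -
    have "gn T \<subseteq> U" "drp T \<subseteq> U" by (auto simp: gn_def drp_def U_def)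
    then have "gn T = {v \<in> U. v \<in> gn T}" "drp T = {v \<in> U. v \<in> drp T}" by auto
    then have "int (card (gn T)) = (\<Sum>v\<in>U. if v \<in> gn T then 1 else 0)"
       "int (card (drp T)) = (\<Sum>v\<in>U. if v \<in> drp T then 1 else 0)"
      using U(3) by (simp_all add: sum.If_cases Int_def)
    then show ?thesis by (simp add: c_def sum_subtractf)
  qed
  have r: "wt A U (k - 1) < 2 * int k - 2"
    by (rule rest_wt [OF tri_core [OF T] TV]) (use tri_rest_admissible [OF T] in \<open>auto simp: U_def\<close>)
  have base: "wt A V k - sum w T + (int (card (gn T)) - int (card (drp T))) \<le> wt A U (k - 1)"
    using wt_sub [OF U(1) c] sc U(2) by simp
  show ?thesis
  proof (cases "hp T")
    case False
    then show ?thesis using r base by simp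
  next
    case True
    then obtain x where x: "x \<in> U" "w x = -1" "2 \<le> dg A U x" by (auto simp: hp_def U_def)
    show ?thesis
    proof (cases "wgt (k - 1) (dg A U x) = -1")
      case True
      have "wt A U (k - 1) < 2 * int k - 3"
      proof (rule contr_rest [OF tri_core [OF T] TV _ _ x(1) True x(3)])
        show "U \<subseteq> V - T" by (simp add: U_def)
        show "\<not> pairwise A P" if "P \<subseteq> U" "card P = 3" for P
          using tri_rest [OF T] that by (auto simp: U_def)
      qed
      then show ?thesis using base \<open>hp T\<close> by simp
    next
      case False
      then have g: "0 \<le> wgt (k - 1) (dg A U x)" using wgt_cases [of "k - 1" "dg A U x"] by auto
      have xn: "x \<notin> gn T" "x \<notin> drp T" using x(2) k3 by (auto simp: gn_def drp_def wgt_def)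
      have "wt A V k - sum w (V - U) + (\<Sum>v\<in>U. c v + (if v = x then 1 else 0)) \<le> wt A U (k - 1)"
      proof (rule wt_sub [OF U(1)])
        fix v assume "v \<in> U"
        then show "w v + (c v + (if v = x then 1 else 0)) \<le> wgt (k - 1) (dg A U v)"
          using c [of v] g x(2) xn by (auto simp: c_def)
      qed
      then show ?thesis using r sc U(2,3) x(1) \<open>hp T\<close> by (simp add: sum.distrib)
    qed
  qed
qed

section \<open>Consequences of minimality\<close>

lemma deg_ge2:
  assumes x: "x \<in> V"
  shows "2 \<le> d x"
proof (rule ccontr)
  assume "\<not> ?thesis"
  then have "wt A V k \<le> wt A (V - {x}) k" using delete_leaf_wt [OF fin x S I, of k] k3 by simp
  then have "packs A (V - {x}) k"
    using IH [of "V - {x}" A k] card_Diff1_less [OF fin x] fin S I k3 wV tri_meeting_mono [OF t1, of "V - {x}"]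
    by (auto simp: admissible_def)
  then show False using np packs_mono by blast
qed

text \<open>A contraction of sufficient weight can fail only by creating two disjoint triangles. One
  of them avoids the merged vertex and is a triangle \<open>T\<close> of the graph; the other one
  would be disjoint from \<open>T\<close> already in the graph, at \<open>x\<close> or at
  \<open>y\<close>, unless it arises from a 4-cycle through \<open>xy\<close>.\<close>

lemma contract_cyc:
  assumes x: "x \<in> V" "y \<in> V" "A x y" and nc: "\<And>z. z \<in> V \<Longrightarrow> A x z \<Longrightarrow> \<not> A y z"
    and wx: "2 * int k + w x \<le> wt A V k"
  obtains p q T where "p \<in> V" "q \<in> V" "A x p" "A y q" "A p q" "p \<noteq> y" "q \<noteq> x"
    "tri T" "T \<inter> {x, y, p, q} = {}"
proof -
  let ?C = "contr A x y"
  have "wt A V k - w x \<le> wt ?C (V - {x}) k" by (rule contr_wt [OF fin x S I nc deg_ge2 [OF x(1)]])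
  moreover have "\<not> packs ?C (V - {x}) k"
    using contr_packs [of A x y "V - {x}" k] np x S I by (auto simp: insert_absorb)
  ultimately have "\<not> admissible k ?C (V - {x})"
    using IH [of "V - {x}" ?C k] card_Diff1_less [OF fin x(1)] fin k3 wx contr_symp [OF S, of x y]
      contr_irreflp [of A x y] by auto
  then have "\<not> tri_meeting ?C (V - {x})" using k3 by (simp add: admissible_def)
  then obtain P Q where PQ: "P \<subseteq> V - {x}" "Q \<subseteq> V - {x}" "card P = 3" "card Q = 3" "pairwise ?C P"
    "pairwise ?C Q" "P \<inter> Q = {}" unfolding tri_meeting_def by blast
  have tA: "tri R" if "R \<subseteq> V - {x}" "card R = 3" "pairwise ?C R" "y \<notin> R" for R
    using contr_triangle [OF that] that by (auto simp: tri_def)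
  have "\<exists>P T. P \<subseteq> V - {x} \<and> card P = 3 \<and> pairwise ?C P \<and> y \<in> P \<and> tri T \<and> x \<notin> T \<and> P \<inter> T = {}"
  proof (cases "y \<in> P")
    case True
    then have "tri Q" using tA [of Q] PQ by blast
    then show ?thesis using True PQ by blast
  next
    case False
    then have "tri P" using tA [of P] PQ by blast
    moreover have "y \<in> Q" using tri_meet [of P Q] tA [of Q] PQ \<open>tri P\<close> by blast
    ultimately show ?thesis using PQ by blast
  qed
  then obtain P T where P: "P \<subseteq> V - {x}" "card P = 3" "pairwise ?C P" "y \<in> P" and T: "tri T" "x \<notin> T" "P \<inter> T = {}"
    by blast
  have "card (P - {y}) = 2" using P by simp
  then obtain u v where uv: "P - {y} = {u, v}" "u \<noteq> v" by (auto simp: card_2_iff)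
  have uvV: "u \<in> V" "v \<in> V" "u \<noteq> x" "v \<noteq> x" "u \<noteq> y" "v \<noteq> y" "u \<notin> T" "v \<notin> T" "y \<notin> T"
    using uv P T by auto
  have uP: "u \<in> P" "v \<in> P" using uv by auto
  have "?C y u" "?C y v" "?C u v"
    using P(3,4) uP uvV(5,6) uv(2) unfolding pairwise_def by metis+
  then have a: "A y u \<or> A x u" "A y v \<or> A x v" "A u v" using uvV x(3) neqD by (auto simp: contr_def)
  have n1: "\<not> (A y u \<and> A y v)"
  proof
    assume "A y u \<and> A y v"
    then have "tri {y, u, v}" using a uvV x by (intro triI) auto
    then show False using tri_meet [OF _ T(1)] uvV by blast
  qed
  have n2: "\<not> (A x u \<and> A x v)"
  proof
    assume "A x u \<and> A x v"
    then have "tri {x, u, v}" using a uvV x by (intro triI) auto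
    then show False using tri_meet [OF _ T(1)] uvV T by blast
  qed
  show ?thesis
  proof (cases "A x u")
    case True
    then have "A y v" using n2 a by blast
    then show ?thesis using that [of u v T] True a uvV T by auto
  next
    case False
    then have "A y u" "A x v" using n1 a by auto
    then show ?thesis using that [of v u T] a uvV T sym [of u v] by auto
  qed
qed

text \<open>Without triangles no contraction fails, so every vertex is high. The disjoint
  neighbourhoods of two adjacent vertices then give at least \<open>4 * k\<close> vertices of weight
  1, which again leaves room for a contraction.\<close>

lemma ex_tri: "\<exists>T. tri T"
proof (rule ccontr)
  assume n: "\<nexists>T. tri T"
  have nc: "\<not> A y z" if "x \<in> V" "y \<in> V" "A x y" "z \<in> V" "A x z" for x y z
    using n triI [of x y z] that by auto
  have nb: "\<exists>y\<in>V. A x y" if "x \<in> V" for x using deg_ge2 [OF that] dg_pos [OF fin, of A x] by simp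
  have hi: "w x = 1" if x: "x \<in> V" for x
  proof (rule ccontr)
    assume "w x \<noteq> 1"
    then have "2 * int k + w x \<le> wt A V k" using wV wgt_cases [of k "d x"] by auto
    moreover obtain y where y: "y \<in> V" "A x y" using nb [OF x] by blast
    ultimately show False using contract_cyc [OF x y nc [OF x y]] n by metis
  qed
  then have c: "wt A V k = int (card V)" by (simp add: wt_def)
  have "V \<noteq> {}" using wV k3 by (auto simp: wt_def)
  then obtain x where x: "x \<in> V" by auto
  then obtain y where y: "y \<in> V" "A x y" using nb by blast
  have "d x + d y \<le> card V" by (rule disjoint_nbs_card [OF fin]) (use nc [OF x y] in auto)
  moreover have "2 * k \<le> d x" "2 * k \<le> d y" using hi [OF x] hi [OF y(1)] by (simp_all add: wgt_eq_1)
  ultimately have "2 * int k + w x \<le> wt A V k" using c hi [OF x] k3 by simp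
  then show False using contract_cyc [OF x y nc [OF x y]] n by metis
qed

lemma admissible_sub: "U \<subseteq> V \<Longrightarrow> (k = 3 \<Longrightarrow> \<not> K5m A U) \<Longrightarrow> admissible (k - 1) A U"
  using tri_meeting_mono [OF t1, of U] by (auto simp: admissible_def)

lemma four_sum:
  fixes f :: "'a \<Rightarrow> int"
  shows "distinct [a, b, c, e] \<Longrightarrow> (\<Sum>v\<in>{a, b, c, e}. f v) = f a + f b + f c + f e"
  by simp

text \<open>The balance of \<open>tri_loss\<close> for an arbitrary cycle. Triangles may survive its
  deletion, so admissibility is a hypothesis; by \<open>admissible_sub\<close> it can fail only for
  \<open>k = 3\<close>.\<close>

lemma core_loss:
  assumes C: "core A C" "C \<subseteq> V" "admissible (k - 1) A (V - C)" and e: "\<And>v. v \<in> V - C \<Longrightarrow> dg A C v \<le> 3"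
  shows "3 + slack \<le> sum w C + int (card {v \<in> V - C. dg A C v = 3})"
proof -
  have "wt A V k - (\<Sum>v\<in>V - (V - C). w v) + (\<Sum>v\<in>V - C. - (if dg A C v = 3 then 1 else 0)) \<le> wt A (V - C) (k - 1)"
  proof (rule wt_sub)
    fix v assume v: "v \<in> V - C"
    have "d v = dg A (V - C) v + dg A C v" by (rule dg_split [OF fin C(2)])
    then show "w v + - (if dg A C v = 3 then 1 else 0) \<le> wgt (k - 1) (dg A (V - C) v)"
      using e [OF v] k3 wgt_shift [of 1 k "d v" "dg A (V - C) v"] wgt_shift1 [of 1 k "d v" "dg A (V - C) v"]
      by auto
  qed auto
  moreover have "(\<Sum>v\<in>V - C. - (if dg A C v = 3 then 1 else (0::int))) = - int (card {v \<in> V - C. dg A C v = 3})"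
    using fin by (simp add: sum_negf sum.If_cases Int_def)
  moreover have "V - (V - C) = C" using C by auto
  moreover have "wt A (V - C) (k - 1) < 2 * int k - 2" by (rule rest_wt [OF C(1,2) _ C(3)]) auto
  ultimately show ?thesis by simp
qed

lemma core_loss2:
  assumes "core A C" "C \<subseteq> V" "admissible (k - 1) A (V - C)" and e: "\<And>v. v \<in> V - C \<Longrightarrow> dg A C v \<le> 2"
  shows "3 + slack \<le> sum w C"
proof -
  have em: "{v \<in> V - C. dg A C v = 3} = {}" using e by fastforce
  show ?thesis using core_loss [OF assms(1-3)] e unfolding em by fastforce
qed

end

section \<open>Complete subgraphs on five vertices\<close>

text \<open>With \<open>Q\<close> a K5 and \<open>P\<close> a triangle: if \<open>P\<close> leaves
  \<open>Q\<close>, then it misses a whole triangle of \<open>Q\<close>.\<close>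

lemma card_Diff_ge3:
  assumes "finite Q" "card Q = 5" "\<not> P \<subseteq> Q" "card P = 3"
  obtains R where "R \<subseteq> Q - P" "card R = 3"
proof -
  have fP: "finite P" using assms(4) by (simp add: card_ge_0_finite)
  have "P \<inter> Q \<subset> P" using assms(3) by auto
  then have "card (P \<inter> Q) < 3" using psubset_card_mono [OF fP, of "P \<inter> Q"] assms(4) by simp
  moreover have "card (Q - P) = card Q - card (P \<inter> Q)"
    using card_Diff_subset_Int [of Q P] fP by (simp add: Int_commute)
  ultimately have "3 \<le> card (Q - P)" using assms(2) by simp
  then obtain R where "R \<subseteq> Q - P" "card R = 3" by (rule obtain_subset_with_card_n)
  then show ?thesis by (rule that)
qed

context cex begin

text \<open>The neighbours of \<open>x\<close> are pairwise nonadjacent, as \<open>x\<close> lies on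
  no triangle. So the 4-cycle from the failed contraction has no chord, and an outer neighbour of
  \<open>x\<close> is adjacent to neither \<open>y\<close> nor \<open>p\<close>.\<close>

lemma low_cycle:
  assumes x: "x \<in> V" "w x = -1" and y: "y \<in> V" "A x y"
    and xt: "\<And>T. tri T \<Longrightarrow> x \<notin> T"
  obtains p q T where "p \<in> V" "q \<in> V" "A x p" "A y q" "A p q" "p \<noteq> y" "q \<noteq> x"
    "tri T" "T \<inter> {x, y, p, q} = {}"
    "core A {x, y, q, p}" "distinct [x, y, q, p]" "\<not> A x q" "\<not> A y p"
    "\<And>v. v \<in> V - {x, y, q, p} \<Longrightarrow> dg A {x, y, q, p} v \<le> 3"
    "\<And>v. v \<in> V - {x, y, q, p} \<Longrightarrow> dg A {x, y, q, p} v = 3 \<Longrightarrow> A v y \<and> A v q \<and> A v p"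
proof -
  have nc: "\<not> A u v" if "A x u" "A x v" "u \<in> V" "v \<in> V" for u v
    using triI [of x u v] xt [of "{x, u, v}"] that x by auto
  obtain p q T where p: "p \<in> V" "q \<in> V" "A x p" "A y q" "A p q" "p \<noteq> y" "q \<noteq> x"
    and T: "tri T" "T \<inter> {x, y, p, q} = {}"
    by (rule contract_cyc [OF x(1) y]) (use nc [OF y(2)] y wV x in auto)
  have ds: "distinct [x, y, q, p]" using p y neqD by auto
  have c: "core A {x, y, q, p}"
    by (rule core_4 [OF S I y(2) p(4) sym [OF p(5)] sym [OF p(3)]]) (use p in auto)
  have n: "\<not> A x q" using nc [of y q] p y by auto
  have n2: "\<not> A y p" using nc p y by auto
  have dv: "dg A {x, y, q, p} v = (if A v x then 1 else 0) + (if A v y then 1 else 0)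
      + (if A v q then 1 else 0) + (if A v p then 1 else 0)" for v
    using ds by simp
  have vx: "\<not> A v y \<and> \<not> A v p" if "v \<in> V" "A v x" for v
    using nc [of v y] nc [of v p] sym [OF that(2)] that(1) y p by auto
  have e3: "dg A {x, y, q, p} v \<le> 3" if "v \<in> V" for v
    using dv [of v] vx [OF that] by (cases "A v x") auto
  have e3': "A v y \<and> A v q \<and> A v p" if "v \<in> V" "dg A {x, y, q, p} v = 3" for v
    using dv [of v] vx [OF that(1)] that(2) by (cases "A v x") (auto split: if_splits)
  show ?thesis
    by (rule that [OF p T c ds n n2]) (use e3 e3' in auto)
qed

text \<open>All triangles lie inside \<open>Q\<close>, so an outer vertex has at most one neighbour
  in \<open>Q\<close>. The 4-cycle at a low outer vertex can be deleted unless \<open>k = 3\<close>,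
  where \<open>Q\<close> itself is the obstruction and what remains is a forest. Without low outer
  vertices, all outer vertices are high after removing \<open>Q\<close> and lowering
  \<open>k\<close>; hence they are too few to hold the neighbours of two high vertices of
  \<open>Q\<close>.\<close>

lemma K5_False:
  assumes Q: "Q \<subseteq> V" "card Q = 5" "pairwise A Q"
  shows False
proof -
  have fQ: "finite Q" using Q fin finite_subset by blast
  have triQ: "tri R" if "R \<subseteq> Q" "card R = 3" for R
    using that Q by (auto simp: tri_def intro: pairwise_subset)
  have tin: "P \<subseteq> Q" if P: "tri P" for P
  proof (rule ccontr)
    assume "\<not> P \<subseteq> Q"
    then obtain R where "R \<subseteq> Q - P" "card R = 3"
      using card_Diff_ge3 [OF fQ Q(2), of P] P by (auto simp: tri_def)
    then show False using tri_meet [OF P triQ [of R]] by blast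
  qed
  have aQ: "A u v" if "u \<in> Q" "v \<in> Q" "u \<noteq> v" for u v using Q(3) that by (auto simp: pairwise_def)
  have e1: "u = v" if "z \<in> V - Q" "u \<in> Q" "v \<in> Q" "A z u" "A z v" for z u v
  proof (rule ccontr)
    assume "u \<noteq> v"
    then have "tri {z, u, v}" using that Q aQ by (intro triI) auto
    then show False using tin that by blast
  qed
  have e1': "dg A Q z \<le> 1" if "z \<in> V - Q" for z
  proof (rule ccontr)
    assume "\<not> ?thesis"
    then have "2 \<le> dg A Q z" by simp
    then show False by (rule dg_ge2E) (use e1 [OF that] in blast)
  qed
  have dV: "d v = dg A (V - Q) v + dg A Q v" for v by (rule dg_split [OF fin Q(1)])
  obtain T where TQ: "T \<subseteq> Q" "card T = 3" using obtain_subset_with_card_n [of 3 Q] Q(2) by auto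
  have T: "tri T" by (rule triQ [OF TQ])
  show False
  proof (cases "\<exists>x\<in>V - Q. w x = -1")
    case True
    then obtain x where x: "x \<in> V" "x \<notin> Q" "w x = -1" by auto
    obtain y where y: "y \<in> V" "A x y" using deg_ge2 [OF x(1)] dg_pos [OF fin, of A x] by auto
    have xt: "x \<notin> R" if "tri R" for R using tin [OF that] x by auto
    obtain p q R where p: "p \<in> V" "q \<in> V" "A x p" "A y q" "A p q" "p \<noteq> y" "q \<noteq> x"
      and c: "core A {x, y, q, p}" "distinct [x, y, q, p]" "\<not> A x q" "\<not> A y p"
      and e: "\<And>v. v \<in> V - {x, y, q, p} \<Longrightarrow> dg A {x, y, q, p} v \<le> 3"
        "\<And>v. v \<in> V - {x, y, q, p} \<Longrightarrow> dg A {x, y, q, p} v = 3 \<Longrightarrow> A v y \<and> A v q \<and> A v p"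
      by (rule low_cycle [OF x(1,3) y xt]) blast+
    define C where "C = {x, y, q, p}"
    have CV: "C \<subseteq> V" using x y p by (simp add: C_def)
    have e2: "dg A C v \<noteq> 3" if "v \<in> V - C" for v
    proof
      assume "dg A C v = 3"
      then have a: "A v y" "A v q" "A v p" using e(2) that by (auto simp: C_def)
      then have "tri {v, y, q}" "tri {v, q, p}" using y p that sym [OF p(5)] by (auto intro!: triI)
      then have "y \<in> Q" "p \<in> Q" using tin by blast+
      then show False using e1 [of x y p] x y p by auto
    qed
    have sC: "sum w C = w x + w y + w q + w p" unfolding C_def by (rule four_sum [OF c(2)])
    have sC2: "sum w C \<le> 2"
      using sC x(3) wgt_le1 [of k "d y"] wgt_le1 [of k "d q"] wgt_le1 [of k "d p"] by linarith
    have "\<not> admissible (k - 1) A (V - C)"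
    proof
      assume o: "admissible (k - 1) A (V - C)"
      have "dg A C v \<le> 2" if "v \<in> V - C" for v using e2 [OF that] e(1) [of v] that by (simp add: C_def)
      then have "3 + slack \<le> sum w C" using core_loss2 [OF _ CV o] c(1) by (simp add: C_def)
      then show False using sC2 wV by simp
    qed
    then have kk: "k = 3" and k5: "K5m A (V - C)" using admissible_sub [of "V - C"] by auto
    obtain a b e' s t where K: "{a, b, e', s, t} \<subseteq> V - C" "distinct [a, b, e', s, t]"
      "pairwise A {a, b, e', s}" "pairwise A {a, b, e', t}" using k5 by (rule K5mE)
    have "tri {a, b, s}" "tri {b, e', t}"
      using K CV by (auto simp: tri_def intro: pairwise_subset)
    then have "{a, b, e', s, t} \<subseteq> Q" using tin by blast
    moreover have "card {a, b, e', s, t} = 5" using K(2) by simp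
    ultimately have "{a, b, e', s, t} = Q" using fQ Q(2) card_subset_eq by metis
    then have QC: "Q \<inter> C = {}" using K by auto
    define F where "F = V - C - Q"
    have F: "finite F" "F \<subseteq> V" using fin by (auto simp: F_def)
    have fC: "finite C" by (simp add: C_def)
    have dF: "d v = dg A F v + dg A C v + dg A Q v" for v
      using dg_split [OF fin CV, of A v] dg_split [of "V - C" Q A v] fin QC Q(1) by (auto simp: F_def)
    \<comment> \<open>For \<open>k = 3\<close> no two disjoint cores avoid the triangle
      \<open>T\<close>, and \<open>C\<close> is one that does.\<close>
    have cF: "\<not> core A B" if "B \<subseteq> F" for B
    proof
      assume B: "core A B"
      have "packs A (V - T) 2"
        by (rule packs_2I [OF B c(1)]) (use that CV QC TQ in \<open>auto simp: F_def C_def\<close>)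
      then show False using no_packs_rest [OF tri_core [OF T], of "V - T"] T kk by (simp add: tri_def)
    qed
    have sV: "wt A V k = sum w F + sum w Q + sum w C"
      unfolding wt_def F_def using sum.subset_diff [OF CV fin, of w]
        sum.subset_diff [of Q "V - C" w] fin Q(1) QC by auto
    have sQ: "sum w Q \<le> 5" using sum_mono [of Q w "\<lambda>_. 1"] wgt_le1 Q(2) by simp
    show False
    proof (cases "2 \<le> card F")
      case True
      \<comment> \<open>At most 2 neighbours on \<open>C\<close> and 1 in \<open>Q\<close>, while
        for \<open>k = 3\<close> the weight is the sign of the degree minus 5.\<close>
      have "sum w F \<le> (\<Sum>v\<in>F. sgn (int (dg A F v) - 2))"
      proof (rule sum_mono)
        fix v assume v: "v \<in> F"
        have "dg A C v \<le> 3" "dg A C v \<noteq> 3" using e2 e(1) v by (auto simp: F_def C_def)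
        then have "d v \<le> dg A F v + 3" using dF [of v] e1' [of v] v by (auto simp: F_def)
        then show "w v \<le> sgn (int (dg A F v) - 2)" using kk by (auto simp: wgt_def sgn_if)
      qed
      also have "\<dots> \<le> -2" by (rule coreless_sgn [OF F(1) True cF S I])
      finally show False using sV sQ sC2 wV kk by simp
    next
      case False
      \<comment> \<open>At most 3 neighbours on \<open>C\<close>, 1 in \<open>F\<close> and 1 in
        \<open>Q\<close> make degree 5, which is not high for \<open>k = 3\<close>.\<close>
      have lo: "w v \<le> 0" if "v \<in> C" for v
      proof -
        have "dg A C v \<le> card (C - {v})" unfolding dg_def using fC irr by (intro card_mono) auto
        then have "dg A C v \<le> 3" using that c(2) fC by (auto simp: C_def)
        moreover have "dg A F v \<le> 1" using False dg_le_card [OF F(1), of A v] by simp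
        moreover have "v \<in> V - Q" using that QC CV by auto
        ultimately have "d v \<le> 5" using dF [of v] e1' [of v] by simp
        then show ?thesis using kk by (simp add: wgt_def sgn_if)
      qed
      have "w y \<le> 0" "w q \<le> 0" "w p \<le> 0" by (auto intro!: lo simp: C_def)
      then have "sum w C \<le> -1" using sC x(3) by simp
      moreover have "sum w F \<le> 1" using sum_mono [of F w "\<lambda>_. 1"] wgt_le1 False by simp
      ultimately show False using sV sQ wV kk by simp
    qed
  next
    case False
    define Z where "Z = V - Q"
    have Z: "finite Z" "Z \<subseteq> V" using fin by (auto simp: Z_def)
    have "wgt (k - 1) (dg A Z z) = 1" if "z \<in> Z" for z
    proof -
      have "2 * k - 1 \<le> d z" using False that wgt_eq_m1 [of k "d z"] k3 by (force simp: Z_def)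
      then have "2 * (k - 1) \<le> dg A Z z" using dV [of z] e1' [of z] that by (simp add: Z_def)
      then show ?thesis by (simp add: wgt_eq_1)
    qed
    then have "wt A Z (k - 1) = int (card Z)" by (simp add: wt_def)
    moreover have "wt A Z (k - 1) < 2 * int k - 2"
      by (rule rest_wt [OF tri_core [OF T] _ _ tri_rest_admissible [OF T]]) (use TQ Q(1) in \<open>auto simp: Z_def\<close>)
    ultimately have cZ: "int (card Z) \<le> 2 * int k - 3" by simp
    have "wt A V k = sum w Z + sum w Q"
      unfolding wt_def Z_def by (rule sum.subset_diff [OF Q(1) fin])
    moreover have "sum w Z \<le> int (card Z)" using sum_mono [of Z w "\<lambda>_. 1"] wgt_le1 by simp
    ultimately have sQ: "3 \<le> sum w Q" using wV cZ by simp
    have "sum w Q \<le> (\<Sum>v\<in>Q. if w v = 1 then 1 else 0)"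
      by (rule sum_mono) (use wgt_cases in \<open>force\<close>)
    also have "\<dots> = int (card {v \<in> Q. w v = 1})" using fQ by (simp add: sum.If_cases Int_def)
    finally have "2 \<le> card {v \<in> Q. w v = 1}" using sQ by simp
    then obtain a b where ab: "a \<in> Q" "b \<in> Q" "a \<noteq> b" "w a = 1" "w b = 1"
      by (rule card_ge2E) blast
    have big: "2 * k \<le> dg A Z v + 4" if "v \<in> Q" "w v = 1" for v
    proof -
      have "dg A Q v \<le> card (Q - {v})" unfolding dg_def using fQ irr by (intro card_mono) auto
      then have "dg A Q v \<le> 4" using that fQ Q(2) by simp
      then show ?thesis using dV [of v] that by (simp add: Z_def wgt_eq_1)
    qed
    \<comment> \<open>No outer vertex is adjacent to both \<open>a\<close> and \<open>b\<close>, so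
      \<open>2 * (2 * k - 4) \<le> 2 * k - 3\<close>, which is false for
      \<open>k \<ge> 3\<close>.\<close>
    have "dg A Z a + dg A Z b \<le> card Z"
    proof (rule disjoint_nbs_card [OF Z(1)])
      show "{u \<in> Z. A a u} \<inter> {u \<in> Z. A b u} = {}"
        using e1 [of _ a b] ab sym by (auto simp: Z_def)
    qed
    then show False using big [of a] big [of b] ab cZ k3 by simp
  qed
qed


section \<open>Complete subgraphs on four vertices\<close>

definition clq4 :: "'a set \<Rightarrow> bool" where
  "clq4 Q \<longleftrightarrow> Q \<subseteq> V \<and> card Q = 4 \<and> pairwise A Q"

text \<open>Triangles \<open>Q - {c}\<close> that contain \<open>\<delta>\<close> have at most the common neighbour \<open>c\<close>, so their deletion is cheap.\<close>

definition star :: "'a set \<Rightarrow> 'a \<Rightarrow> bool" where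
  "star Q \<delta> \<longleftrightarrow> clq4 Q \<and> \<delta> \<in> Q \<and> (\<forall>v\<in>V - Q. 3 \<le> dg A Q v \<longrightarrow> \<not> A v \<delta>)"

lemma clq4_finite: "clq4 Q \<Longrightarrow> finite Q"
  by (simp add: clq4_def card_ge_0_finite)

lemma clq4_adj: "clq4 Q \<Longrightarrow> u \<in> Q \<Longrightarrow> v \<in> Q \<Longrightarrow> u \<noteq> v \<Longrightarrow> A u v"
  by (auto simp: clq4_def pairwise_def)

lemma clq4_sub: "clq4 Q \<Longrightarrow> u \<in> Q \<Longrightarrow> u \<in> V"
  by (auto simp: clq4_def)

lemma clq4_tri: "clq4 Q \<Longrightarrow> R \<subseteq> Q \<Longrightarrow> card R = 3 \<Longrightarrow> tri R"
  by (auto simp: clq4_def tri_def intro: pairwise_subset)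

lemma clq4_minus: "clq4 Q \<Longrightarrow> u \<in> Q \<Longrightarrow> tri (Q - {u})"
  by (rule clq4_tri) (auto simp: clq4_def)

text \<open>The third vertex of \<open>P\<close> meets the K4 at most once, which leaves a triangle
  of the K4 disjoint from \<open>P\<close>. Hence adjacent vertices outside a K4 have no common
  neighbour at all.\<close>

lemma clq4_meet:
  assumes "clq4 Q" "tri P" "u \<in> P" "v \<in> P" "u \<noteq> v" "u \<notin> Q" "v \<notin> Q"
  shows False
proof -
  have "card (P - {u, v}) = 1"
    using assms tri_finite [OF assms(2)] by (simp add: tri_def card_Diff_subset)
  then obtain z where z: "P - {u, v} = {z}" by (auto simp: card_1_singleton_iff)
  have "card (Q - {z}) \<ge> card Q - 1" using clq4_finite [OF assms(1)] by (simp add: card_Diff_singleton_if)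
  then have "3 \<le> card (Q - {z})" using assms(1) by (simp add: clq4_def)
  then obtain R where R: "R \<subseteq> Q - {z}" "card R = 3" by (rule obtain_subset_with_card_n)
  have "tri R" by (rule clq4_tri [OF assms(1)]) (use R in auto)
  then show False using tri_meet [OF assms(2)] R z assms(6,7) by blast
qed

lemma clq4_meet3:
  "clq4 Q \<Longrightarrow> A a b \<Longrightarrow> A a c \<Longrightarrow> A b c \<Longrightarrow> {a, b, c} \<subseteq> V \<Longrightarrow> a \<notin> Q \<Longrightarrow> b \<notin> Q \<Longrightarrow> False"
  using clq4_meet [of Q "{a, b, c}" a b] triI [of a b c] neqD [of a b] by blast

lemma clq4_dg:
  assumes "clq4 Q" "v \<in> V" "v \<notin> Q"
  shows "dg A Q v \<le> 3"
proof (rule ccontr)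
  assume "\<not> ?thesis"
  then have "dg A Q v = card Q"
    using dg_le_card [OF clq4_finite [OF assms(1)], of A v] assms(1) by (simp add: clq4_def)
  then have "A v u" if "u \<in> Q" for u using dg_full [OF clq4_finite [OF assms(1)] _ that] by blast
  then have "pairwise A (insert v Q)" using assms(1) sym by (auto simp: clq4_def pairwise_insert)
  moreover have "insert v Q \<subseteq> V" "card (insert v Q) = 5"
    using assms clq4_finite [OF assms(1)] by (auto simp: clq4_def)
  ultimately show False using K5_False by blast
qed

text \<open>All outer vertices with three neighbours in \<open>Q\<close> miss the same vertex. If
  \<open>v\<close> misses \<open>\<delta>\<close> and \<open>u\<close> does not, then
  \<open>u\<close>, \<open>\<delta>\<close> and another neighbour of \<open>u\<close> in
  \<open>Q\<close> form a triangle, and \<open>v\<close> with the other two vertices of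
  \<open>Q\<close> forms a disjoint one.\<close>

lemma star_ex:
  assumes "clq4 Q"
  shows "\<exists>\<delta>. star Q \<delta>"
proof (cases "\<exists>v\<in>V - Q. 3 \<le> dg A Q v")
  case False
  have "Q \<noteq> {}" using assms by (auto simp: clq4_def)
  then show ?thesis using False assms by (auto simp: star_def)
next
  case True
  then obtain v where v: "v \<in> V - Q" "3 \<le> dg A Q v" by auto
  have fQ: "finite Q" by (rule clq4_finite [OF assms])
  have d3: "dg A Q v = 3" using clq4_dg [OF assms, of v] v by auto
  have "card (Q - {u \<in> Q. A v u}) = 1"
    using d3 assms fQ by (simp add: dg_def clq4_def card_Diff_subset)
  then obtain \<delta> where del: "Q - {u \<in> Q. A v u} = {\<delta>}" by (auto simp: card_1_singleton_iff)
  have vQ: "A v u" if "u \<in> Q" "u \<noteq> \<delta>" for u using del that by blast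
  have dQ: "\<delta> \<in> Q" "\<not> A v \<delta>" using del by auto
  have "\<not> A u \<delta>" if u: "u \<in> V - Q" "3 \<le> dg A Q u" for u
  proof
    assume ud: "A u \<delta>"
    have "u \<noteq> v" using ud dQ by auto
    have "dg A Q u = dg A (Q - {\<delta>}) u + 1" using dg_remove [OF fQ dQ(1), of A u] ud by simp
    then have "0 < dg A (Q - {\<delta>}) u" using u by simp
    then obtain e where e: "e \<in> Q" "e \<noteq> \<delta>" "A u e" using dg_pos [of "Q - {\<delta>}" A u] fQ by auto
    have t1: "tri {u, \<delta>, e}" using u e dQ ud clq4_adj [OF assms dQ(1), of e] clq4_sub [OF assms] by (intro triI) auto
    have "card (Q - {\<delta>, e}) = 2" using assms fQ e dQ by (simp add: clq4_def card_Diff_subset)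
    then obtain b c where bc: "Q - {\<delta>, e} = {b, c}" "b \<noteq> c" by (auto simp: card_2_iff)
    have b: "b \<in> Q" "c \<in> Q" "b \<noteq> \<delta>" "c \<noteq> \<delta>" "b \<noteq> e" "c \<noteq> e" using bc(1) by auto
    have "tri {v, b, c}" using v b bc(2) vQ clq4_adj [OF assms b(1,2)] clq4_sub [OF assms] by (intro triI) auto
    then have "{u, \<delta>, e} \<inter> {v, b, c} \<noteq> {}" by (rule tri_meet [OF t1])
    then show False using u v b e dQ \<open>u \<noteq> v\<close> by auto
  qed
  then show ?thesis using assms dQ(1) by (auto simp: star_def)
qed

lemma starE:
  assumes "star Q \<delta>"
  obtains a b c where "Q = {\<delta>, a, b, c}" "distinct [\<delta>, a, b, c]"
    "A a b" "A a c" "A b c" "A \<delta> a" "A \<delta> b" "A \<delta> c" "{\<delta>, a, b, c} \<subseteq> V"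
proof -
  have Q: "clq4 Q" "\<delta> \<in> Q" using assms by (auto simp: star_def)
  have "card (Q - {\<delta>}) = 3" using Q by (simp add: clq4_def)
  then obtain a b c where abc: "Q - {\<delta>} = {a, b, c}" "a \<noteq> b" "a \<noteq> c" "b \<noteq> c" by (rule card3E)
  have "Q = {\<delta>, a, b, c}" using abc(1) Q(2) by auto
  moreover have "a \<noteq> \<delta>" "b \<noteq> \<delta>" "c \<noteq> \<delta>" using abc(1) by auto
  ultimately show ?thesis using that [of a b c] abc clq4_adj [OF Q(1)] Q(1) by (simp add: clq4_def)
qed

text \<open>An outer vertex complete to \<open>Q - {c}\<close> would have three neighbours in
  \<open>Q\<close> including \<open>\<delta>\<close>; so only \<open>c\<close> itself can
  drop.\<close>

lemma star_loss:
  assumes s: "star Q \<delta>" and c: "c \<in> Q" "c \<noteq> \<delta>"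
  shows "3 + slack + int (card (gn (Q - {c}))) + (if hp (Q - {c}) then 1 else 0)
    \<le> sum w (Q - {c}) + (if d c = 2 * k \<or> d c = 2 * k - 1 then 1 else 0)"
proof -
  have Q: "clq4 Q" "\<delta> \<in> Q" using s by (auto simp: star_def)
  have fQ: "finite Q" by (rule clq4_finite [OF Q(1)])
  have "drp (Q - {c}) \<subseteq> (if d c = 2 * k \<or> d c = 2 * k - 1 then {c} else {})"
  proof
    fix v assume v: "v \<in> drp (Q - {c})"
    have "v = c"
    proof (rule ccontr)
      assume "v \<noteq> c"
      then have vQ: "v \<in> V - Q" and d3: "dg A (Q - {c}) v = card (Q - {c})"
        using v Q c fQ by (auto simp: drp_def clq4_def)
      have "A v \<delta>" by (rule dg_full [OF _ d3]) (use fQ Q c in auto)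
      moreover have "3 \<le> dg A Q v" using dg_mono [of Q "Q - {c}" A v] fQ v by (auto simp: drp_def)
      ultimately show False using s vQ by (auto simp: star_def)
    qed
    then show "v \<in> (if d c = 2 * k \<or> d c = 2 * k - 1 then {c} else {})" using v by (auto simp: drp_def)
  qed
  then have "card (drp (Q - {c})) \<le> card (if d c = 2 * k \<or> d c = 2 * k - 1 then {c} else {})"
    by (intro card_mono) auto
  then have "int (card (drp (Q - {c}))) \<le> (if d c = 2 * k \<or> d c = 2 * k - 1 then 1 else 0)"
    by (auto split: if_splits)
  then show ?thesis using tri_loss [OF clq4_minus [OF Q(1) c(1)]] by simp
qed

text \<open>A vertex complete to \<open>{m, u, v}\<close> lies in \<open>Q\<close>, since outside it
  would form with \<open>m\<close> and \<open>u\<close> a triangle having two vertices off the K4.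
  So it is a further neighbour of \<open>m\<close> in \<open>Q\<close>.\<close>

lemma out_drp:
  assumes Q: "clq4 Q" and m: "m \<in> V" "m \<notin> Q" and u: "u \<in> Q" "v \<in> Q" "u \<noteq> v" "A m u" "A m v"
  shows "tri {m, u, v}" "drp {m, u, v} \<subseteq> {z \<in> Q - {u, v}. A m z}"
    "card (drp {m, u, v}) + 2 \<le> dg A Q m"
proof -
  show t: "tri {m, u, v}"
    using m u clq4_adj [OF Q u(1-3)] clq4_sub [OF Q] by (intro triI) auto
  show d: "drp {m, u, v} \<subseteq> {z \<in> Q - {u, v}. A m z}"
  proof
    fix z assume z: "z \<in> drp {m, u, v}"
    then have "dg A {m, u, v} z = card {m, u, v}" using t by (auto simp: drp_def tri_def)
    then have zz: "A z m" "A z u" using dg_full [of "{m, u, v}" A z] by auto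
    moreover have "z \<in> Q"
      using clq4_meet3 [OF Q, of z m u] zz z m u clq4_sub [OF Q] by (auto simp: drp_def)
    ultimately show "z \<in> {z \<in> Q - {u, v}. A m z}" using z sym by (auto simp: drp_def)
  qed
  have fQ: "finite Q" by (rule clq4_finite [OF Q])
  have "card (drp {m, u, v}) \<le> card ({z \<in> Q. A m z} - {u, v})"
    using d fQ by (intro card_mono) auto
  also have "\<dots> + 2 = dg A Q m"
  proof -
    have "card {u, v} \<le> card {z \<in> Q. A m z}" using u fQ by (intro card_mono) auto
    then show ?thesis using u fQ by (simp add: card_Diff_subset dg_def)
  qed
  finally show "card (drp {m, u, v}) + 2 \<le> dg A Q m" by simp
qed

lemma sum3: 
  fixes f :: "'a \<Rightarrow> int"
  shows "tri {a, b, c} \<Longrightarrow> (\<Sum>v\<in>{a, b, c}. f v) = f a + f b + f c"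
proof -
  assume "tri {a, b, c}"
  then have "card {a, b, c} = 3" by (simp add: tri_def)
  then have "a \<noteq> b" "a \<noteq> c" "b \<noteq> c" by (auto simp: card_insert_if split: if_splits)
  then show ?thesis by simp
qed

lemma out_loss:
  assumes Q: "clq4 Q" and m: "m \<in> V" "m \<notin> Q" and u: "u \<in> Q" "v \<in> Q" "u \<noteq> v" "A m u" "A m v"
  shows "3 + slack + int (card (gn {m, u, v})) + (if hp {m, u, v} then 1 else 0)
    \<le> w m + w u + w v + (if dg A Q m = 3 then 1 else 0)"
  using tri_loss [OF out_drp(1) [OF assms]] sum3 [OF out_drp(1) [OF assms], of w] out_drp(3) [OF assms]
    clq4_dg [OF Q m] by (auto split: if_splits)

section \<open>Counterexamples without low vertices\<close>

lemma gn_empty: "card (gn T) = 0 \<Longrightarrow> v \<in> V \<Longrightarrow> v \<notin> T \<Longrightarrow> w v = 0 \<Longrightarrow> 2 \<le> dg A T v"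
  using fin by (fastforce simp: gn_def card_eq_0_iff)

lemma drp_clq4:
  assumes T: "tri T" and v: "v \<in> drp T"
  shows "clq4 (insert v T)"
proof -
  have v': "v \<in> V" "v \<notin> T" "dg A T v = card T" using v T by (auto simp: drp_def tri_def)
  then have "A v u" if "u \<in> T" for u using dg_full [OF tri_finite [OF T] _ that] by blast
  then have "pairwise A (insert v T)" using T sym by (auto simp: tri_def pairwise_insert)
  then show ?thesis using T v' tri_finite [OF T] by (auto simp: clq4_def tri_def)
qed

text \<open>Without a K4 nothing is complete to a triangle, so all triangle balances are tight:
  triangles consist of high vertices, and a vertex of weight 0 has two neighbours on each triangle,
  hence lies on one itself. Thus all vertices are high and there are only \<open>2 * k\<close> of
  them, too few for their degrees.\<close>

lemma no_low_K4_free_False: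
  assumes nl: "\<And>v. v \<in> V \<Longrightarrow> 0 \<le> w v" and n4: "\<nexists>Q. clq4 Q"
  shows False
proof -
  have dr: "drp T = {}" if T: "tri T" for T using drp_clq4 [OF T] n4 by blast
  obtain T where T: "tri T" using ex_tri by blast
  have full: "sum w T \<le> 3" if "tri T" for T
    using sum_mono [of T w "\<lambda>_. 1"] wgt_le1 that by (simp add: tri_def)
  have loss: "3 + slack + int (card (gn T)) \<le> sum w T" if "tri T" for T
    using tri_loss [OF that] dr [OF that] by (simp split: if_splits)
  have s0: "slack = 0" and g0: "card (gn T) = 0" if "tri T" for T
    using loss [OF that] full [OF that] wV by simp_all
  have all1: "w v = 1" if "tri T" "v \<in> T" for T v
  proof (rule ccontr)
    assume "w v \<noteq> 1"
    then have "w v < 1" using wgt_le1 [of k "d v"] by simp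
    then have "sum w T < (\<Sum>v\<in>T. 1)"
      using that tri_finite wgt_le1 by (intro sum_strict_mono_ex1) auto
    then show False using loss [OF that(1)] wV that by (simp add: tri_def)
  qed
  have w1: "w v = 1" if v: "v \<in> V" for v
  proof (rule ccontr)
    assume n: "w v \<noteq> 1"
    then have w0: "w v = 0" using nl [OF v] wgt_le1 [of k "d v"] by simp
    have vT: "v \<notin> T" using all1 [OF T] n by auto
    have "2 \<le> dg A T v" by (rule gn_empty [OF g0 [OF T] v vT w0])
    then obtain a b where "a \<in> T" "b \<in> T" "a \<noteq> b" "A v a" "A v b" by (rule dg_ge2E)
    then have "tri {v, a, b}" using v T tri_adj [OF T, of a b] by (intro triI) (auto simp: tri_def)
    then show False using all1 n by blast
  qed
  have "wt A V k = int (card V)" unfolding wt_def using w1 by simp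
  then have c: "card V = 2 * k" "\<And>v. v \<in> V \<Longrightarrow> 2 * k \<le> d v"
    using s0 [OF T] w1 by (simp_all add: wgt_eq_1)
  obtain v where v: "v \<in> V" using T by (fastforce simp: tri_def)
  have "d v \<le> card (V - {v})" unfolding dg_def using fin irr by (intro card_mono) auto
  then show False using c(1) c(2) [OF v] v fin k3 by simp
qed

text \<open>If an outer vertex of weight 0 has three neighbours in the K4, tightness puts all
  vertices of weight 0 next to a vertex of degree \<open>2 * k\<close>, and two adjacent outer
  vertices have too many neighbours. Otherwise at most one vertex has weight 0, so that high
  vertices are adjacent to everything, and six of them contain two disjoint triangles.\<close>

lemma no_low_False:
  assumes nl: "\<And>v. v \<in> V \<Longrightarrow> 0 \<le> w v"
  shows False
proof -
  obtain Q where Q: "clq4 Q" using no_low_K4_free_False [OF nl] by blast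
  obtain \<delta> where s: "star Q \<delta>" using star_ex [OF Q] by blast
  obtain a b c where abc: "Q = {\<delta>, a, b, c}" "distinct [\<delta>, a, b, c]" "A a b" "A a c" "A b c"
    "A \<delta> a" "A \<delta> b" "A \<delta> c" "{\<delta>, a, b, c} \<subseteq> V" using s by (rule starE)
  have fQ: "finite Q" by (rule clq4_finite [OF Q])
  define M where "M = {v \<in> V. w v = 0}"
  have fM: "finite M" "M \<subseteq> V" using fin by (auto simp: M_def)
  have cV: "wt A V k + int (card M) = int (card V)"
  proof -
    have "wt A V k = (\<Sum>v\<in>V. 1 - (if v \<in> M then 1 else 0))"
      unfolding wt_def using nl wgt_cases by (intro sum.cong) (force simp: M_def)+
    moreover have "V \<inter> M = M" by (auto simp: M_def)
    ultimately show ?thesis using fin by (simp add: sum_subtractf sum.If_cases)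
  qed
  show False
  proof (cases "\<exists>m\<in>V - Q. w m = 0 \<and> dg A Q m = 3")
    case True
    then obtain m where m: "m \<in> V" "m \<notin> Q" "w m = 0" "dg A Q m = 3" by auto
    have nd: "\<not> A m \<delta>" using s m by (auto simp: star_def)
    have ma: "A m a" "A m b" "A m c" using m(4) nd abc(1,2) by (auto split: if_splits)
    have l1: "3 + slack + int (card (gn {m, a, b})) \<le> w a + w b + 1"
      using out_loss [OF Q m(1,2), of a b] abc(1,2) ma m by (auto split: if_splits)
    have t2: "tri {m, b, c}" and d2: "drp {m, b, c} \<subseteq> {z \<in> Q - {b, c}. A m z}"
      using out_drp [OF Q m(1,2), of b c] abc(1,2) ma by auto
    have l3: "3 + slack \<le> w b + w c + int (card (drp {m, b, c}))"
      using tri_loss [OF t2] sum3 [OF t2, of w] m by (simp split: if_splits)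
    have w1: "w a = 1" "w b = 1" "slack = 0" "card (gn {m, a, b}) = 0"
      using l1 wV wgt_le1 [of k "d a"] wgt_le1 [of k "d b"] by simp_all
    \<comment> \<open>This triangle weighs at most 2, so some vertex has to drop. It can only be
      \<open>a\<close>, whose degree is thereby determined.\<close>
    have "drp {m, b, c} \<noteq> {}" using l3 w1 wgt_le1 [of k "d c"] by auto
    moreover have "drp {m, b, c} \<subseteq> {a}" using d2 abc(1) nd by auto
    ultimately have "a \<in> drp {m, b, c}" by auto
    then have da: "d a = 2 * k" using w1(1) k3 by (auto simp: drp_def wgt_eq_1)
    have wc: "w c = 1"
    proof -
      have "card (drp {m, b, c}) \<le> card {a}" using \<open>drp {m, b, c} \<subseteq> {a}\<close> by (intro card_mono) auto
      then show ?thesis using l3 w1 wgt_le1 [of k "d c"] by simp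
    qed
    have M: "M \<subseteq> {u \<in> V. A a u} - {b, c}"
    proof
      fix v assume "v \<in> M"
      then have v: "v \<in> V" "w v = 0" by (auto simp: M_def)
      have v3: "v \<noteq> a" "v \<noteq> b" "v \<noteq> c" using v w1 wc by auto
      have "A v a"
      proof (cases "v = m \<or> v = \<delta>")
        case True then show ?thesis using ma abc by auto
      next
        case False
        then have vn: "v \<notin> {m, a, b}" "v \<notin> Q" using v3 abc(1) by auto
        have "2 \<le> dg A {m, a, b} v" by (rule gn_empty [OF w1(4) v(1) vn(1) v(2)])
        moreover have "\<not> (A v m \<and> A v b)" using clq4_meet3 [OF Q, of v m b] v m ma abc vn by auto
        ultimately show ?thesis using m(2) abc(1,2) by (auto split: if_splits)
      qed
      then show "v \<in> {u \<in> V. A a u} - {b, c}" using v v3 sym by auto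
    qed
    have cM: "card M + 2 \<le> 2 * k"
    proof -
      have "card M \<le> card ({u \<in> V. A a u} - {b, c})" using M fin by (intro card_mono) auto
      moreover have "card {b, c} \<le> card {u \<in> V. A a u}" using abc fin by (intro card_mono) auto
      moreover have "card ({u \<in> V. A a u} - {b, c}) = card {u \<in> V. A a u} - 2"
        using abc by (subst card_Diff_subset) auto
      ultimately show ?thesis using da abc(2) by (simp add: dg_def)
    qed
    have dm: "d m = 2 * k - 1" using m(3) wgt_eq_0 [of k "d m"] k3 by simp
    then have "dg A Q m < d m" using m(4) k3 by simp
    then obtain y where y: "y \<in> V" "y \<notin> Q" "A m y" using dg_witness [OF fQ] by metis
    have ya: "\<not> A a y" using clq4_meet3 [OF Q, of m y a] m y ma abc sym [of a y] by auto
    have "w y \<noteq> 0" using ya M y by (auto simp: M_def)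
    then have "w y = 1" using nl [OF y(1)] wgt_le1 [of k "d y"] by simp
    then have dy: "2 * k \<le> d y" by (simp add: wgt_eq_1)
    \<comment> \<open>At least \<open>4 * k - 1\<close> neighbours, against at most
      \<open>2 * k + (2 * k - 2)\<close> vertices.\<close>
    have "d m + d y \<le> card V"
    proof (rule disjoint_nbs_card [OF fin])
      show "{u \<in> V. A m u} \<inter> {u \<in> V. A y u} = {}"
        using clq4_meet3 [OF Q, of m y] m y by auto
    qed
    then show False using cV w1(3) cM dm dy k3 by simp
  next
    case False
    have lo: "dg A Q m \<le> 1" if m: "m \<in> V - Q" "w m = 0" for m
    proof (rule ccontr)
      assume n: "\<not> dg A Q m \<le> 1"
      then have "2 \<le> dg A Q m" by simp
      then obtain u v where uv: "u \<in> Q" "v \<in> Q" "u \<noteq> v" "A m u" "A m v" by (rule dg_ge2E)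
      have "dg A Q m \<noteq> 3" using False m by auto
      then show False using out_loss [OF Q _ _ uv] uv m wgt_le1 [of k "d u"] wgt_le1 [of k "d v"] wV
        by (auto split: if_splits)
    qed
    have MQ: "M - Q \<subseteq> gn (Q - {z})" for z
    proof
      fix m assume m: "m \<in> M - Q"
      have "dg A (Q - {z}) m \<le> dg A Q m" using fQ by (intro dg_mono) auto
      then show "m \<in> gn (Q - {z})" using lo [of m] m by (auto simp: gn_def M_def)
    qed
    have fg: "finite (gn T)" for T using fin by (simp add: gn_def)
    have cMQ: "card (M - Q) \<le> card (gn (Q - {z}))" for z by (rule card_mono [OF fg MQ])
    \<comment> \<open>A vertex of weight 0 enters the balance of \<open>Q - {z}\<close> either as a
      gain, outside \<open>Q\<close>, or as missing weight, inside. Only \<open>z\<close> can drop,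
      so there is room for one.\<close>
    have key: "slack + int (card (M - Q)) \<le> 1 - (if M \<inter> (Q - {z}) = {} then 0 else 1)"
      "card (M \<inter> (Q - {z})) \<le> 1" if z: "z \<in> Q" "z \<noteq> \<delta>" for z
    proof -
      have c3: "card (Q - {z}) = 3" using Q z by (simp add: clq4_def)
      have "sum w (Q - {z}) \<le> (\<Sum>v\<in>Q - {z}. 1 - (if v \<in> M then 1 else 0))"
        using wgt_le1 Q by (intro sum_mono) (auto simp: M_def clq4_def)
      also have "\<dots> = 3 - int (card ((Q - {z}) \<inter> M))"
        using c3 fQ by (simp add: sum_subtractf sum.If_cases)
      finally have *: "3 + slack + int (card (gn (Q - {z}))) \<le> 3 - int (card (M \<inter> (Q - {z}))) + 1"
        using star_loss [OF s z] by (simp add: Int_commute split: if_splits)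
      then show "card (M \<inter> (Q - {z})) \<le> 1" using wV by simp
      show "slack + int (card (M - Q)) \<le> 1 - (if M \<inter> (Q - {z}) = {} then 0 else 1)"
      proof (cases "M \<inter> (Q - {z}) = {}")
        case True then show ?thesis using * cMQ [of z] by simp
      next
        case False
        then have "1 \<le> card (M \<inter> (Q - {z}))" using fM by (simp add: Suc_le_eq card_gt_0_iff)
        then show ?thesis using * cMQ [of z] False by simp
      qed
    qed
    have small: "slack + int (card M) \<le> 1"
    proof -
      have cM: "card M = card (M - Q) + card (M \<inter> Q)"
        using card_Int_Diff [OF fM(1), of Q] by simp
      show ?thesis
      proof (cases "M \<inter> Q = {}")
        case True
        have "a \<in> Q" "a \<noteq> \<delta>" using abc(1,2) by auto
        from key(1) [OF this] True cM show ?thesis by (simp split: if_splits)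
      next
        case F: False
        then obtain u where u: "u \<in> M" "u \<in> Q" by auto
        have ex: "\<exists>z\<in>Q. z \<noteq> \<delta> \<and> z \<noteq> u \<and> z \<noteq> v" for v
        proof -
          have "a \<in> Q" "b \<in> Q" "c \<in> Q" using abc(1) by auto
          moreover have "a \<noteq> \<delta>" "b \<noteq> \<delta>" "c \<noteq> \<delta>" "a \<noteq> b" "a \<noteq> c" "b \<noteq> c" using abc(2) by auto
          ultimately show ?thesis by metis
        qed
        have "M \<inter> Q = {u}"
        proof (rule ccontr)
          assume "M \<inter> Q \<noteq> {u}"
          then obtain v where v: "v \<in> M" "v \<in> Q" "v \<noteq> u" using u by auto
          obtain z where z: "z \<in> Q" "z \<noteq> \<delta>" "z \<noteq> u" "z \<noteq> v" using ex [of v] by blast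
          have "card {u, v} \<le> card (M \<inter> (Q - {z}))" using u v z fM by (intro card_mono) auto
          then show False using key(2) [OF z(1,2)] v by simp
        qed
        moreover obtain z where z: "z \<in> Q" "z \<noteq> \<delta>" "z \<noteq> u" using ex by blast
        moreover have "M \<inter> (Q - {z}) \<noteq> {}" using u z by auto
        ultimately show ?thesis using key(1) [of z] cM by (simp split: if_splits)
      qed
    qed
    then have cV2: "card V \<le> 2 * k + 1" using cV by simp
    define H where "H = {v \<in> V. w v = 1}"
    \<comment> \<open>At least \<open>2 * k\<close> neighbours among at most \<open>2 * k\<close>
      other vertices.\<close>
    have HA: "A u v" if uv: "u \<in> H" "v \<in> V" "u \<noteq> v" for u v
    proof (rule nbs_subset_full [of "V - {u}" V])
      show "z \<in> V - {u}" if "z \<in> V" "A u z" for z using that irr by auto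
      have "2 * k \<le> d u" using uv by (simp add: H_def wgt_eq_1)
      then show "card (V - {u}) \<le> d u" using uv cV2 fin by (simp add: H_def)
    qed (use uv fin in auto)
    have "H = V - M" using nl wgt_cases by (force simp: H_def M_def)
    then have "card H = card V - card M" using fM by (simp add: card_Diff_subset)
    then have cH: "6 \<le> card H" using cV wV k3 by simp
    then obtain P where P: "P \<subseteq> H" "card P = 3" using obtain_subset_with_card_n [of 3 H] by auto
    have fP: "finite P" using P(2) by (simp add: card_ge_0_finite)
    have "3 \<le> card (H - P)" using cH P fP by (simp add: card_Diff_subset)
    then obtain R where R: "R \<subseteq> H - P" "card R = 3" by (rule obtain_subset_with_card_n)
    have trH: "tri P'" if "P' \<subseteq> H" "card P' = 3" for P'
      unfolding tri_def
    proof (intro conjI pairwiseI)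
      show PV: "P' \<subseteq> V" using that by (auto simp: H_def)
      show "A u v" if "u \<in> P'" "v \<in> P'" "u \<noteq> v" for u v
        using HA [of u v] that PV \<open>P' \<subseteq> H\<close> by auto
    qed (rule that(2))
    have "tri P" "tri R" using P R by (auto intro!: trH)
    then show False using tri_meet [of P R] R by blast
  qed
qed


section \<open>Low vertices\<close>

text \<open>A triangle with a low vertex weighs at most 1, so some vertex must be complete to it. In
  the resulting K4 a vertex \<open>c\<close> other than \<open>\<delta>\<close> and \<open>x\<close>
  leaves a triangle through \<open>x\<close> at which at most one vertex drops, and the balance
  needs two.\<close>

lemma low_no_tri:
  assumes T: "tri T" and x: "x \<in> T" "w x = -1"
  shows False
proof (cases "drp T = {}")
  case True
  have "sum w (T - {x}) \<le> 2"
    using sum_mono [of "T - {x}" w "\<lambda>_. 1"] wgt_le1 T x by (simp add: tri_def)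
  then have "sum w T \<le> 1" using sum.remove [OF tri_finite [OF T] x(1), of w] x(2) by simp
  then show False using tri_loss [OF T] True wV by (simp split: if_splits)
next
  case False
  then obtain z where z: "z \<in> drp T" by auto
  have Q: "clq4 (insert z T)" by (rule drp_clq4 [OF T z])
  define Q where "Q = insert z T"
  have Q: "clq4 Q" "x \<in> Q" using Q x by (auto simp: Q_def)
  have fQ: "finite Q" by (rule clq4_finite [OF Q(1)])
  obtain \<delta> where s: "star Q \<delta>" using star_ex [OF Q(1)] by blast
  have "2 \<le> card (Q - {\<delta>, x})"
    using Q s fQ by (cases "x = \<delta>") (simp_all add: star_def clq4_def card_Diff_subset)
  then have "Q - {\<delta>, x} \<noteq> {}" by (metis card.empty not_numeral_le_zero)
  then obtain c where "c \<in> Q - {\<delta>, x}" by blast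
  then have c: "c \<in> Q" "c \<noteq> \<delta>" "c \<noteq> x" by auto
  have "card (Q - {c} - {x}) = 2" using Q c fQ by (simp add: clq4_def)
  then have "sum w (Q - {c} - {x}) \<le> 2"
    using sum_mono [of "Q - {c} - {x}" w "\<lambda>_. 1"] wgt_le1 by simp
  then have "sum w (Q - {c}) \<le> 1"
    using sum.remove [of "Q - {c}" x w] fQ Q(2) c x(2) by simp
  then show False using star_loss [OF s c(1,2)] wV by (simp split: if_splits)
qed

lemma low_nbs:
  assumes x: "x \<in> V" "w x = -1" and "A x u" "A x v" "u \<in> V" "v \<in> V"
  shows "\<not> A u v"
  using low_no_tri [of "{x, u, v}" x] triI [of x u v] assms by auto

lemma hpI:
  assumes x: "x \<in> V" "w x = -1" and "tri T"
    and "A x y" "A x p" "y \<noteq> p" "y \<in> V" "p \<in> V" "y \<notin> T" "p \<notin> T"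
  shows "hp T"
proof -
  have "x \<notin> T" using low_no_tri [OF assms(3)] x by blast
  moreover have "2 \<le> dg A (V - T) x" by (rule dg_ge2I [of _ y p]) (use assms fin in auto)
  ultimately show ?thesis using x by (auto simp: hp_def)
qed

text \<open>Three weights of at most 1 have to make up for at least 3, so nothing else fits into the
  balance.\<close>

lemma tri_loss_no_drp:
  assumes T: "tri T" and "drp T = {}"
  shows "slack = 0" "card (gn T) = 0" "\<not> hp T" "v \<in> T \<Longrightarrow> w v = 1"
proof -
  have le: "3 + slack + int (card (gn T)) + (if hp T then 1 else 0) \<le> sum w T"
    using tri_loss [OF T] assms(2) by simp
  have s3: "sum w T \<le> 3"
    using sum_mono [of T w "\<lambda>_. 1"] wgt_le1 T by (simp add: tri_def)
  show "slack = 0" "card (gn T) = 0" "\<not> hp T" using le s3 wV by (simp_all split: if_splits)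
  show "w v = 1" if v: "v \<in> T"
  proof -
    have "sum w (T - {v}) \<le> 2"
      using sum_mono [of "T - {v}" w "\<lambda>_. 1"] wgt_le1 T v by (simp add: tri_def)
    then show ?thesis
      using le wV sum.remove [OF tri_finite [OF T] v, of w] wgt_le1 [of k "d v"] by (simp split: if_splits)
  qed
qed

text \<open>All triangles contain two of the three vertices that are complete to a \<open>K\<^sub>5\<close> minus an edge.\<close>

lemma K5m_meet:
  assumes K: "clq4 {a, b, c, s}" "clq4 {a, b, c, t}" "s \<noteq> t" and P: "tri P"
    and u: "u \<in> P" "v \<in> P" "u \<noteq> v" "u \<notin> {a, b, c}" "v \<notin> {a, b, c}"
  shows False
proof -
  have "u = s \<or> v = s" using clq4_meet [OF K(1) P u(1-3)] u by auto
  moreover have "u = t \<or> v = t" using clq4_meet [OF K(2) P u(1-3)] u by auto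
  ultimately have "A s t" using tri_adj [OF P u(1-3)] K(3) sym by auto
  have "pairwise A {a, b, c, s, t}"
  proof (rule pairwiseI)
    fix u v assume uv: "u \<in> {a, b, c, s, t}" "v \<in> {a, b, c, s, t}" "u \<noteq> v"
    then consider "u \<in> {a, b, c, s}" "v \<in> {a, b, c, s}" | "u \<in> {a, b, c, t}" "v \<in> {a, b, c, t}"
      | "u = s" "v = t" | "u = t" "v = s" by blast
    then show "A u v"
      using clq4_adj [OF K(1) _ _ uv(3)] clq4_adj [OF K(2) _ _ uv(3)] \<open>A s t\<close> sym [OF \<open>A s t\<close>]
      by cases simp_all
  qed
  moreover have "card {a, b, c, s, t} = 5"
  proof -
    have "t \<notin> {a, b, c, s}"
    proof
      assume "t \<in> {a, b, c, s}"
      then have "{a, b, c, t} \<subseteq> {a, b, c}" using K(3) by auto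
      then have "card {a, b, c, t} \<le> card {a, b, c}" by (intro card_mono) auto
      moreover have "card {a, b, c} \<le> 3" by (simp add: card_insert_if)
      ultimately show False using K(2) by (simp add: clq4_def)
    qed
    then have "card (insert t {a, b, c, s}) = 5" using K(1) by (simp add: clq4_def)
    then show ?thesis by (simp add: insert_commute)
  qed
  moreover have "{a, b, c, s, t} \<subseteq> V" using K by (auto simp: clq4_def)
  ultimately show False using K5_False by blast
qed

lemma K5m_clq4:
  assumes "U \<subseteq> V" "K5m A U"
  obtains a b c s t where "{a, b, c, s, t} \<subseteq> U" "distinct [a, b, c, s, t]"
    "clq4 {a, b, c, s}" "clq4 {a, b, c, t}"
proof -
  obtain a b c s t where K: "{a, b, c, s, t} \<subseteq> U" "distinct [a, b, c, s, t]"
    "pairwise A {a, b, c, s}" "pairwise A {a, b, c, t}" using assms(2) by (rule K5mE)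
  then have "clq4 {a, b, c, s}" "clq4 {a, b, c, t}" using assms(1) by (auto simp: clq4_def)
  then show ?thesis using that K by blast
qed

text \<open>The four vertices form a 4-cycle of weight at most 0 on which outer vertices have at
  most two neighbours. Even when a K5 minus an edge remains for \<open>k = 3\<close>, the remaining
  weight is at least 6, above the maximum 5 in \<open>dense2\<close>.\<close>

lemma common_low_nbs:
  assumes x: "x \<in> V" "w x = -1" and z: "z \<in> V" "w z = -1" "x \<noteq> z"
    and u: "u \<in> V" "u' \<in> V" "u \<noteq> u'" "A x u" "A x u'" "A z u" "A z u'"
  shows False
proof -
  define C where "C = {x, u, z, u'}"
  have ds: "distinct [x, u, z, u']" using z u neqD by auto
  have c: "core A C" unfolding C_def
    by (rule core_4 [OF S I u(4) sym [OF u(6)] u(7) sym [OF u(5)] z(3) u(3)])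
  have CV: "C \<subseteq> V" using x z u by (simp add: C_def)
  have e: "dg A C v \<le> 2" if v: "v \<in> V - C" for v
  proof -
    have "A v x \<Longrightarrow> \<not> A v u \<and> \<not> A v u'" "A v z \<Longrightarrow> \<not> A v u \<and> \<not> A v u'"
      using low_nbs [OF x _ u(4), of v] low_nbs [OF x _ u(5), of v] low_nbs [OF z(1,2) _ u(6), of v]
        low_nbs [OF z(1,2) _ u(7), of v] sym [of v] v u by auto
    then show ?thesis using ds by (auto simp: C_def)
  qed
  have sC: "sum w C \<le> 0"
    using four_sum [OF ds, of w] x z wgt_le1 [of k "d u"] wgt_le1 [of k "d u'"] by (simp add: C_def)
  show False
  proof (cases "admissible (k - 1) A (V - C)")
    case True
    have "3 + slack \<le> sum w C" by (rule core_loss2 [OF c CV True e])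
    then show False using sC wV by simp
  next
    case False
    then have kk: "k = 3" using admissible_sub [of "V - C"] by auto
    have "wt A V k - (\<Sum>v\<in>V - (V - C). w v) + (\<Sum>v\<in>V - C. 0) \<le> wt A (V - C) (k - 1)"
    proof (rule wt_sub)
      fix v assume v: "v \<in> V - C"
      have "d v = dg A (V - C) v + dg A C v" by (rule dg_split [OF fin CV])
      then show "w v + 0 \<le> wgt (k - 1) (dg A (V - C) v)"
        using e [OF v] k3 wgt_shift [of 1 k "d v" "dg A (V - C) v"] by simp
    qed auto
    moreover have "V - (V - C) = C" using CV by auto
    ultimately have "6 \<le> wt A (V - C) 2" using sC wV kk by simp
    moreover have "\<not> packs A (V - C) 2" using no_packs_rest [OF c CV, of "V - C"] kk by simp
    ultimately show False
      using two_cores [of "V - C" A] fin S I by (auto simp: dense2_def)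
  qed
qed

text \<open>Every triangle has two vertices in \<open>{a, b, c}\<close>. If two of these had at most
  one neighbour on \<open>C\<close> each, deleting \<open>C\<close> and the edge between them would
  keep weight 4 but leave only triangles through the third, against \<open>two_cores\<close>. So two
  of them are adjacent to opposite pairs of \<open>C\<close>; different pairs would give a 4-cycle
  whose deletion destroys all triangles.\<close>

lemma low_config_K5m:
  assumes kk: "k = 3" and x: "x \<in> V" "w x = -1"
    and C: "C = {x, y, q, p}" "C \<subseteq> V" "core A C" "A x y" "A y q" "A q p" "A p x" "x \<noteq> q" "y \<noteq> p"
    and e: "\<And>v. v \<in> V - C \<Longrightarrow> dg A C v \<le> 2" and sC: "sum w C \<le> 2"
    and K: "{a, b, c, s, t} \<subseteq> V - C" "distinct [a, b, c, s, t]"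
    and K4: "clq4 {a, b, c, s}" "clq4 {a, b, c, t}"
  shows "\<exists>f\<in>{a, b, c}. \<exists>g\<in>{a, b, c}. f \<noteq> g \<and> A y f \<and> A y g \<and> A p f \<and> A p g"
proof -
  define Q where "Q = {a, b, c, s}"
  define Q' where "Q' = {a, b, c, t}"
  have Q: "clq4 Q" "clq4 Q'" using K4 by (simp_all add: Q_def Q'_def)
  have st: "s \<noteq> t" using K(2) by auto
  note meet = K5m_meet [OF K4 st]
  have abc: "a \<noteq> b" "a \<noteq> c" "b \<noteq> c" using K(2) by auto
  have CQ: "C \<inter> Q = {}" "C \<inter> Q' = {}" using K(1) by (auto simp: Q_def Q'_def)
  have inC: "x \<in> C" "y \<in> C" "q \<in> C" "p \<in> C" using C(1) by auto
  have inV: "x \<in> V" "y \<in> V" "q \<in> V" "p \<in> V" using inC C(2) by auto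
  have abcQ: "f \<in> Q \<and> f \<in> Q' \<and> f \<in> V \<and> f \<notin> C" if "f \<in> {a, b, c}" for f
    using that K(1) by (auto simp: Q_def Q'_def)
  have nQ: "u \<notin> Q" "u \<notin> Q'" if "u \<in> C" for u using that CQ by auto
  \<comment> \<open>Adjacent vertices of \<open>C\<close> lie outside the K4 and so have no common
    neighbour; only opposite ones remain.\<close>
  have pair: "(A f y \<and> A f p) \<or> (A f x \<and> A f q)" if f: "f \<in> {a, b, c}" "2 \<le> dg A C f" for f
  proof -
    have fV: "f \<in> V" using abcQ [OF f(1)] by simp
    have n: False if "A u v" "u \<in> C" "v \<in> C" "A f u" "A f v" for u v
      by (rule clq4_meet3 [OF Q(1) that(1) sym [OF that(4)] sym [OF that(5)]])
        (use that nQ fV C(2) in auto)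
    have "x \<noteq> y" "y \<noteq> q" "q \<noteq> p" "p \<noteq> x" using C(4-7) neqD by blast+
    then have "dg A C f = (if A f x then 1 else 0) + (if A f y then 1 else 0)
        + (if A f q then 1 else 0) + (if A f p then 1 else 0)"
      using C(8,9) unfolding C(1) by simp
    moreover have "\<not> (A f x \<and> A f y)" "\<not> (A f y \<and> A f q)" "\<not> (A f q \<and> A f p)" "\<not> (A f p \<and> A f x)"
      using n C(4-7) inC by blast+
    ultimately show ?thesis using f(2) by (auto split: if_splits)
  qed
  have meet3: "h \<in> P \<or> f \<in> P" if P: "tri P" and fg: "{f, g, h} = {a, b, c}" for P f g h
  proof (rule ccontr)
    assume n: "\<not> ?thesis"
    have "2 \<le> card (P - {g})"
      using P tri_finite [OF P] by (simp add: tri_def card_Diff_singleton_if)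
    then obtain u v where uv: "u \<in> P - {g}" "v \<in> P - {g}" "u \<noteq> v" by (rule card_ge2E)
    have "u \<notin> {f, g, h}" "v \<notin> {f, g, h}" using uv n by auto
    then show False using meet [OF P, of u v] uv unfolding fg by blast
  qed
  have star: "star Q s"
    unfolding star_def
  proof (intro conjI ballI impI notI)
    show "clq4 Q" "s \<in> Q" using Q by (simp_all add: Q_def)
    fix v assume v: "v \<in> V - Q" "3 \<le> dg A Q v" "A v s"
    have "0 < dg A {a, b, c} v" using v(2,3) K(2) unfolding Q_def by (auto split: if_splits)
    then obtain f where f: "f \<in> {a, b, c}" "A v f" using dg_pos [of "{a, b, c}" A v] by auto
    have "A s f" using clq4_adj [OF Q(1), of s f] f(1) K(2) by (auto simp: Q_def)
    then have "tri {v, s, f}" using v f(2) abcQ [OF f(1)] Q(1) by (intro triI) (auto simp: Q_def clq4_def)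
    then show False using meet [of "{v, s, f}" v s] v K(2) by (auto simp: Q_def)
  qed
  have w1: "w f = 1" if f: "f \<in> {a, b, c}" "h \<in> {a, b, c}" "f \<noteq> h" for f h
  proof -
    have h: "h \<in> Q" "h \<noteq> s" using f K(2) by (auto simp: Q_def)
    have "hp (Q - {h})"
      by (rule hpI [OF x clq4_minus [OF Q(1) h(1)] C(4) sym [OF C(7)] C(9) inV(2,4)]) (use nQ inC in auto)
    then have "3 \<le> sum w (Q - {h})" using star_loss [OF star h] wV by (simp split: if_splits)
    moreover have fQ: "finite (Q - {h})" and fh: "f \<in> Q - {h}" using clq4_finite [OF Q(1)] f by (auto simp: Q_def)
    have "card (Q - {h} - {f}) = 2" using Q(1) h fh fQ by (simp add: clq4_def)
    then have "sum w (Q - {h} - {f}) \<le> 2"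
      using sum_mono [of "Q - {h} - {f}" w "\<lambda>_. 1"] wgt_le1 by simp
    ultimately show ?thesis using sum.remove [OF fQ fh, of w] wgt_le1 [of k "d f"] by simp
  qed
  have few: "False" if fg: "{f, g, h} = {a, b, c}" "f \<noteq> g" "f \<noteq> h" "g \<noteq> h" "dg A C f \<le> 1" "dg A C g \<le> 1" for f g h
  proof -
    have mem: "f \<in> {a, b, c}" "g \<in> {a, b, c}" "h \<in> {a, b, c}" using fg(1) by auto
    define A' where "A' = (\<lambda>u v. A u v \<and> {u, v} \<noteq> {f, g})"
    define U where "U = V - C"
    have fU: "finite U" using fin by (simp add: U_def)
    have S': "symp A'" using sym by (auto simp: A'_def symp_def insert_commute)
    have I': "irreflp A'" using irr by (auto simp: A'_def irreflp_def)
    have dU: "d v = dg A U v + dg A C v" for v using dg_split [OF fin C(2)] by (simp add: U_def)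
    have cut: "dg A U u \<le> dg A' U u + 1" if "{u, u'} = {f, g}" for u u'
    proof -
      have "{v \<in> U. A u v} \<subseteq> insert u' {v \<in> U. A' u v}" using that by (auto simp: A'_def doubleton_eq_iff)
      then have "dg A U u \<le> card (insert u' {v \<in> U. A' u v})"
        unfolding dg_def using fU by (intro card_mono) auto
      then show ?thesis using fU by (simp add: dg_def card_insert_if split: if_splits)
    qed
    \<comment> \<open>Degree 6 less one neighbour on \<open>C\<close> and the removed edge still
      reaches the threshold 4 for \<open>k = 2\<close>.\<close>
    have hi: "wgt 2 (dg A' U u) = 1" if "u \<in> {f, g}" for u
    proof -
      have "w u = 1" using w1 [of u h] mem fg(3,4) that by auto
      then have "6 \<le> d u" using kk by (simp add: wgt_eq_1)
      moreover have "dg A C u \<le> 1" using that fg by auto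
      moreover have "dg A U u \<le> dg A' U u + 1" using that cut [of f g] cut [of g f] by (auto simp: insert_commute)
      ultimately show ?thesis using dU [of u] by (simp add: wgt_eq_1)
    qed
    have "sum w U \<le> wt A' U 2"
      unfolding wt_def
    proof (rule sum_mono)
      fix v assume v: "v \<in> U"
      show "w v \<le> wgt 2 (dg A' U v)"
      proof (cases "v \<in> {f, g}")
        case True
        then show ?thesis using hi [OF True] wgt_le1 [of k "d v"] by simp
      next
        case False
        then have "dg A' U v = dg A U v" by (intro dg_cong) (auto simp: A'_def doubleton_eq_iff)
        then show ?thesis using wgt_shift [of 1 k "d v" "dg A U v"] dU [of v] e [of v] v kk by (simp add: U_def)
      qed
    qed
    moreover have "wt A V k = sum w U + sum w C"
      unfolding wt_def U_def by (rule sum.subset_diff [OF C(2) fin])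
    ultimately have w4: "4 \<le> wt A' U 2" using sC wV kk by simp
    have "\<not> packs A U 2" using no_packs_rest [OF C(3,2), of U] kk by (simp add: U_def)
    moreover have "packs A U 2" if "packs A' U 2"
      by (rule packs_mono_rel [OF that]) (simp add: A'_def)
    ultimately have "\<not> packs A' U 2" by blast
    then have "K5m A' U" using two_cores [OF fU S' I' _ w4] by (simp add: dense2_def)
    moreover have "\<not> K5m A' U"
    proof (rule apex_no_K5m)
      fix P assume P: "P \<subseteq> U" "card P = 3" "pairwise A' P"
      then have t: "tri P" by (auto simp: tri_def U_def A'_def pairwise_def)
      have "\<not> (f \<in> P \<and> g \<in> P)" using P(3) fg(2) by (auto simp: pairwise_def A'_def)
      then show "h \<in> P" using meet3 [OF t, of f g h] meet3 [OF t, of g f h] fg(1) by (auto simp: insert_commute)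
    qed
    ultimately show False by simp
  qed
  have two: "\<exists>f\<in>{a, b, c}. \<exists>g\<in>{a, b, c}. f \<noteq> g \<and> 2 \<le> dg A C f \<and> 2 \<le> dg A C g"
  proof (rule ccontr)
    assume "\<not> ?thesis"
    then have "\<not> (2 \<le> dg A C a \<and> 2 \<le> dg A C b)" "\<not> (2 \<le> dg A C a \<and> 2 \<le> dg A C c)"
      "\<not> (2 \<le> dg A C b \<and> 2 \<le> dg A C c)" using abc by blast+
    then have "dg A C a \<le> 1 \<and> dg A C b \<le> 1 \<or> dg A C a \<le> 1 \<and> dg A C c \<le> 1 \<or> dg A C b \<le> 1 \<and> dg A C c \<le> 1"
      by linarith
    then show False using few [of a b c] few [of a c b] few [of b c a] abc by (auto simp: insert_commute)
  qed
  have mixed: False if fg: "f \<in> {a, b, c}" "g \<in> {a, b, c}" "f \<noteq> g" "A f y" "A f p" "A g x" "A g q" for f g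
  proof -
    obtain h where h: "{f, g, h} = {a, b, c}" "h \<noteq> f" "h \<noteq> g"
    proof -
      have "\<exists>h. {f, g, h} = {a, b, c} \<and> h \<noteq> f \<and> h \<noteq> g"
        using fg(1-3) abc by (elim insertE emptyE) (auto simp: insert_commute)
      then show ?thesis using that by blast
    qed
    have hm: "h \<in> {a, b, c}" using h by auto
    define C' where "C' = {x, y, f, g}"
    have fgV: "f \<in> V" "g \<in> V" "h \<in> V" "f \<notin> C" "g \<notin> C" "h \<notin> C" using abcQ fg(1,2) hm by auto
    have Afg: "A f g" "A f h" "A g h"
      using clq4_adj [OF Q(1)] abcQ fg(1-3) hm h(2,3) by metis+
    have yn: "y \<notin> {a, b, c}" "p \<notin> {a, b, c}" using abcQ inC by blast+
    have C'V: "C' \<subseteq> V" using inV fgV by (simp add: C'_def)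
    have ds: "distinct [x, y, f, g]" using fgV inC fg(3) neqD [OF C(4)] by auto
    have c': "core A C'" unfolding C'_def
      by (rule core_4 [OF S I C(4) sym [OF fg(4)] Afg(1) fg(6)]) (use ds in auto)
    have nx: "\<not> A v y \<and> \<not> A v g" if "v \<in> V" "A v x" for v
      using low_nbs [OF x sym [OF that(2)], of y] low_nbs [OF x sym [OF that(2)], of g] that(1) inV fgV C(4)
        sym [OF fg(6)] by blast
    have dC: "dg A C' v = (if A v x then 1 else 0) + (if A v y then 1 else 0)
        + (if A v f then 1 else 0) + (if A v g then 1 else 0)" for v
      using ds by (simp add: C'_def)
    have e3: "dg A C' v \<le> 3" if "v \<in> V" for v
      using dC [of v] nx [OF that] by (cases "A v x") auto
    \<comment> \<open>Such a \<open>v\<close> is adjacent to \<open>y\<close> and \<open>f\<close>,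
      hence equals \<open>h\<close>. No vertex is complete to the triangle \<open>{y, f, h}\<close>,
      whose tight balance forbids the two neighbours \<open>p\<close> and \<open>g\<close> left to
      \<open>x\<close>.\<close>
    have no3: "dg A C' v \<noteq> 3" if v: "v \<in> V - C'" for v
    proof
      assume "dg A C' v = 3"
      then have a: "A v y" "A v f" using dC [of v] nx [of v] v by (cases "A v x"; auto split: if_splits)+
      have t1: "tri {v, y, f}" using a v inV fgV sym [OF fg(4)] by (intro triI) auto
      have "v \<in> {a, b, c}" using meet [OF t1, of v y] yn neqD [OF a(1)] by auto
      then have "v = h" using v h(1) by (auto simp: C'_def)
      then have yh: "A y h" using a sym by auto
      have t2: "tri {y, f, h}" using yh fg(4) sym [OF fg(4)] Afg inV fgV by (intro triI) auto
      have "drp {y, f, h} = {}"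
      proof (rule ccontr)
        assume "drp {y, f, h} \<noteq> {}"
        then obtain z where z: "z \<in> drp {y, f, h}" by auto
        then have zz: "z \<in> V" "z \<notin> {y, f, h}" "dg A {y, f, h} z = card {y, f, h}"
          using t2 by (auto simp: drp_def tri_def)
        have "A z u" if "u \<in> {y, f, h}" for u by (rule dg_full [OF _ zz(3) that]) simp
        then have zy: "A z y" "A z f" by auto
        have t3: "tri {z, y, f}" using zy zz inV fgV sym [OF fg(4)] by (intro triI) auto
        have "z \<in> {a, b, c}" using meet [OF t3, of z y] yn neqD [OF zy(1)] by auto
        then have "z = g" using zz h(1) by auto
        then show False using low_nbs [OF x sym [OF fg(6)] C(4)] zy fgV inV by auto
      qed
      then have "\<not> hp {y, f, h}" by (rule tri_loss_no_drp(3) [OF t2])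
      moreover have "hp {y, f, h}"
        by (rule hpI [OF x t2 sym [OF C(7)] sym [OF fg(6)]]) (use yn fg h fgV inV inC C(9) in auto)
      ultimately show False by simp
    qed
    have sC': "sum w C' \<le> 2"
      using four_sum [OF ds, of w] x(2) wgt_le1 [of k "d y"] wgt_le1 [of k "d f"] wgt_le1 [of k "d g"]
      by (simp add: C'_def)
    have "admissible (k - 1) A (V - C')"
    proof (rule apex_admissible)
      fix P assume P: "P \<subseteq> V - C'" "card P = 3" "pairwise A P"
      then have t: "tri P" by (auto simp: tri_def)
      have "g \<in> P \<or> f \<in> P" using meet3 [OF t, of f h g] h(1) by (auto simp: insert_commute)
      then show "x \<in> P" using P by (auto simp: C'_def)
    qed
    moreover have "dg A C' v \<le> 2" if "v \<in> V - C'" for v using no3 [OF that] e3 [of v] that by auto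
    ultimately have "3 + slack \<le> sum w C'" by (rule core_loss2 [OF c' C'V])
    then show False using sC' wV by simp
  qed
  obtain f g where fg: "f \<in> {a, b, c}" "g \<in> {a, b, c}" "f \<noteq> g" "2 \<le> dg A C f" "2 \<le> dg A C g"
    using two by blast
  have "\<not> (A f x \<and> A g x)"
    using low_nbs [OF x, of f g] sym clq4_adj [OF Q(1), of f g] abcQ [OF fg(1)] abcQ [OF fg(2)] fg(3) by blast
  then have "A f y \<and> A f p \<and> A g y \<and> A g p"
    using pair [OF fg(1,4)] pair [OF fg(2,5)] mixed [OF fg(1-3)] mixed [OF fg(2,1)] fg(3) by blast
  then show ?thesis using fg sym by blast
qed

text \<open>The triangle \<open>T\<close> off the 4-cycle leaves \<open>x\<close> two neighbours, so
  some \<open>\<delta>\<close> extends it to a K4. A vertex with three neighbours on the cycle must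
  lie in \<open>T\<close>, and then \<open>q\<close> is \<open>\<delta>\<close>. Without such a
  vertex, deleting the cycle is free, and only K5 minus an edge for \<open>k = 3\<close> can
  obstruct it.\<close>

lemma low_config:
  assumes x: "x \<in> V" "w x = -1" and y: "y \<in> V" "A x y"
  shows "\<exists>p q v Q. p \<in> V \<and> A x p \<and> p \<noteq> y \<and> clq4 Q \<and> q \<in> Q \<and> v \<in> Q \<and> q \<noteq> v \<and> y \<notin> Q \<and> p \<notin> Q \<and>
    A y q \<and> A y v \<and> A p q \<and> A p v"
proof -
  obtain p q T where p: "p \<in> V" "q \<in> V" "A x p" "A y q" "A p q" "p \<noteq> y" "q \<noteq> x"
    and T: "tri T" "T \<inter> {x, y, p, q} = {}"
    and c: "core A {x, y, q, p}" "distinct [x, y, q, p]" "\<not> A x q" "\<not> A y p"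
    and e: "\<And>v. v \<in> V - {x, y, q, p} \<Longrightarrow> dg A {x, y, q, p} v \<le> 3"
      "\<And>v. v \<in> V - {x, y, q, p} \<Longrightarrow> dg A {x, y, q, p} v = 3 \<Longrightarrow> A v y \<and> A v q \<and> A v p"
    by (rule low_cycle [OF x y]) (use low_no_tri x in blast)+
  have "hp T" by (rule hpI [OF x T(1) y(2) p(3)]) (use p y T in auto)
  then have "drp T \<noteq> {}" using tri_loss_no_drp(3) [OF T(1)] by blast
  then obtain \<delta> where del: "\<delta> \<in> drp T" by auto
  define Q where "Q = insert \<delta> T"
  have Q: "clq4 Q" unfolding Q_def by (rule drp_clq4 [OF T(1) del])
  define C where "C = {x, y, q, p}"
  have CV: "C \<subseteq> V" using x y p by (simp add: C_def)
  show ?thesis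
  proof (cases "\<exists>v\<in>V - C. dg A C v = 3")
    case True
    then obtain v where v: "v \<in> V" "v \<notin> C" "A v y" "A v q" "A v p" using e(2) by (auto simp: C_def)
    have t1: "tri {v, y, q}" and t2: "tri {v, q, p}"
      using v y p sym [OF p(5)] by (auto intro!: triI)
    have vT: "v \<in> T" using tri_meet [OF t1 T(1)] T(2) by auto
    have "y = \<delta> \<or> q = \<delta>" using clq4_meet [OF Q t1, of y q] p(4) neqD T(2) by (auto simp: Q_def)
    moreover have "q = \<delta> \<or> p = \<delta>" using clq4_meet [OF Q t2, of q p] p(5) neqD T(2) by (auto simp: Q_def)
    ultimately have q: "q = \<delta>" using p(6) by auto
    have "y \<notin> Q" "p \<notin> Q" "q \<in> Q" "v \<in> Q" "q \<noteq> v"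
      using q T(2) vT p(4,5) neqD v by (auto simp: Q_def)
    then show ?thesis using p v Q sym by blast
  next
    case False
    have sC: "sum w C \<le> 2"
      using four_sum [OF c(2), of w] x(2) wgt_le1 [of k "d y"] wgt_le1 [of k "d q"] wgt_le1 [of k "d p"]
      by (simp add: C_def)
    have cC: "core A C" using c(1) by (simp add: C_def)
    have e2: "dg A C v \<le> 2" if "v \<in> V - C" for v
    proof -
      have "dg A C v \<le> 3" using e(1) [of v] that by (simp add: C_def)
      moreover have "dg A C v \<noteq> 3" using False that by blast
      ultimately show ?thesis by simp
    qed
    have "\<not> admissible (k - 1) A (V - C)"
    proof
      assume "admissible (k - 1) A (V - C)"
      then have "3 + slack \<le> sum w C" using e2 by (rule core_loss2 [OF cC CV])
      then show False using sC wV by simp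
    qed
    then have kk: "k = 3" and k5: "K5m A (V - C)" using admissible_sub [of "V - C"] by auto
    obtain a b c' s t where K: "{a, b, c', s, t} \<subseteq> V - C" "distinct [a, b, c', s, t]"
      and K4: "clq4 {a, b, c', s}" "clq4 {a, b, c', t}" by (rule K5m_clq4 [OF _ k5]) auto
    obtain f g where fg: "f \<in> {a, b, c'}" "g \<in> {a, b, c'}" "f \<noteq> g" "A y f" "A y g" "A p f" "A p g"
    proof -
      have "\<exists>f\<in>{a, b, c'}. \<exists>g\<in>{a, b, c'}. f \<noteq> g \<and> A y f \<and> A y g \<and> A p f \<and> A p g"
      by (rule low_config_K5m [OF kk x C_def CV cC y(2) p(4) sym [OF p(5)] sym [OF p(3)] _ _ e2 sC K K4]) (use p c(2) in auto)
      then show ?thesis using that by blast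
    qed
    have "y \<in> C" "p \<in> C" by (simp_all add: C_def)
    then have "y \<notin> {a, b, c', s}" "p \<notin> {a, b, c', s}" using K(1) by auto
    moreover have "f \<in> {a, b, c', s}" "g \<in> {a, b, c', s}" using fg by auto
    ultimately show ?thesis using p(1,3,6) fg K4(1) by blast
  qed
qed


section \<open>The K4 attached to a low vertex\<close>

lemma sum_le_card: "finite B \<Longrightarrow> sum w B \<le> int (card B)"
  using sum_mono [of B w "\<lambda>_. 1"] wgt_le1 by simp

lemma tight_sum:
  assumes "finite B" "int (card B) \<le> sum w B" "u \<in> B"
  shows "w u = 1"
  using sum.remove [OF assms(1,3), of w] sum_le_card [of "B - {u}"] assms wgt_le1 [of k "d u"]
    card_Suc_Diff1 [OF assms(1,3)] by simp

text \<open>The two neighbours of \<open>x\<close> outside \<open>Q\<close> allow a contraction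
  after deleting a triangle of \<open>Q\<close>, which forces equality throughout the balance. A
  triangle through \<open>m\<close> and two vertices of \<open>Q\<close> would allow one too, unless
  \<open>m\<close> is one of only two neighbours of \<open>x\<close>.\<close>

lemma low_config_star:
  assumes x: "x \<in> V" "w x = -1" and yp: "y \<in> V" "p \<in> V" "A x y" "A x p" "y \<noteq> p"
    and s: "star Q \<delta>" and out: "y \<notin> Q" "p \<notin> Q"
  shows "slack = 0" "u \<in> Q \<Longrightarrow> w u = 1" "u \<in> Q \<Longrightarrow> u \<noteq> \<delta> \<Longrightarrow> d u = 2 * k"
    "m \<in> V \<Longrightarrow> w m = 0 \<Longrightarrow> (m = y \<or> m = p) \<and> d x = 2"
proof -
  have Q: "clq4 Q" "\<delta> \<in> Q" using s by (auto simp: star_def)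
  have fQ: "finite Q" by (rule clq4_finite [OF Q(1)])
  have loss: "4 + slack + int (card (gn (Q - {c})))
      \<le> sum w (Q - {c}) + (if d c = 2 * k \<or> d c = 2 * k - 1 then 1 else 0)"
    and le3: "sum w (Q - {c}) \<le> 3" and c3: "card (Q - {c}) = 3"
    if c: "c \<in> Q" "c \<noteq> \<delta>" for c
  proof -
    have "hp (Q - {c})"
      by (rule hpI [OF x clq4_minus [OF Q(1) c(1)] yp(3-5,1,2)]) (use out in auto)
    then show "4 + slack + int (card (gn (Q - {c})))
      \<le> sum w (Q - {c}) + (if d c = 2 * k \<or> d c = 2 * k - 1 then 1 else 0)"
      using star_loss [OF s c] by simp
    show c3: "card (Q - {c}) = 3" using Q c by (simp add: clq4_def)
    show "sum w (Q - {c}) \<le> 3" using sum_le_card [of "Q - {c}"] fQ c3 by simp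
  qed
  have ex: "\<exists>c\<in>Q. c \<noteq> \<delta> \<and> c \<noteq> u" for u
  proof -
    have "\<not> Q \<subseteq> {\<delta>, u}"
    proof
      assume "Q \<subseteq> {\<delta>, u}"
      then have "card Q \<le> card {\<delta>, u}" by (intro card_mono) auto
      then show False using Q by (simp add: clq4_def card_insert_if split: if_splits)
    qed
    then show ?thesis by blast
  qed
  obtain c where c: "c \<in> Q" "c \<noteq> \<delta>" using ex by blast
  show s0: "slack = 0" using loss [OF c] le3 [OF c] wV by (simp split: if_splits)
  have g0: "card (gn (Q - {c})) = 0" using loss [OF c] le3 [OF c] wV by (simp split: if_splits)
  show w1: "w u = 1" if u: "u \<in> Q" for u
  proof -
    obtain c' where c': "c' \<in> Q" "c' \<noteq> \<delta>" "c' \<noteq> u" using ex by blast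
    show ?thesis
      by (rule tight_sum [of "Q - {c'}"]) (use loss [OF c'(1,2)] c3 [OF c'(1,2)] c' u fQ s0 in \<open>auto split: if_splits\<close>)
  qed
  show "d u = 2 * k" if u: "u \<in> Q" "u \<noteq> \<delta>"
  proof -
    have "d u = 2 * k \<or> d u = 2 * k - 1" using loss [OF u] le3 [OF u] s0 by (simp split: if_splits)
    then show ?thesis using w1 [OF u(1)] k3 by (auto simp: wgt_eq_1)
  qed
  show "(m = y \<or> m = p) \<and> d x = 2" if m: "m \<in> V" "w m = 0"
  proof -
    have mQ: "m \<notin> Q" using w1 m by auto
    have "2 \<le> dg A (Q - {c}) m" by (rule gn_empty [OF g0 m(1) _ m(2)]) (use mQ in auto)
    then obtain u v where uv: "u \<in> Q - {c}" "v \<in> Q - {c}" "u \<noteq> v" "A m u" "A m v" by (rule dg_ge2E)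
    have "dg A Q m = 3"
      using out_loss [OF Q(1) m(1) mQ _ _ uv(3-5)] uv w1 [of u] w1 [of v] m s0 by (auto split: if_splits)
    moreover have "card {u \<in> Q. A x u} \<le> 1"
    proof (rule ccontr)
      assume "\<not> ?thesis"
      then have "2 \<le> dg A Q x" by (simp add: dg_def)
      then obtain u v where "u \<in> Q" "v \<in> Q" "u \<noteq> v" "A x u" "A x v" by (rule dg_ge2E)
      then show False using low_nbs [OF x, of u v] clq4_adj [OF Q(1)] clq4_sub [OF Q(1)] by blast
    qed
    \<comment> \<open>Of the three neighbours of \<open>m\<close> in \<open>Q\<close> at most one is
      a neighbour of \<open>x\<close>, so two are left for the triangle.\<close>
    moreover have "card {u \<in> Q. A m u} - card {u \<in> Q. A x u} \<le> card ({u \<in> Q. A m u} - {u \<in> Q. A x u})"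
      by (rule diff_card_le_card_Diff) (use fQ in auto)
    ultimately have "2 \<le> card ({u \<in> Q. A m u} - {u \<in> Q. A x u})" by (simp add: dg_def)
    then obtain u v where uv: "u \<in> Q" "v \<in> Q" "u \<noteq> v" "A m u" "A m v" "\<not> A x u" "\<not> A x v"
      by (rule card_ge2E) blast
    have "\<not> hp {m, u, v}"
      using out_loss [OF Q(1) m(1) mQ uv(1-5)] w1 [OF uv(1)] w1 [OF uv(2)] m s0 by (auto split: if_splits)
    moreover have t: "tri {m, u, v}" by (rule out_drp(1) [OF Q(1) m(1) mQ uv(1-5)])
    moreover have xt: "x \<notin> {m, u, v}" using low_no_tri [OF t _ x(2)] by blast
    ultimately have "dg A (V - {m, u, v}) x \<le> 1" using x by (auto simp: hp_def)
    moreover have "d x = dg A (V - {m, u, v}) x + dg A {m, u, v} x"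
      by (rule dg_split [OF fin]) (use t in \<open>simp add: tri_def\<close>)
    moreover have "dg A {m, u, v} x = (if A x m then 1 else 0)"
    proof -
      have "{z \<in> {m, u, v}. A x z} = (if A x m then {m} else {})" using uv by auto
      then show ?thesis by (simp add: dg_def)
    qed
    ultimately have *: "A x m" "d x = 2" using deg_ge2 [OF x(1)] by (auto split: if_splits)
    have "{y, p} = {u \<in> V. A x u}"
      by (rule card_subset_eq) (use yp * fin in \<open>auto simp: dg_def\<close>)
    then have "m \<in> {y, p}" using * m by auto
    then show ?thesis using * by simp
  qed
qed

definition L :: "'a set" where "L = {v \<in> V. w v = -1}"
definition M :: "'a set" where "M = {v \<in> V. w v = 0}"

lemma card_V: "int (card V) = wt A V k + int (card M) + 2 * int (card L)"
proof -
  have "(\<Sum>v\<in>V. 1) = (\<Sum>v\<in>V. w v + (if v \<in> M then 1 else 0) + (if v \<in> L then 2 else 0))"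
    using wgt_cases by (intro sum.cong) (force simp: M_def L_def)+
  also have "\<dots> = wt A V k + int (card (V \<inter> M)) + 2 * int (card (V \<inter> L))"
    using fin by (simp add: sum.distrib sum.If_cases wt_def)
  finally show ?thesis by (simp add: M_def L_def Int_def)
qed

lemma high_deg: "v \<in> V \<Longrightarrow> v \<notin> L \<Longrightarrow> v \<notin> M \<Longrightarrow> 2 * k \<le> d v"
  using wgt_cases [of k "d v"] by (auto simp: L_def M_def wgt_eq_1)

lemma fin_LM: "finite L" "finite M" using fin by (auto simp: L_def M_def)

text \<open>As \<open>t\<close> has only two neighbours in \<open>Q\<close>, nothing is complete to
  \<open>{t, q, v}\<close> and its balance is tight. Then every low vertex is adjacent to
  \<open>t\<close> and to one more vertex, and two low vertices besides \<open>x\<close> would share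
  both. So there are at most two low vertices, and the graph is too small for the neighbours of
  \<open>t\<close> and of an adjacent high vertex outside \<open>Q\<close>.\<close>

lemma low_outside_deg2_False:
  assumes x: "x \<in> V" "w x = -1" and ty: "t \<in> V" "y \<in> V" "t \<noteq> y" "A x t" "A x y"
    and Q: "clq4 Q" "q \<in> Q" "v \<in> Q" "q \<noteq> v" "t \<notin> Q" "y \<notin> Q"
    and a: "A t q" "A t v" "A y q" "A y v" and t2: "dg A Q t = 2"
  shows False
proof -
  define R where "R = {t, q, v}"
  have R: "tri R" unfolding R_def by (rule out_drp(1) [OF Q(1) ty(1) Q(5,2,3,4) a(1,2)])
  have "finite (drp R)" using fin by (simp add: drp_def)
  then have "drp R = {}"
    using out_drp(3) [OF Q(1) ty(1) Q(5,2,3,4) a(1,2)] t2 unfolding R_def by simp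
  note iso = tri_loss_no_drp [OF R this]
  have qvV: "q \<in> V" "v \<in> V" using Q clq4_sub by blast+
  have w1: "w t = 1" "w q = 1" "w v = 1" using iso(4) by (auto simp: R_def)
  have fQ: "finite Q" by (rule clq4_finite [OF Q(1)])
  have "{u \<in> Q. A t u} = {q, v}"
    by (rule card_subset_eq [symmetric]) (use Q a t2 fQ in \<open>auto simp: dg_def\<close>)
  then have ntQ: "u = q \<or> u = v" if "u \<in> Q" "A t u" for u using that by blast
  have RV: "R \<subseteq> V" using R by (simp add: tri_def)
  have sR: "sum w R = 3" using sum3 [of t q v w] R w1 by (simp add: R_def)
  have eR: "dg A R u \<le> 2" if u: "u \<in> V" "u \<notin> R" for u
  proof (rule ccontr)
    assume "\<not> ?thesis"
    then have "dg A R u = card R"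
      using dg_le_card [OF tri_finite [OF R], of A u] R by (simp add: tri_def)
    then have z: "A u z" if "z \<in> R" for z by (rule dg_full [OF tri_finite [OF R] _ that])
    have "u \<in> Q" using clq4_meet3 [OF Q(1), of u t q] z a Q ty u qvV by (auto simp: R_def)
    then show False using ntQ [of u] z sym u by (auto simp: R_def)
  qed
  have lown: "A z t \<and> (\<exists>y'\<in>V. y' \<noteq> t \<and> A z y' \<and> (\<forall>u\<in>V. A z u \<longrightarrow> u = t \<or> u = y') \<and> A y' q \<and> A y' v)"
    if z: "z \<in> V" "w z = -1" for z
  proof -
    have zR: "z \<notin> R" using low_no_tri [OF R _ z(2)] by blast
    have "dg A (V - R) z \<le> 1" using iso(3) z zR by (auto simp: hp_def)
    moreover have "dg A R z \<le> 1"
    proof (rule ccontr)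
      assume "\<not> ?thesis"
      then have "2 \<le> dg A R z" by simp
      then obtain u u' where "u \<in> R" "u' \<in> R" "u \<noteq> u'" "A z u" "A z u'" by (rule dg_ge2E)
      then show False using low_nbs [OF z, of u u'] tri_adj [OF R] RV by blast
    qed
    ultimately have "dg A (V - R) z = 1" "dg A R z = 1"
      using deg_ge2 [OF z(1)] dg_split [OF fin RV, of A z] by auto
    then obtain y' t' where yt: "{u \<in> V - R. A z u} = {y'}" "{u \<in> R. A z u} = {t'}"
      unfolding dg_def by (auto simp: card_1_singleton_iff)
    have y': "y' \<in> V" "y' \<notin> R" "A z y'" and t': "t' \<in> R" "A z t'" "t' \<in> V" using yt RV by auto
    have zn: "u = t' \<or> u = y'" if "u \<in> V" "A z u" for u using that yt by blast
    \<comment> \<open>Otherwise \<open>z\<close> can be deleted along with \<open>R\<close>: no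
      outer vertex loses more than two neighbours, and the low \<open>z\<close> reduces the deleted
      weight to 2.\<close>
    have e2: "2 \<le> dg A R y'"
    proof (rule ccontr)
      assume n: "\<not> ?thesis"
      define U where "U = V - insert z R"
      have "wt A V k - sum w (V - U) + (\<Sum>u\<in>U. 0) \<le> wt A U (k - 1)"
      proof (rule wt_sub)
        fix u assume u: "u \<in> U"
        have "d u = dg A U u + dg A (insert z R) u"
          unfolding U_def by (rule dg_split [OF fin]) (use z RV in auto)
        moreover have "dg A (insert z R) u = (if A u z then 1 else 0) + dg A R u"
          using zR tri_finite [OF R] by simp
        moreover have "dg A R u \<le> 2" using eR u by (auto simp: U_def)
        moreover have "dg A R u \<le> 1" if "A u z"
          using zn [of u] sym [OF that] u n t' by (auto simp: U_def)
        ultimately have "d u \<le> dg A U u + 2" by auto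
        then show "w u + 0 \<le> wgt (k - 1) (dg A U u)" using k3 wgt_shift [of 1 k "d u" "dg A U u"] by simp
      qed (auto simp: U_def)
      moreover have "V - U = insert z R" using RV z by (auto simp: U_def)
      moreover have "sum w (insert z R) = 2" using sR zR tri_finite [OF R] z by simp
      ultimately have "2 * int k - 2 \<le> wt A U (k - 1)" using wV by simp
      moreover have "wt A U (k - 1) < 2 * int k - 2"
        by (rule rest_wt [OF tri_core [OF R] RV _ tri_rest_admissible [OF R]]) (auto simp: U_def)
      ultimately show False by simp
    qed
    have nyt: "\<not> A y' t'" by (rule low_nbs [OF z y'(3) t'(2) y'(1) t'(3)])
    have dR: "dg A R y' = (if A y' t then 1 else 0) + (if A y' q then 1 else 0) + (if A y' v then 1 else 0)"
      using Q(4) neqD [OF a(1)] neqD [OF a(2)] by (simp add: R_def)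
    have "t' = t"
    proof (rule ccontr)
      assume "t' \<noteq> t"
      then have yy: "A y' t" "A y' q \<or> A y' v" using e2 dR nyt t'(1) by (auto simp: R_def split: if_splits)
      have "y' \<in> Q"
        using clq4_meet3 [OF Q(1), of y' t q] clq4_meet3 [OF Q(1), of y' t v] yy y' ty qvV Q a by auto
      then show False using ntQ [of y'] sym [OF yy(1)] y'(2) by (auto simp: R_def)
    qed
    then have "A y' q" "A y' v" using e2 dR nyt by (auto split: if_splits)
    then show ?thesis using \<open>t' = t\<close> t' y' zn by (auto simp: R_def)
  qed
  have xn: "u = t \<or> u = y" if "u \<in> V" "A x u" for u
    using lown [OF x] ty that by metis
  define C where "C = {x, t, q, y}"
  have CV: "C \<subseteq> V" using x ty qvV by (simp add: C_def)
  have ds: "distinct [x, t, q, y]"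
    using neqD [OF ty(4)] neqD [OF ty(5)] neqD [OF a(1)] neqD [OF a(3)] ty(3)
      low_no_tri [OF R _ x(2)] by (auto simp: R_def)
  have cC: "core A C" unfolding C_def
    by (rule core_4 [OF S I ty(4) a(1) sym [OF a(3)] sym [OF ty(5)]]) (use ds ty in auto)
  have xC: "\<not> A u x" if "u \<in> V" "u \<notin> C" for u using xn [OF that(1)] sym that by (auto simp: C_def)
  have dC: "dg A C u = (if A u x then 1 else 0) + (if A u t then 1 else 0) + (if A u q then 1 else 0)
    + (if A u y then 1 else 0)" for u using ds by (simp add: C_def)
  have e3: "dg A C u \<le> 3" if "u \<in> V" "u \<notin> C" for u using dC [of u] xC [OF that] by simp
  have C3: "{u \<in> V - C. dg A C u = 3} \<subseteq> {v}"
  proof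
    fix u assume "u \<in> {u \<in> V - C. dg A C u = 3}"
    then have u: "u \<in> V" "u \<notin> C" "A u t" "A u q" using dC [of u] xC [of u] by (auto split: if_splits)
    then have "u \<in> Q" using clq4_meet3 [OF Q(1), of u t q] a ty qvV Q by auto
    then show "u \<in> {v}" using ntQ [of u] sym [OF u(3)] u(2) by (auto simp: C_def)
  qed
  have okC: "admissible (k - 1) A (V - C)"
  proof (rule admissible_sub)
    show "\<not> K5m A (V - C)"
    proof
      assume "K5m A (V - C)"
      then obtain a' b' c' s s' where K: "{a', b', c', s, s'} \<subseteq> V - C" "distinct [a', b', c', s, s']"
        "clq4 {a', b', c', s}" "clq4 {a', b', c', s'}" by (rule K5m_clq4 [rotated]) auto
      have "t \<notin> {a', b', c'}" "q \<notin> {a', b', c'}" using K(1) by (auto simp: C_def)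
      then show False
        using K5m_meet [OF K(3,4) _ R, of t q] K(2) neqD [OF a(1)] by (auto simp: R_def)
    qed
  qed auto
  have "3 + slack \<le> sum w C + int (card {u \<in> V - C. dg A C u = 3})"
    by (rule core_loss [OF cC CV okC]) (use e3 in auto)
  moreover have "card {u \<in> V - C. dg A C u = 3} \<le> 1" using card_mono [OF _ C3] by simp
  ultimately have wy: "w y = 1" and sC: "sum w C = 2"
    using four_sum [OF ds, of w] x w1 wV wgt_le1 [of k "d y"] by (simp_all add: C_def)
  have other: "\<exists>y'\<in>Q. y' \<noteq> q \<and> y' \<noteq> v \<and> A y y' \<and> A z y' \<and> A z t"
    if z: "z \<in> V" "w z = -1" "z \<noteq> x" for z
  proof -
    obtain y' where y': "y' \<in> V" "y' \<noteq> t" "A z y'" "A y' q" "A y' v"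
      and zn: "\<And>u. u \<in> V \<Longrightarrow> A z u \<Longrightarrow> u = t \<or> u = y'" and zt: "A z t" using lown [OF z(1,2)] by blast
    have zC: "z \<notin> C" using z w1 wy by (auto simp: C_def)
    \<comment> \<open>Otherwise \<open>z\<close> can be deleted along with \<open>C\<close>: the
      deleted weight is 1, and only \<open>v\<close> may drop.\<close>
    have "y' \<notin> C \<and> 2 \<le> dg A C y'"
    proof (rule ccontr)
      assume n: "\<not> ?thesis"
      define U where "U = V - insert z C"
      have "wt A V k - sum w (V - U) + (\<Sum>u\<in>U. - (if u = v then 1 else 0)) \<le> wt A U (k - 1)"
      proof (rule wt_sub)
        fix u assume u: "u \<in> U"
        have du: "d u = dg A U u + dg A (insert z C) u"
          unfolding U_def by (rule dg_split [OF fin]) (use z CV in auto)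
        have dz: "dg A (insert z C) u = (if A u z then 1 else 0) + dg A C u"
          using zC by (simp add: C_def)
        have c1: "dg A C u \<le> 1" if "A u z"
          using zn [of u] sym [OF that] u n by (auto simp: U_def C_def)
        have c3: "dg A C u \<le> 2 \<or> u = v" using C3 e3 [of u] u by (fastforce simp: U_def)
        have c4: "dg A C u \<le> 3" using e3 u by (auto simp: U_def)
        show "w u + - (if u = v then 1 else 0) \<le> wgt (k - 1) (dg A U u)"
          using k3 wgt_shift [of 1 k "d u" "dg A U u"] wgt_shift1 [of 1 k "d u" "dg A U u"] du dz c1 c3 c4
          by (auto split: if_splits)
      qed (auto simp: U_def)
      moreover have "V - U = insert z C" using CV z by (auto simp: U_def)
      moreover have "sum w (insert z C) = 1" using sC zC z by (simp add: C_def)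
      moreover have "(\<Sum>u\<in>U. - (if u = v then 1 else (0::int))) \<ge> -1"
        using fin by (simp add: U_def sum_negf)
      ultimately have "2 * int k - 2 \<le> wt A U (k - 1)" using wV by simp
      moreover have UC: "U \<subseteq> V - C" by (auto simp: U_def)
      have "admissible (k - 1) A U" using okC tri_meeting_mono [OF _ UC] K5m_mono [OF _ UC]
        by (auto simp: admissible_def split: if_splits)
      then have "wt A U (k - 1) < 2 * int k - 2"
        by (intro rest_wt [OF cC CV]) (auto simp: U_def)
      ultimately show False by simp
    qed
    then have y2: "y' \<notin> C" "2 \<le> dg A C y'" by auto
    have "\<not> A y' t" by (rule low_nbs [OF z(1,2) y'(3) zt y'(1) ty(1)])
    then have yy: "A y' y" using dC [of y'] xC [OF y'(1) y2(1)] y2(2) by (auto split: if_splits)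
    have "y' \<in> Q" using clq4_meet3 [OF Q(1), of y' y q] yy y' a ty qvV Q by auto
    then show ?thesis using yy sym y' neqD [OF y'(4)] neqD [OF y'(5)] zt by blast
  qed
  have cL: "card L \<le> 2"
  proof (rule ccontr)
    assume "\<not> ?thesis"
    then have "2 \<le> card (L - {x})" using fin_LM by (auto simp: card_Diff_singleton_if)
    then obtain z z' where z: "z \<in> L - {x}" "z' \<in> L - {x}" "z \<noteq> z'" by (rule card_ge2E)
    obtain u where u: "u \<in> Q" "u \<noteq> q" "u \<noteq> v" "A y u" "A z u" "A z t" using other [of z] z by (auto simp: L_def)
    obtain u' where u': "u' \<in> Q" "u' \<noteq> q" "u' \<noteq> v" "A y u'" "A z' u'" "A z' t" using other [of z'] z by (auto simp: L_def)
    \<comment> \<open>In \<open>Q\<close> the vertex \<open>y\<close> is adjacent to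
      \<open>q\<close> and \<open>v\<close> and to at most one more.\<close>
    have "u = u'"
    proof (rule ccontr)
      assume "u \<noteq> u'"
      then have "card {q, v, u, u'} = 4" using Q(4) u u' by simp
      moreover have "card {q, v, u, u'} \<le> dg A Q y"
        unfolding dg_def by (rule card_mono) (use fQ Q u u' a in auto)
      ultimately show False using clq4_dg [OF Q(1) ty(2) Q(6)] by simp
    qed
    moreover have "u \<noteq> t" using u Q by auto
    ultimately show False
      using common_low_nbs [of z z' u t] z u u' ty clq4_sub [OF Q(1) u(1)] by (auto simp: L_def)
  qed
  obtain \<delta> where s: "star Q \<delta>" using star_ex [OF Q(1)] by blast
  note cs = low_config_star [OF x ty(1,2,4,5,3) s Q(5,6)]
  have "M = {}" using cs(4) w1 wy by (force simp: M_def)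
  then have cV: "card V \<le> 2 * k + 4" using card_V cs(1) cL by simp
  have dt: "2 * k \<le> d t" using w1 by (simp add: wgt_eq_1)
  have "dg A (Q \<union> L) t \<le> dg A Q t + dg A L t"
    using dg_Un [of Q "L - Q" A t] fQ fin_LM dg_mono [of L "L - Q" A t] by auto
  then have "dg A (Q \<union> L) t < d t" using t2 dt cL dg_le_card [OF fin_LM(1), of A t] k3 by simp
  then obtain u where u: "u \<in> V" "u \<notin> Q \<union> L" "A t u"
    using dg_witness [of "Q \<union> L" A t V] fQ fin_LM by blast
  have "2 * k \<le> d u" using high_deg u \<open>M = {}\<close> by blast
  moreover have "d t + d u \<le> card V"
  proof (rule disjoint_nbs_card [OF fin])
    show "{z \<in> V. A t z} \<inter> {z \<in> V. A u z} = {}" using clq4_meet3 [OF Q(1), of t u] u ty Q by auto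
  qed
  ultimately show False using cV dt k3 by simp
qed


text \<open>By \<open>low_outside_deg2_False\<close> both \<open>y\<close> and \<open>p\<close> have
  three neighbours in \<open>Q\<close>, and by the choice of \<open>\<delta>\<close> they are the
  same three.\<close>

lemma low_config_clq4:
  assumes x: "x \<in> V" "w x = -1" and y: "y \<in> V" "A x y"
  shows "\<exists>p \<delta> a b c. p \<in> V \<and> A x p \<and> p \<noteq> y \<and> star {\<delta>, a, b, c} \<delta> \<and> distinct [\<delta>, a, b, c]
    \<and> y \<notin> {\<delta>, a, b, c} \<and> p \<notin> {\<delta>, a, b, c} \<and> clq4 {a, b, c, y} \<and> clq4 {a, b, c, p}"
proof -
  obtain p q v Q where p: "p \<in> V" "A x p" "p \<noteq> y" and Q: "clq4 Q" "q \<in> Q" "v \<in> Q" "q \<noteq> v"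
    and out: "y \<notin> Q" "p \<notin> Q" and a: "A y q" "A y v" "A p q" "A p v"
    using low_config [OF x y] by blast
  have fQ: "finite Q" by (rule clq4_finite [OF Q(1)])
  obtain \<delta> where s: "star Q \<delta>" using star_ex [OF Q(1)] by blast
  obtain f g h where Qe: "Q = {\<delta>, f, g, h}" "distinct [\<delta>, f, g, h]" "A f g" "A f h" "A g h"
    "A \<delta> f" "A \<delta> g" "A \<delta> h" "{\<delta>, f, g, h} \<subseteq> V" using s by (rule starE)
  have c4: "clq4 {f, g, h, u}" if u: "u \<in> V" "u \<notin> Q" "dg A Q u \<noteq> 2" "A u q" "A u v" for u
  proof -
    have "2 \<le> dg A Q u" by (rule dg_ge2I [of Q q v A u]) (use fQ Q u in auto)
    then have d3: "dg A Q u = 3" using clq4_dg [OF Q(1) u(1,2)] u(3) by simp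
    then have "\<not> A u \<delta>" using s u by (auto simp: star_def)
    then have "A u f" "A u g" "A u h" using d3 Qe(1,2) by (auto split: if_splits)
    then have "pairwise A {f, g, h, u}" using Qe(3-5) sym by (auto simp: pairwise_insert)
    moreover have "card {f, g, h, u} = 4" using Qe(1,2) u(2) by auto
    ultimately show ?thesis using Qe(9) u by (auto simp: clq4_def)
  qed
  have "dg A Q y \<noteq> 2" using low_outside_deg2_False [OF x y(1) p(1) _ y(2) p(2) Q out a] p(3) by blast
  moreover have "dg A Q p \<noteq> 2" using low_outside_deg2_False [OF x p(1) y(1) p(3) p(2) y(2) Q out(2,1) a(3,4,1,2)] by blast
  ultimately have "clq4 {f, g, h, y}" "clq4 {f, g, h, p}" using c4 y p out a by auto
  then show ?thesis using p s out Qe(2) unfolding Qe(1) by blast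
qed

text \<open>Every triangle has two vertices in \<open>T\<close>, the set \<open>S\<close> of common
  neighbours of \<open>T\<close> is independent, and low vertices have all their neighbours in
  \<open>S\<close>. For \<open>k \<ge> 4\<close> this permits deleting two cycles together with a
  second low vertex; for \<open>k = 3\<close> it bounds the number of vertices.\<close>

lemma low_False:
  assumes x0: "x0 \<in> V" "w x0 = -1"
  shows False
proof -
  obtain y0 where y0: "y0 \<in> V" "A x0 y0" using deg_ge2 [OF x0(1)] dg_pos [OF fin, of A x0] by auto
  obtain p0 \<delta> a b c where p0: "p0 \<in> V" "A x0 p0" "p0 \<noteq> y0" and s: "star {\<delta>, a, b, c} \<delta>"
    and ds: "distinct [\<delta>, a, b, c]" and out: "y0 \<notin> {\<delta>, a, b, c}" "p0 \<notin> {\<delta>, a, b, c}"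
    and K: "clq4 {a, b, c, y0}" "clq4 {a, b, c, p0}" using low_config_clq4 [OF x0 y0] by blast
  define T where "T = {a, b, c}"
  define S where "S = {u \<in> V. A u a \<and> A u b \<and> A u c}"
  have meet: False if "tri P" "u \<in> P" "v \<in> P" "u \<noteq> v" "u \<notin> T" "v \<notin> T" for P u v
    using K5m_meet [OF K p0(3) [symmetric] that(1-4)] that(5,6) by (simp add: T_def)
  have meet3: False if "A u v" "A u z" "A v z" "u \<in> V" "v \<in> V" "z \<in> V" "u \<notin> T" "v \<notin> T" for u v z
    using meet [of "{u, v, z}" u v] triI [of u v z] that neqD by auto
  have abc: "a \<noteq> b" "a \<noteq> c" "b \<noteq> c" using ds by auto
  have Ta: "A a b" "A a c" "A b c" "a \<in> V" "b \<in> V" "c \<in> V"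
    using clq4_adj [OF K(1)] clq4_sub [OF K(1)] abc by auto
  have tT: "tri T" unfolding T_def by (rule triI) (use Ta in auto)
  have TV: "T \<subseteq> V" using tT by (simp add: tri_def)
  have T3: "card T = 3" "finite T" using tT tri_finite by (auto simp: tri_def)
  have fS: "finite S" "S \<subseteq> V" using fin by (auto simp: S_def)
  have ST: "S \<inter> T = {}" using irr by (auto simp: S_def T_def)
  have inS: "y0 \<in> S" "p0 \<in> S" "\<delta> \<in> S"
  proof -
    show "y0 \<in> S" "p0 \<in> S"
      using clq4_adj [OF K(1), of y0] clq4_adj [OF K(2), of p0] y0 p0 out by (auto simp: S_def)
    have "clq4 {\<delta>, a, b, c}" using s by (simp add: star_def)
    then show "\<delta> \<in> S" using clq4_adj [of _ \<delta>] clq4_sub [of _ \<delta>] ds by (auto simp: S_def)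
  qed
  have Sindep: "\<not> A u v" if "u \<in> S" "v \<in> S" for u v
    using meet3 [of u v a] that ST by (auto simp: S_def Ta)
  have S_T: "\<not> A r z" if "r \<in> V" "r \<notin> T" "u \<in> S" "A r u" "z \<in> T" for r u z
    using meet3 [of r u z] that ST TV by (auto simp: S_def T_def)
  have cs: "slack = 0" "\<And>u. u \<in> T \<Longrightarrow> d u = 2 * k" "\<And>m. m \<in> M \<Longrightarrow> m = y0 \<or> m = p0"
    using low_config_star [OF x0 y0(1) p0(1) y0(2) p0(2) p0(3) [symmetric] s out] ds by (auto simp: T_def M_def)
  have MS: "M \<subseteq> S" using cs(3) inS by auto
  have cM: "card M \<le> 2"
  proof -
    have "card M \<le> card {y0, p0}" by (rule card_mono) (use cs(3) in auto)
    then show ?thesis by (simp add: card_insert_if split: if_splits)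
  qed
  have cS: "card S + 2 \<le> 2 * k"
  proof -
    have "S \<union> {b, c} \<subseteq> {u \<in> V. A a u}" using Ta sym by (auto simp: S_def)
    then have "card (S \<union> {b, c}) \<le> d a" unfolding dg_def using fin by (intro card_mono) auto
    moreover have "card (S \<union> {b, c}) = card S + 2"
      using ST fS abc by (subst card_Un_disjoint) (auto simp: T_def)
    ultimately show ?thesis using cs(2) [of a] by (simp add: T_def)
  qed
  \<comment> \<open>The K4 found at the edge \<open>xu\<close> yields a triangle \<open>T'\<close>
    complete to \<open>u\<close>, and \<open>T'\<close> turns out to be \<open>T\<close>.\<close>
  have LS: "u \<in> S" if l: "x \<in> L" "u \<in> V" "A x u" for x u
  proof -
    have x: "x \<in> V" "w x = -1" using l by (auto simp: L_def)
    obtain p \<delta>' a' b' c' where p: "p \<in> V" "A x p" "p \<noteq> u" and out': "u \<notin> {\<delta>', a', b', c'}" "p \<notin> {\<delta>', a', b', c'}"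
      and ds': "distinct [\<delta>', a', b', c']" and K': "clq4 {a', b', c', u}" "clq4 {a', b', c', p}"
      using low_config_clq4 [OF x l(2,3)] by blast
    define T' where "T' = {a', b', c'}"
    have t': "tri T'" by (rule clq4_tri [OF K'(1)]) (use ds' in \<open>auto simp: T'_def\<close>)
    have T'3: "card T' = 3" "finite T'" using t' tri_finite by (auto simp: tri_def)
    have ad: "A u z \<and> A p z" if "z \<in> T'" for z
      using that clq4_adj [OF K'(1), of u z] clq4_adj [OF K'(2), of p z] out' by (auto simp: T'_def)
    have "T' \<subseteq> T"
    proof
      fix r assume r: "r \<in> T'"
      show "r \<in> T"
      proof (rule ccontr)
        assume n: "r \<notin> T"
        have rest: "T' - {r} \<subseteq> T" using meet [OF t', of r] r n by blast
        \<comment> \<open>If \<open>T'\<close> left \<open>T\<close> at \<open>r\<close>, then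
          \<open>u\<close>, \<open>p\<close> and the other two vertices of \<open>T'\<close> would
          be four vertices of \<open>T\<close>.\<close>
        have up: "z \<in> T" if z: "z = u \<or> z = p" for z
        proof (rule ccontr)
          assume zn: "z \<notin> T"
          have "card (T' - {r}) = 2" using r T'3 by simp
          then have "T' - {r} \<noteq> {}" by (metis card.empty zero_neq_numeral)
          then obtain e where e: "e \<in> T'" "e \<noteq> r" by blast
          have "A r e" using tri_adj [OF t' r e(1)] e by auto
          moreover have "r \<in> V" "e \<in> V" "z \<in> V" using t' r e z p l by (auto simp: tri_def)
          ultimately show False using meet3 [of r z e] ad [of r] ad [of e] r e z zn n sym by blast
        qed
        have "card (insert u (insert p (T' - {r}))) = 4"
          using T'3 r out' p by (simp add: T'_def card_insert_if)
        moreover have "card (insert u (insert p (T' - {r}))) \<le> card T"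
          by (rule card_mono) (use T3 up rest in auto)
        ultimately show False using T3 by simp
      qed
    qed
    then have "T' = T" using card_subset_eq [of T T'] T3 T'3 by simp
    then show ?thesis using ad l by (auto simp: S_def T_def)
  qed
  have c3S: "3 \<le> card S"
  proof -
    have "card {\<delta>, y0, p0} \<le> card S" using inS fS by (intro card_mono) auto
    then show ?thesis using out p0(3) by (auto simp: card_insert_if split: if_splits)
  qed
  have LT: "L \<inter> T = {}" using low_no_tri [OF tT] by (auto simp: L_def)
  have LnS: "L \<inter> S = {}"
  proof -
    have False if "z \<in> L" "z \<in> S" for z
      using low_no_tri [of "{z, a, b}" z] triI [of z a b] that Ta by (auto simp: S_def L_def)
    then show ?thesis by auto
  qed
  \<comment> \<open>With a single low vertex there are at most \<open>2 * k + 4\<close> vertices,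
    too few for the disjoint neighbourhoods of \<open>y0\<close> and a high neighbour.\<close>
  have two: "2 \<le> card L"
  proof (rule ccontr)
    assume n: "\<not> ?thesis"
    have "L = {x0}"
    proof -
      have "x0 \<in> L" using x0 by (simp add: L_def)
      moreover have "card L \<le> card {x0}" using n by simp
      ultimately show ?thesis using card_seteq [of L "{x0}"] fin_LM by auto
    qed
    then have cV: "card V \<le> 2 * k + 4" using card_V cs(1) cM by simp
    have "w y0 \<noteq> -1" using inS(1) LnS y0 by (auto simp: L_def)
    then have dy: "2 * k - 1 \<le> d y0" using wgt_eq_m1 [of k "d y0"] k3 by simp
    have "dg A (insert x0 T) y0 \<le> card (insert x0 T)" using T3 by (intro dg_le_card) auto
    also have "\<dots> \<le> 4" using T3 by (simp add: card_insert_if)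
    finally have "dg A (insert x0 T) y0 < d y0" using dy k3 by simp
    then obtain u where u: "u \<in> V" "u \<notin> insert x0 T" "A y0 u"
      using dg_witness [of "insert x0 T" A y0 V] T3 by blast
    have "u \<notin> S" using Sindep inS(1) u by blast
    then have "2 * k \<le> d u" using high_deg [OF u(1)] MS \<open>L = {x0}\<close> u by blast
    moreover have "d y0 + d u \<le> card V"
    proof (rule disjoint_nbs_card [OF fin])
      show "{z \<in> V. A y0 z} \<inter> {z \<in> V. A u z} = {}"
        using meet3 [of y0 u] u y0 inS ST by auto
    qed
    ultimately show False using dy cV k3 by simp
  qed
  show False
  proof (cases "k = 3")
    case False
    then have k4: "4 \<le> k" using k3 by simp
    obtain x x' where xx: "x \<in> L" "x' \<in> L" "x \<noteq> x'" using two by (rule card_ge2E)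
    have x: "x \<in> V" "w x = -1" "x' \<in> V" "w x' = -1" using xx by (auto simp: L_def)
    \<comment> \<open>Taking the common neighbour of the two low vertices, if there is one, ensures
      that no undeleted vertex is adjacent to both.\<close>
    have "\<exists>y\<in>V. A x y \<and> (\<forall>u\<in>V. A x u \<longrightarrow> A x' u \<longrightarrow> u = y)"
    proof (cases "\<exists>u\<in>V. A x u \<and> A x' u")
      case True
      then show ?thesis using common_low_nbs [OF x xx(3)] by blast
    next
      case False
      moreover obtain y where "y \<in> V" "A x y" using deg_ge2 [OF x(1)] dg_pos [OF fin, of A x] by auto
      ultimately show ?thesis by blast
    qed
    then obtain y where y: "y \<in> V" "A x y" and sh: "\<And>u. u \<in> V \<Longrightarrow> A x u \<Longrightarrow> A x' u \<Longrightarrow> u = y" by blast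
    have "dg A {y} x < d x" using deg_ge2 [OF x(1)] y by simp
    then obtain p where p: "p \<in> V" "p \<noteq> y" "A x p" using dg_witness [of "{y}" A x V] by auto
    have yS: "y \<in> S" "p \<in> S" using LS [OF xx(1)] y p by auto
    have "\<not> S \<subseteq> {y, p}"
    proof
      assume "S \<subseteq> {y, p}"
      then have "card S \<le> card {y, p}" by (intro card_mono) auto
      then show False using c3S p(2) by simp
    qed
    then obtain u where u: "u \<in> S" "u \<noteq> y" "u \<noteq> p" by auto
    \<comment> \<open>Two disjoint cycles, to be deleted with the low \<open>x'\<close>: eight
      vertices, two of them low, weigh at most 4, which is the drop of the bound from
      \<open>k\<close> to \<open>k - 2\<close>.\<close>
    define B1 where "B1 = {x, y, a, p}"
    define B2 where "B2 = {b, c, u}"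
    define U where "U = V - insert x' (B1 \<union> B2)"
    have xnT: "x \<notin> S" "x' \<notin> S" "x \<notin> T" "x' \<notin> T" using xx LT LnS by auto
    have SnT: "y \<notin> T" "p \<notin> T" "u \<notin> T" using ST yS u by auto
    have c1: "core A B1" unfolding B1_def
      by (rule core_4 [OF S I y(2) _ _ sym [OF p(3)]]) (use yS sym p xnT in \<open>auto simp: S_def T_def\<close>)
    have t2: "tri B2" unfolding B2_def
      by (rule triI) (use Ta u sym in \<open>auto simp: S_def\<close>)
    have ds8: "distinct [x', x, y, a, p, b, c, u]"
      using xx(3) xnT SnT abc p(2) u yS u(1) by (auto simp: T_def)
    have W: "insert x' (B1 \<union> B2) = {x', x, y, a, p, b, c, u}" by (auto simp: B1_def B2_def)
    have WV: "insert x' (B1 \<union> B2) \<subseteq> V" using x y p u Ta fS by (auto simp: W)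
    have "wt A V k - sum w (V - U) + (\<Sum>v\<in>U. 0) \<le> wt A U (k - 2)"
    proof (rule wt_sub)
      fix v assume v: "v \<in> U"
      have vT: "v \<notin> T" "v \<in> V" using v by (auto simp: U_def W T_def)
      have dv: "dg A {x', x, y, a, p, b, c, u} v = (if A v x' then 1 else 0) + (if A v x then 1 else 0)
        + (if A v y then 1 else 0) + (if A v a then 1 else 0) + (if A v p then 1 else 0)
        + (if A v b then 1 else 0) + (if A v c then 1 else 0) + (if A v u then 1 else 0)"
        using ds8 by simp
      \<comment> \<open>A vertex of \<open>S\<close> has no neighbour in \<open>S\<close> and at
        most one of the two low ones; any other vertex has no low neighbour and not neighbours in
        both \<open>S\<close> and \<open>T\<close>.\<close>
      have "dg A {x', x, y, a, p, b, c, u} v \<le> 4"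
      proof (cases "v \<in> S")
        case True
        have "\<not> A v y" "\<not> A v p" "\<not> A v u" using Sindep True yS u(1) by auto
        moreover have "\<not> (A v x \<and> A v x')" using sh [OF vT(2)] sym v by (auto simp: U_def W)
        ultimately show ?thesis unfolding dv by simp
      next
        case False
        have nx: "\<not> A v x" "\<not> A v x'"
          using LS [OF xx(1) vT(2)] LS [OF xx(2) vT(2)] sym False by blast+
        show ?thesis
        proof (cases "A v y \<or> A v p \<or> A v u")
          case True
          then have "\<not> A v z" if "z \<in> T" for z
            using S_T [OF vT(2,1) _ _ that] yS u(1) by blast
          then have "\<not> A v a" "\<not> A v b" "\<not> A v c" by (simp_all add: T_def)
          then show ?thesis unfolding dv using nx by simp
        next
          case False
          then show ?thesis unfolding dv using nx by simp
        qed
      qed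
      moreover have "d v = dg A U v + dg A {x', x, y, a, p, b, c, u} v"
        unfolding U_def W by (rule dg_split [OF fin]) (use WV in \<open>simp add: W\<close>)
      ultimately show "w v + 0 \<le> wgt (k - 2) (dg A U v)"
        using wgt_shift [of 2 k "d v" "dg A U v"] k3 by simp
    qed (auto simp: U_def)
    moreover have "V - U = {x', x, y, a, p, b, c, u}" using WV by (auto simp: U_def W)
    moreover have "sum w {x', x, y, a, p, b, c, u} \<le> 4"
      using ds8 x wgt_le1 [of k "d y"] wgt_le1 [of k "d a"] wgt_le1 [of k "d p"] wgt_le1 [of k "d b"]
        wgt_le1 [of k "d c"] wgt_le1 [of k "d u"] by simp
    ultimately have "2 * int (k - 2) \<le> wt A U (k - 2)" using wV k3 by (simp add: of_nat_diff)
    moreover have "admissible (k - 2) A U"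
    proof (rule tri_rest_admissible [OF tT])
      show "U \<subseteq> V - T" by (auto simp: U_def W T_def)
    qed
    moreover have "card U < card V" by (rule card_less [of U x]) (use x in \<open>auto simp: U_def W\<close>)
    moreover have "finite U" using fin by (simp add: U_def)
    ultimately have "packs A U (k - 2)" using IH [of U A "k - 2"] S I k4 by simp
    then have "packs A (V - B1) (Suc (k - 2))"
      by (rule packs_add [OF tri_core [OF t2], rotated]) (use WV ds8 in \<open>auto simp: U_def W B1_def B2_def\<close>)
    then have "packs A V (Suc (Suc (k - 2)))"
      by (rule packs_add [OF c1, rotated]) (use WV W in auto)
    then show False using np k3 by (simp add: numeral_2_eq_2 Suc_diff_Suc)
  next
    case kk: True
    have S4: "card S \<le> 4" using cS kk by simp
    define R where "R = V - T - S - L"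
    have R: "finite R" "R \<subseteq> V" using fin by (auto simp: R_def)
    have cV: "int (card V) = 6 + int (card M) + 2 * int (card L)" using card_V cs(1) kk by simp
    have "card V = card T + card S + card L + card R"
    proof -
      have "V = T \<union> S \<union> L \<union> R" using TV fS by (auto simp: R_def L_def)
      also have "card \<dots> = card (T \<union> S \<union> L) + card R"
        using T3 fS fin_LM R by (intro card_Un_disjoint) (auto simp: R_def)
      also have "card (T \<union> S \<union> L) = card (T \<union> S) + card L"
        using T3 fS fin_LM LT LnS by (intro card_Un_disjoint) auto
      also have "card (T \<union> S) = card T + card S" using T3 fS ST by (intro card_Un_disjoint) auto
      finally show ?thesis .
    qed
    then have cR: "card R + card S = 3 + card M + card L" using cV T3 by simp
    have Rd: "6 \<le> d r" if "r \<in> R" for r using high_deg [of r] that MS kk by (auto simp: R_def)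
    have Rn: "z \<in> R \<union> S \<union> T" if "r \<in> R" "z \<in> V" "A r z" for r z
      using LS [of z r] that sym [OF that(3)] by (auto simp: R_def)
    have "R \<noteq> {}"
    proof
      assume "R = {}"
      then show False using cR S4 two by simp
    qed
    then obtain r where r: "r \<in> R" by auto
    \<comment> \<open>A vertex of \<open>R\<close> has neighbours in \<open>S\<close> or in
      \<open>T\<close>, but not in both.\<close>
    have "dg A (S \<union> T) r \<le> 4"
    proof (cases "\<exists>u\<in>S. A r u")
      case True
      then have "dg A (S \<union> T) r = dg A S r"
        using S_T [of r] r unfolding dg_def by (intro arg_cong [where f = card]) (auto simp: R_def)
      then show ?thesis using dg_le_card [OF fS(1), of A r] S4 by simp
    next
      case False
      then have "dg A (S \<union> T) r = dg A T r"
        unfolding dg_def by (intro arg_cong [where f = card]) auto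
      then show ?thesis using dg_le_card [OF T3(2), of A r] T3 by simp
    qed
    then have "dg A (S \<union> T) r < d r" using Rd [OF r] by simp
    then obtain r' where r': "r' \<in> V" "r' \<notin> S \<union> T" "A r r'" using dg_witness [of "S \<union> T" A r V] fS T3 by blast
    then have r'R: "r' \<in> R" using Rn [OF r] by blast
    have dis: "{z \<in> V. A r z} \<inter> {z \<in> V. A r' z} = {}"
      using meet3 [of r r'] r r' r'R by (auto simp: R_def)
    \<comment> \<open>Each low vertex selects two of its neighbours in \<open>S\<close>, and by
      \<open>common_low_nbs\<close> no pair is selected twice.\<close>
    have cLS: "card L \<le> card S choose 2"
    proof -
      have "\<exists>P. P \<subseteq> S \<and> card P = 2 \<and> P \<subseteq> {u \<in> V. A x u}" if "x \<in> L" for x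
      proof -
        have "2 \<le> card {u \<in> V. A x u}" using deg_ge2 [of x] that by (auto simp: L_def dg_def)
        then obtain P where "P \<subseteq> {u \<in> V. A x u}" "card P = 2" by (rule obtain_subset_with_card_n)
        then show ?thesis using LS [OF that] by blast
      qed
      then obtain P where P: "\<And>x. x \<in> L \<Longrightarrow> P x \<subseteq> S \<and> card (P x) = 2 \<and> P x \<subseteq> {u \<in> V. A x u}" by metis
      have "inj_on P L"
      proof (rule inj_onI, rule ccontr)
        fix x z assume xz: "x \<in> L" "z \<in> L" "P x = P z" "x \<noteq> z"
        obtain u u' where uu: "P x = {u, u'}" "u \<noteq> u'" using P [OF xz(1)] by (auto simp: card_2_iff)
        then show False using common_low_nbs [of x z u u'] P [OF xz(1)] P [OF xz(2)] xz by (auto simp: L_def)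
      qed
      then have "card L \<le> card {Z. Z \<subseteq> S \<and> card Z = 2}"
        by (rule card_inj_on_le) (use P fS in auto)
      then show ?thesis using n_subsets [OF fS(1), of 2] by simp
    qed
    have "card S = 3 \<or> card S = 4" using c3S S4 by auto
    then show False
    proof
      assume s3: "card S = 3"
      \<comment> \<open>On the other side, \<open>R\<close> and \<open>S\<close> have at most 3 + 2
        + 3 vertices together and \<open>T\<close> has 3, which makes 11.\<close>
      have "12 \<le> card (R \<union> S \<union> T)"
      proof -
        have "d r + d r' = card ({z \<in> V. A r z} \<union> {z \<in> V. A r' z})"
          using dis fin by (simp add: card_Un_disjoint dg_def)
        also have "\<dots> \<le> card (R \<union> S \<union> T)"
          using Rn [OF r] Rn [OF r'R] R fS T3 by (intro card_mono) auto
        finally show ?thesis using Rd [OF r] Rd [OF r'R] by simp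
      qed
      moreover have "card (R \<union> S \<union> T) \<le> card R + card S + card T"
        using card_Un_le [of "R \<union> S" T] card_Un_le [of R S] by simp
      moreover have "card L \<le> 3" using cLS s3 by (simp add: choose_two)
      ultimately show False using cR cM T3 by simp
    next
      assume s4: "card S = 4"
      \<comment> \<open>A vertex of \<open>T\<close> has degree 6, used up by the four vertices of
        \<open>S\<close> and the other two of \<open>T\<close>. This compensates for the larger
        bound on the number of low vertices.\<close>
      have RT: "\<not> A v z" if v: "v \<in> R" and z: "z \<in> T" for v z
      proof
        assume vz: "A v z"
        have "insert v (S \<union> (T - {z})) \<subseteq> {u \<in> V. A z u}"
          using vz v z sym R fS TV tri_adj [OF tT z] by (auto simp: S_def T_def)
        then have "card (insert v (S \<union> (T - {z}))) \<le> d z" unfolding dg_def using fin by (intro card_mono) auto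
        moreover have "card (insert v (S \<union> (T - {z}))) = Suc (card (S \<union> (T - {z})))"
          using v fS T3 by (simp add: R_def)
        moreover have "card (S \<union> (T - {z})) = card S + card (T - {z})"
          using ST fS T3 by (intro card_Un_disjoint) auto
        ultimately show False using cs(2) [OF z] s4 T3 z kk by simp
      qed
      have "12 \<le> card (R \<union> S)"
      proof -
        have "d r + d r' = card ({z \<in> V. A r z} \<union> {z \<in> V. A r' z})"
          using dis fin by (simp add: card_Un_disjoint dg_def)
        also have "\<dots> \<le> card (R \<union> S)"
          using Rn [OF r] Rn [OF r'R] RT [OF r] RT [OF r'R] R fS by (intro card_mono) auto
        finally show ?thesis using Rd [OF r] Rd [OF r'R] by simp
      qed
      moreover have "card (R \<union> S) \<le> card R + card S" by (rule card_Un_le)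
      moreover have "card L \<le> 6" using cLS s4 by (simp add: choose_two)
      ultimately show False using cR cM by simp
    qed
  qed
qed

lemma cex_False: False
proof (cases "\<exists>v\<in>V. w v = -1")
  case True
  then show ?thesis using low_False by blast
next
  case False
  then have "0 \<le> w v" if "v \<in> V" for v using wgt_cases [of k "d v"] that by force
  then show ?thesis by (rule no_low_False)
qed

end

text \<open>Induction on the number of vertices with relation and \<open>k\<close> arbitrary
  supplies the hypothesis \<open>IH\<close> of \<open>cex\<close>; the case \<open>k = 2\<close> is
  closed by \<open>two_cores\<close> alone.\<close>

lemma packs_if_admissible:
  assumes "finite V" "symp A" "irreflp A" "2 \<le> k" "admissible k A V" "2 * int k \<le> wt A V k"
  shows "packs A V k"
  using assms
proof (induction "card V" arbitrary: A V k rule: less_induct)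
  case less
  show ?case
  proof (cases "k = 2")
    case True
    then show ?thesis using two_cores [of V A] less.prems by (auto simp: admissible_def dense2_def)
  next
    case False
    show ?thesis
    proof (rule ccontr)
      assume "\<not> packs A V k"
      then interpret cex A V k
        using less False by unfold_locales (auto simp: admissible_def)
      show False by (rule cex_False)
    qed
  qed
qed

section \<open>Cycles from cores\<close>

lemma packs_family:
  "packs A V k \<Longrightarrow> \<exists>C. (\<forall>i<k. core A (C i) \<and> C i \<subseteq> V) \<and> disjoint_family_on C {..<k}"
proof (induction k arbitrary: V)
  case 0
  then show ?case by (simp add: disjoint_family_on_def)
next
  case (Suc k)
  then obtain B where B: "B \<subseteq> V" "core A B" "packs A (V - B) k" by auto
  obtain C where C: "\<And>i. i < k \<Longrightarrow> core A (C i) \<and> C i \<subseteq> V - B" "disjoint_family_on C {..<k}"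
    using Suc.IH [OF B(3)] by auto
  have "disjoint_family_on (C(k := B)) {..<Suc k}"
    unfolding disjoint_family_on_def
  proof (intro ballI impI)
    fix m n assume mn: "m \<in> {..<Suc k}" "n \<in> {..<Suc k}" "m \<noteq> n"
    then consider "m = k" "n < k" | "n = k" "m < k" | "m < k" "n < k" by (auto simp: less_Suc_eq)
    then show "(C(k := B)) m \<inter> (C(k := B)) n = {}"
    proof cases
      case 1 then show ?thesis using C(1) [of n] by auto
    next
      case 2 then show ?thesis using C(1) [of m] by auto
    next
      case 3 then show ?thesis using disjoint_family_onD [OF C(2), of m n] mn(3) by simp
    qed
  qed
  moreover have "core A ((C(k := B)) i) \<and> (C(k := B)) i \<subseteq> V" if "i < Suc k" for i
    using C(1) [of i] B that by (auto simp: less_Suc_eq)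
  ultimately show ?case by blast
qed

text \<open>In a longest path the neighbours of the first vertex all lie on the path.\<close>
lemma core_closed_path:
  assumes "core A B" and S: "symp A" and I: "irreflp A"
  obtains xs where "distinct xs" "3 \<le> length xs" "set xs \<subseteq> B" "successively A xs" "A (last xs) (hd xs)"
proof -
  define P where "P = {xs. distinct xs \<and> set xs \<subseteq> B \<and> successively A xs \<and> xs \<noteq> []}"
  have fB: "finite B" using assms(1) by (simp add: core_def)
  have bd: "length xs < Suc (card B)" if "xs \<in> P" for xs
    using that card_mono [OF fB, of "set xs"] by (simp add: P_def distinct_card less_Suc_eq_le)
  obtain b where "b \<in> B" using assms(1) by (auto simp: core_def)
  then have "[b] \<in> P" by (simp add: P_def)
  then obtain xs where xs: "xs \<in> P" and mx: "\<And>ys. ys \<in> P \<Longrightarrow> length ys \<le> length xs"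
    using ex_has_greatest_nat [of "\<lambda>xs. xs \<in> P" "[b]" length "Suc (card B)"] bd by (meson less_imp_le)
  obtain x ys where x: "xs = x # ys" using xs by (cases xs) (auto simp: P_def)
  have nb: "u \<in> set ys" if "u \<in> B" "A x u" for u
  proof (rule ccontr)
    assume "u \<notin> set ys"
    then have "u # xs \<in> P"
      using xs that x irreflpD [OF I, of x] sympD [OF S that(2)] by (auto simp: P_def)
    then show False using mx [of "u # xs"] by simp
  qed
  have "x \<in> B" using xs x by (simp add: P_def)
  then have "2 \<le> dg A B x" using assms(1) by (simp add: core_def)
  then obtain y p where yp: "y \<in> B" "p \<in> B" "y \<noteq> p" "A x y" "A x p" by (rule dg_ge2E)
  \<comment> \<open>A neighbour other than the second vertex of the path closes a cycle of length at
    least 3.\<close>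
  then obtain u where u: "u \<in> B" "A x u" "u \<noteq> hd ys" by metis
  obtain us vs where ys: "ys = us @ u # vs" using nb [OF u(1,2)] by (auto dest: split_list)
  have "us \<noteq> []" using u(3) ys by auto
  define zs where "zs = x # us @ [u]"
  have zx: "xs = zs @ vs" by (simp add: zs_def x ys)
  show ?thesis
  proof (rule that [of zs])
    show "distinct zs" "set zs \<subseteq> B" "successively A zs"
      using xs unfolding zx by (auto simp: P_def successively_append_iff)
    show "3 \<le> length zs" using \<open>us \<noteq> []\<close> by (cases us) (auto simp: zs_def)
    show "A (last zs) (hd zs)" using sympD [OF S u(2)] by (simp add: zs_def)
  qed
qed

section \<open>From closed vertex lists to arc walks\<close>

definition closing_arcs :: "'a list \<Rightarrow> ('a \<times> 'a) list" where
  "closing_arcs xs = zip xs (tl xs @ [hd xs])"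

text \<open>The final vertex \<open>w\<close> is kept apart from \<open>hd xs\<close>, because the
  head changes in the induction over the list.\<close>

lemma zip_path:
  assumes "xs \<noteq> []"
  shows "pcas (hd xs) (zip xs (tl xs @ [w])) w"
    "pawalk_verts (hd xs) (zip xs (tl xs @ [w])) = xs @ [w]"
    "successively A xs \<Longrightarrow> A (last xs) w \<Longrightarrow> e \<in> set (zip xs (tl xs @ [w])) \<Longrightarrow> A (fst e) (snd e)"
  using assms by (induction xs rule: induct_list012) auto

lemma ugraph_cycle_closing_arcs:
  assumes "\<And>u v. A u v \<longleftrightarrow> (u, v) \<in> parcs G" "set xs \<subseteq> pverts G" "distinct xs" "3 \<le> length xs"
    "successively A xs" "A (last xs) (hd xs)"
  shows "ugraph_cycle G (closing_arcs xs)" "cycle_verts (closing_arcs xs) = set xs"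
    "length (closing_arcs xs) = length xs"
proof -
  have ne: "xs \<noteq> []" using assms(4) by auto
  show len: "length (closing_arcs xs) = length xs" using ne by (simp add: closing_arcs_def)
  have "fst ` set (closing_arcs xs) = set (map fst (closing_arcs xs))" by simp
  also have "map fst (closing_arcs xs) = xs" using ne by (simp add: closing_arcs_def)
  finally show "cycle_verts (closing_arcs xs) = set xs" by (simp add: cycle_verts_def)
  have "(fst e, snd e) \<in> parcs G" if "e \<in> set (closing_arcs xs)" for e
    using zip_path(3) [OF ne assms(5,6)] that assms(1) by (simp add: closing_arcs_def)
  then have "set (closing_arcs xs) \<subseteq> parcs G" by auto
  moreover have "hd xs \<in> pverts G" using ne assms(2) by auto
  moreover have "pcas (hd xs) (closing_arcs xs) (hd xs)" "pawalk_verts (hd xs) (closing_arcs xs) = xs @ [hd xs]"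
    using zip_path(1,2) [OF ne, of "hd xs"] by (simp_all add: closing_arcs_def)
  moreover have "distinct (tl (xs @ [hd xs]))" using ne assms(3) by (cases xs) auto
  ultimately have "pre_digraph.cycle (with_proj G) (closing_arcs xs)"
    using len assms(4) unfolding pre_digraph.cycle_def pre_digraph.awalk_def
    by (auto simp: cas_with_proj_eq awalk_verts_with_proj_eq)
  then show "ugraph_cycle G (closing_arcs xs)" using len assms(4) by (simp add: ugraph_cycle_def)
qed

theorem theorem1p8:
  fixes G :: "'a pair_pre_digraph" and k :: nat
  assumes "k \<ge> 3"
    and "pair_graph G"
    and "\<not> (\<exists>p q. triangle G p \<and> triangle G q \<and> cycle_verts p \<inter> cycle_verts q = {})"
    and "int (card (high_verts k G)) - int (card (low_verts k G)) \<ge> 2 * int k"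
  shows "has_disjoint_cycles k G"
proof -
  interpret pair_graph G by (rule assms(2))
  define A where "A u v \<longleftrightarrow> (u, v) \<in> parcs G" for u v
  define V where "V = pverts G"
  have fin: "finite V" using pair_finite_verts by (simp add: V_def)
  have S: "symp A" using pair_sym_arcs by (auto simp: A_def symp_def symmetric_def dest: symD)
  have I: "irreflp A" using pair_no_loops by (fastforce simp: A_def irreflp_def)
  have deg: "out_degree (with_proj G) v = dg A V v" for v
  proof -
    have "out_arcs (with_proj G) v = Pair v ` {u \<in> V. A v u}"
      using in_arcsD2 by (auto simp: A_def V_def out_arcs_def)
    then show ?thesis by (simp add: out_degree_def dg_def card_image inj_on_def)
  qed
  have wt: "wt A V k = int (card (high_verts k G)) - int (card (low_verts k G))"
  proof -
    have "wt A V k = (\<Sum>v\<in>V. (if 2 * k \<le> dg A V v then 1 else 0) - (if dg A V v \<le> 2 * k - 2 then 1 else 0))"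
      unfolding wt_def using assms(1) by (intro sum.cong) (auto simp: wgt_def sgn_if)
    also have "\<dots> = int (card {v \<in> V. 2 * k \<le> dg A V v}) - int (card {v \<in> V. dg A V v \<le> 2 * k - 2})"
      using fin by (simp add: sum_subtractf sum.If_cases Int_def)
    finally show ?thesis by (simp add: high_verts_def low_verts_def deg V_def)
  qed
  have cyc: "\<exists>p. triangle G p \<and> cycle_verts p = T" if T: "T \<subseteq> V" "card T = 3" "pairwise A T" for T
  proof -
    obtain a b c where abc: "T = {a, b, c}" "a \<noteq> b" "a \<noteq> c" "b \<noteq> c" using T(2) by (rule card3E)
    have "A a b" "A b c" "A c a" using T(3) abc by (auto simp: pairwise_def)
    then show ?thesis
      using ugraph_cycle_closing_arcs [of A G "[a, b, c]"] T(1) abc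
      by (intro exI [of _ "closing_arcs [a, b, c]"]) (auto simp: A_def V_def triangle_def)
  qed
  have "tri_meeting A V"
    unfolding tri_meeting_def using cyc assms(3) by metis
  then have "packs A V k"
    using packs_if_admissible [OF fin S I, of k] wt assms(1,4) by (simp add: admissible_def)
  then obtain C where C: "\<And>i. i < k \<Longrightarrow> core A (C i) \<and> C i \<subseteq> V" "disjoint_family_on C {..<k}"
    using packs_family by blast
  \<comment> \<open>A cycle inside each core suffices, as disjointness passes to subsets.\<close>
  have "\<exists>p. ugraph_cycle G p \<and> cycle_verts p \<subseteq> C i" if i: "i < k" for i
  proof -
    obtain xs where xs: "distinct xs" "3 \<le> length xs" "set xs \<subseteq> C i" "successively A xs" "A (last xs) (hd xs)"
      using core_closed_path [OF _ S I, of "C i"] C(1) [OF i] by blast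
    have "set xs \<subseteq> pverts G" using xs C(1) [OF i] by (auto simp: V_def)
    then show ?thesis
      using ugraph_cycle_closing_arcs [of A G xs] xs by (auto simp: A_def)
  qed
  then obtain P where P: "\<And>i. i < k \<Longrightarrow> ugraph_cycle G (P i) \<and> cycle_verts (P i) \<subseteq> C i" by metis
  have "disjoint_family_on (\<lambda>i. cycle_verts (P i)) {..<k}"
    using C(2) P unfolding disjoint_family_on_def lessThan_iff by blast
  then show ?thesis using P unfolding has_disjoint_cycles_def by blast
qed

end
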